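(* For all $\varepsilon>0$ and $R>0$ there exist $M=M(\varepsilon)>0$ and $\delta_0=\delta_0(\varepsilon,R)>0$ such that the following holds for all $\delta\in(0,\delta_0]$. Let $L\subset \mathcal{L}_{SL_2}\cap B(0,R)$ (a finite set) satisfy the two-dimensional ball condition $$\#(L\cap B)\le (r/\delta)^2\quad\text{for all } r\in[\delta,1] \text{ and all balls } B\subset\mathbb{R}^4 \text{ of radius } r.$$ Let $E\subset B(0,R)\subset\mathbb{R}^3$ be a union of $\delta$-cubes, and suppose $|\ell\cap E|\ge\lambda$ for each $\ell\in L$. Then $$|E|\ge \delta^{\varepsilon}\lambda^{M}\,(\delta^2\,\#L).$$
   Context: For $(a,b,c,d)\in\mathbb{R}^4$ with $ad-bc=1$, let $\ell_{(a,b,c,d)}=\{(a,b,0)+s(c,d,1): s\in\mathbb{R}\}\subset\mathbb{R}^3$, and let $\mathcal{L}_{SL_2}$ be the set of all such lines. Each line $\ell_{(a,b,c,d)}$ is identified with the point $(a,b,c,d)\in\mathbb{R}^4$; thus $\mathcal{L}_{SL_2}\cap B(0,R)$ means the lines whose parameter $(a,b,c,d)$ lies in the ball $B(0,R)\subset\mathbb{R}^4$, and $L\cap B$ for a ball $B\subset\mathbb{R}^4$ refers to parameters. $|\ell\cap E|$ denotes the one-dimensional Lebesgue measure of $\ell\cap E$, and $|E|$ the three-dimensional Lebesgue measure. *)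

theory Defs
  imports "HOL-Analysis.Analysis"
begin

definition SL2_param :: "real^4 \<Rightarrow> bool" where
  "SL2_param p \<longleftrightarrow> p$1 * p$4 - p$2 * p$3 = 1"

definition line_of :: "real^4 \<Rightarrow> real \<Rightarrow> real^3" where
  "line_of p s = vector [p$1 + s * p$3, p$2 + s * p$4, s]"

definition SL2_line :: "real^4 \<Rightarrow> (real^3) set" where
  "SL2_line p = range (line_of p)"

text \<open>One-dimensional Lebesgue (arc-length) measure of l_p \<inter> E, via the
  affine parametrisation s \<mapsto> (a,b,0)+s(c,d,1), whose speed is |(c,d,1)|.\<close>
definition line_meas :: "real^4 \<Rightarrow> (real^3) set \<Rightarrow> real" where
  "line_meas p E = sqrt ((p$3)\<^sup>2 + (p$4)\<^sup>2 + 1) * measure lebesgue {s. line_of p s \<in> E}"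

definition delta_cube :: "real \<Rightarrow> int^3 \<Rightarrow> (real^3) set" where
  "delta_cube \<delta> k = {x. \<forall>i. \<delta> * of_int (k$i) \<le> x$i \<and> x$i \<le> \<delta> * (of_int (k$i) + 1)}"

definition union_of_delta_cubes :: "real \<Rightarrow> (real^3) set \<Rightarrow> bool" where
  "union_of_delta_cubes \<delta> E \<longleftrightarrow> (\<exists>K. E = (\<Union>k\<in>K. delta_cube \<delta> k))"

end

theory Submission
  imports Defs "HOL-Probability.Sinc_Integral"
begin

text \<open>Where \<open>d\<close> is not small, an \<open>SL\<^sub>2\<close> line is the graph \<open>y \<mapsto> (x, t) = (W + C y, W y - B)\<close> with
  \<open>(B, C, W) = (b / d, c / d, 1 / d)\<close>, so that \<open>\<bar>\<ell> \<inter> E\<bar>\<close> becomes a function \<open>F\<close> of \<open>(B, C, W) \<in> \<real>\<^sup>3\<close>: an integral over \<open>y\<close>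
  of functions of the linear projections \<open>(W + C y, W y - B)\<close>. The spectrum of \<open>F\<close> lies in the union of
  the planes spanned by \<open>(-1, y\<^sup>2, 2 y)\<close> and \<open>(0, y, 1)\<close>, which are tangent to a light cone. Decompose \<open>F\<close>
  according to the position \<open>s (-1, y\<^sup>2, 2 y) + t (0, y, 1)\<close> of the frequency, \<open>\<bar>s\<bar> \<sim> V\<close> and \<open>\<bar>t\<bar> \<sim> \<rho>\<close>. Far
  from the cone (\<open>\<rho> \<sim> V\<close>) each frequency lies in boundedly many planes, and orthogonality gives
  \<open>\<integral> \<bar>F\<bar>\<^sup>2 \<lesssim> \<bar>E\<bar> / \<rho>\<close>. Near the cone, \<open>L\<^sup>4\<close> decoupling into arcs of \<open>y\<close> of length \<open>\<sigma> = max \<rho> (sqrt V) / V\<close>,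
  together with the same orthogonality and the trivial bound \<open>\<sigma>\<close> on each arc, gives \<open>\<integral> \<bar>F\<bar>\<^sup>4 \<lesssim> \<bar>E\<bar> / V\<close>. Since
  \<open>F\<close> is constant at scale \<open>1 / V\<close> and the lines are two-dimensionally spaced, both bounds limit the number
  of lines with \<open>F \<ge> \<lambda>\<close> to \<open>\<delta>\<^sup>-\<^sup>2 \<bar>E\<bar>\<close> up to powers of \<open>\<lambda>\<close> and \<open>\<delta>\<^sup>-\<^sup>\<epsilon>\<close>. The decoupling is elementary: passing
  from one angular scale to the next uses only that two numbers are determined by their sum and
  their sum of squares.\<close>

section \<open>The Fejer kernel\<close>

text \<open>Every decoupling step costs an absolute factor (578), so with a fixed ratio between
  consecutive angular scales the log (1 / delta) steps would lose a fixed power of delta. The ratio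
  is therefore an integer k with k^(2 (n + 2)) comparable to 1 / delta, where n exceeds 128 /
  epsilon: there are at most n + 3 steps, their total cost is a constant, and every other loss may
  be crude as long as it is a power of k, in the end \<open>k ^ 128\<close>. All localisation rests
  on one kernel, the squared sinc. It is nonnegative, at least 1/2 near 0, integrable, and its
  Fourier transform has compact support. Hence it can be the weight that makes separated spectra
  exactly orthogonal, the substitute for the indicator of a cube, and the envelope of a wave packet.
  No general Fourier transform is taken: spectra are read off from approximating trigonometric sums,
  and the sinc function is itself a limit of such sums.\<close>

definition snc :: "real \<Rightarrow> real" where
  "snc x = (if x = 0 then 1 else sin x / x)"

definition fejer :: "real \<Rightarrow> real" where
  "fejer x = (snc x)\<^sup>2"

text \<open>Dirichlet kernel with symmetric nodes: multiplication by 2 i sin z = cis z - cis (-z)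
  makes the sum telescope.\<close>

lemma sin_mult_sum_cis:
  "of_real (sin z) * (\<Sum>j<K. cis ((2 * real j + 1 - real K) * z)) = complex_of_real (sin (real K * z))"
proof -
  have tw: "2 * \<i> * complex_of_real (sin t) = cis t - cis (- t)" for t
    by (simp add: complex_eq_iff)
  have "2 * \<i> * (complex_of_real (sin z) * (\<Sum>j<K. cis ((2 * real j + 1 - real K) * z)))
      = (\<Sum>j<K. (cis z - cis (- z)) * cis ((2 * real j + 1 - real K) * z))"
    by (subst tw[symmetric]) (simp add: sum_distrib_left mult_ac)
  also have "\<dots> = (\<Sum>j<K. cis ((2 * real (Suc j) - real K) * z) - cis ((2 * real j - real K) * z))"
    by (intro sum.cong refl) (simp add: left_diff_distrib cis_mult algebra_simps)
  also have "\<dots> = cis (real K * z) - cis (- (real K * z))"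
    by (subst sum_lessThan_telescope) (simp add: algebra_simps)
  also have "\<dots> = 2 * \<i> * complex_of_real (sin (real K * z))"
    by (rule tw[symmetric])
  finally show ?thesis by simp
qed

text \<open>Used in two ways: with z = x / K and K tending to infinity it exhibits
  \<open>snc\<close> as a limit of trigonometric sums, and with K fixed it splits a wide kernel into
  narrow modulated ones (\<open>kf_refine\<close>).\<close>

lemma snc_mult_nat:
  assumes "K > 0"
  shows "complex_of_real (snc (real K * z)) =
    (\<Sum>j<K. cis ((2 * real j + 1 - real K) * z)) * of_real (snc z) / of_nat K"
proof (cases "z = 0")
  case False
  then show ?thesis
    using sin_mult_sum_cis[of z K] assms
    by (simp add: snc_def divide_simps mult_ac)
qed (use assms in \<open>simp add: snc_def\<close>)

lemma tendsto_snc_0: "(snc \<longlongrightarrow> 1) (at 0)"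
proof -
  have "((\<lambda>x::real. sin x / x) \<longlongrightarrow> 1) (at 0)"
    using DERIV_sin[of 0] by (simp add: has_field_derivative_iff)
  then show ?thesis
    by (rule Lim_transform_eventually) (auto simp: snc_def eventually_at intro!: exI[of _ 1])
qed

text \<open>The midpoint rule with n + 1 nodes for half the integral of cis (t x) over t in [-1, 1],
  which is \<open>snc x\<close>. All frequencies lie in [-1, 1].\<close>

definition dmean :: "nat \<Rightarrow> real \<Rightarrow> complex" where
  "dmean n x = (\<Sum>j<Suc n. cis ((2 * real j + 1 - real (Suc n)) / real (Suc n) * x)) / of_nat (Suc n)"

lemma dmean_tendsto: "(\<lambda>n. dmean n x) \<longlonglongrightarrow> complex_of_real (snc x)"
proof -
  have eq: "complex_of_real (snc x) = dmean n x * of_real (snc (x / real (Suc n)))" for n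
    using snc_mult_nat[of "Suc n" "x / real (Suc n)"]
    by (simp add: dmean_def del: of_nat_Suc)
  have "isCont snc 0"
    using tendsto_snc_0 by (simp add: isCont_def snc_def)
  moreover have "(\<lambda>n. x / real (Suc n)) \<longlonglongrightarrow> 0"
    by (rule LIMSEQ_Suc[OF lim_const_over_n])
  ultimately have "(\<lambda>n. snc (x / real (Suc n))) \<longlonglongrightarrow> snc 0"
    by (rule isCont_tendsto_compose)
  then have s1: "(\<lambda>n. complex_of_real (snc (x / real (Suc n)))) \<longlonglongrightarrow> 1"
    using tendsto_of_real[of "\<lambda>n. snc (x / real (Suc n))" "snc 0"] by (simp add: snc_def)
  have "(\<lambda>n. of_real (snc x) / complex_of_real (snc (x / real (Suc n)))) \<longlonglongrightarrow> of_real (snc x) / 1"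
    by (intro tendsto_divide tendsto_const s1) simp
  moreover have "eventually (\<lambda>n. complex_of_real (snc (x / real (Suc n))) \<noteq> 0) sequentially"
    by (rule tendsto_imp_eventually_ne[OF s1]) simp
  then have "eventually (\<lambda>n. of_real (snc x) / complex_of_real (snc (x / real (Suc n))) = dmean n x) sequentially"
    by eventually_elim (use eq in \<open>simp add: field_simps\<close>)
  ultimately show ?thesis
    by (simp add: Lim_transform_eventually)
qed

lemma norm_cis_diff_le: "norm (cis a - cis b) \<le> \<bar>a - b\<bar>"
proof -
  have "cis a - cis b = cis ((a + b) / 2) * (2 * \<i> * of_real (sin ((a - b) / 2)))"
  proof -
    have "2 * \<i> * complex_of_real (sin t) = cis t - cis (- t)" for t
      by (simp add: complex_eq_iff)
    then have "cis ((a + b) / 2) * (2 * \<i> * of_real (sin ((a - b) / 2)))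
        = cis ((a + b) / 2) * (cis ((a - b) / 2) - cis (- ((a - b) / 2)))"
      by metis
    also have "\<dots> = cis a - cis b"
      by (simp add: right_diff_distrib cis_mult add_divide_distrib diff_divide_distrib)
    finally show ?thesis by simp
  qed
  then have "norm (cis a - cis b) = 2 * \<bar>sin ((a - b) / 2)\<bar>"
    by (simp add: norm_mult)
  also have "\<dots> \<le> 2 * \<bar>(a - b) / 2\<bar>"
    by (intro mult_left_mono abs_sin_x_le_abs_x) auto
  finally show ?thesis by simp
qed

lemma dirichlet_node_le: "j < Suc n \<Longrightarrow> \<bar>(2 * real j + 1 - real (Suc n)) / real (Suc n)\<bar> \<le> 1"
  by (auto simp: divide_simps)

lemma norm_dmean_le: "norm (dmean n x) \<le> 1"
proof -
  have "norm (\<Sum>j<Suc n. cis ((2 * real j + 1 - real (Suc n)) / real (Suc n) * x)) \<le> (\<Sum>j<Suc n. 1)"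
    by (rule order_trans[OF norm_sum]) simp
  then show ?thesis
    by (simp add: dmean_def norm_divide divide_simps del: of_nat_Suc)
qed

lemma dmean_lipschitz: "norm (dmean n x - dmean n y) \<le> \<bar>x - y\<bar>"
proof -
  have "norm (\<Sum>j<Suc n. cis ((2 * real j + 1 - real (Suc n)) / real (Suc n) * x)
      - cis ((2 * real j + 1 - real (Suc n)) / real (Suc n) * y)) \<le> (\<Sum>j<Suc n. \<bar>x - y\<bar>)"
  proof (rule order_trans[OF norm_sum], rule sum_mono)
    fix j assume "j \<in> {..<Suc n}"
    define t where "t = (2 * real j + 1 - real (Suc n)) / real (Suc n)"
    have "\<bar>t\<bar> \<le> 1" using dirichlet_node_le[of j n] \<open>j \<in> _\<close> by (simp add: t_def)
    have "norm (cis (t * x) - cis (t * y)) \<le> \<bar>t\<bar> * \<bar>x - y\<bar>"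
      using norm_cis_diff_le[of "t * x" "t * y"] by (simp add: right_diff_distrib[symmetric] abs_mult)
    also have "\<dots> \<le> \<bar>x - y\<bar>"
      using \<open>\<bar>t\<bar> \<le> 1\<close> by (simp add: mult_left_le_one_le)
    finally show "norm (cis ((2 * real j + 1 - real (Suc n)) / real (Suc n) * x)
      - cis ((2 * real j + 1 - real (Suc n)) / real (Suc n) * y)) \<le> \<bar>x - y\<bar>"
      by (simp add: t_def)
  qed
  then show ?thesis
    by (simp add: dmean_def norm_divide divide_simps sum_subtractf diff_divide_distrib[symmetric] mult.commute
        del: of_nat_Suc sum.lessThan_Suc)
qed

text \<open>This bound and the Lipschitz bound after it are obvious for the means
  \<open>dmean\<close> and survive the limit.\<close>

lemma abs_snc_le_1: "\<bar>snc x\<bar> \<le> 1"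
proof -
  have "norm (complex_of_real (snc x)) \<le> 1"
    by (rule Lim_bounded[OF tendsto_norm[OF dmean_tendsto]]) (simp add: norm_dmean_le)
  then show ?thesis by simp
qed

lemma snc_lipschitz: "\<bar>snc x - snc y\<bar> \<le> \<bar>x - y\<bar>"
proof -
  have "norm (complex_of_real (snc x) - complex_of_real (snc y)) \<le> \<bar>x - y\<bar>"
    by (rule Lim_bounded[OF tendsto_norm[OF tendsto_diff[OF dmean_tendsto dmean_tendsto]]])
      (simp add: dmean_lipschitz)
  then show ?thesis
    by (metis norm_of_real of_real_diff)
qed

lemma mult_snc: "x * snc x = sin x"
  by (simp add: snc_def)

lemma snc_decay: "\<bar>snc x\<bar> \<le> 2 / (1 + \<bar>x\<bar>)"
proof -
  have "\<bar>x\<bar> * \<bar>snc x\<bar> \<le> 1"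
    by (metis abs_mult mult_snc abs_sin_le_one)
  then show ?thesis
    using abs_snc_le_1[of x] by (simp add: field_simps)
qed

text \<open>The identity x (snc x - snc y) = sin x - sin y - (x - y) snc y exchanges a factor x for
  two Lipschitz bounds, so no derivative of sin x / x is estimated.\<close>

lemma snc_lipschitz_decay: "\<bar>snc x - snc y\<bar> \<le> 3 * \<bar>x - y\<bar> / (1 + \<bar>x\<bar>)"
proof -
  have "x * (snc x - snc y) = (sin x - sin y) - (x - y) * snc y"
    using mult_snc[of x] mult_snc[of y] by (simp add: algebra_simps)
  moreover have "\<bar>sin x - sin y\<bar> \<le> \<bar>x - y\<bar>"
  proof -
    have "\<bar>Im (cis x - cis y)\<bar> \<le> \<bar>x - y\<bar>"
      using abs_Im_le_cmod[of "cis x - cis y"] norm_cis_diff_le[of x y] by linarith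
    then show ?thesis by simp
  qed
  moreover have "\<bar>(x - y) * snc y\<bar> \<le> \<bar>x - y\<bar>"
    using abs_snc_le_1[of y] by (simp add: abs_mult mult_left_le)
  ultimately have "\<bar>x * (snc x - snc y)\<bar> \<le> 2 * \<bar>x - y\<bar>"
    using abs_triangle_ineq4[of "sin x - sin y" "(x - y) * snc y"] by simp
  then have "(1 + \<bar>x\<bar>) * \<bar>snc x - snc y\<bar> \<le> 3 * \<bar>x - y\<bar>"
    using snc_lipschitz[of x y] by (simp add: distrib_right abs_mult)
  then show ?thesis
    by (simp add: pos_le_divide_eq mult.commute)
qed

lemma continuous_snc: "continuous_on A snc"
  by (rule continuous_on_subset[of UNIV])
    (auto intro!: lipschitz_on_continuous_on[of 1] snc_lipschitz simp: lipschitz_on_def dist_real_def)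

lemma fejer_nonneg [simp]: "0 \<le> fejer x"
  by (simp add: fejer_def)

lemma fejer_le_1: "fejer x \<le> 1"
  using abs_snc_le_1[of x] by (simp add: fejer_def abs_square_le_1)

lemma one_plus_abs_square_ge: "1 + x\<^sup>2 \<le> (1 + \<bar>x\<bar>)\<^sup>2" for x :: real
  by (simp add: power2_eq_square algebra_simps flip: abs_mult)

lemma fejer_decay: "fejer x \<le> 4 / (1 + x\<^sup>2)"
proof -
  have "fejer x \<le> (2 / (1 + \<bar>x\<bar>))\<^sup>2"
    unfolding fejer_def using snc_decay[of x] by (metis abs_ge_zero power2_abs power_mono)
  also have "\<dots> = 4 / (1 + \<bar>x\<bar>)\<^sup>2"
    by (simp add: power_divide)
  also have "\<dots> \<le> 4 / (1 + x\<^sup>2)"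
    using one_plus_abs_square_ge[of x] by (intro divide_left_mono) (auto intro!: mult_pos_pos add_pos_nonneg)
  finally show ?thesis .
qed

text \<open>The increment keeps the quadratic decay of the kernel itself, so that increments can be
  summed over a lattice as well as values.\<close>

lemma fejer_lipschitz_decay:
  assumes "\<bar>x - y\<bar> \<le> 1"
  shows "\<bar>fejer x - fejer y\<bar> \<le> 18 * \<bar>x - y\<bar> / (1 + x\<^sup>2)"
proof -
  have "\<bar>snc y\<bar> \<le> 2 / (1 + \<bar>y\<bar>)" by (rule snc_decay)
  also have "\<dots> \<le> 2 / ((1 + \<bar>x\<bar>) / 2)"
    using assms by (intro divide_left_mono) auto
  finally have "\<bar>snc x + snc y\<bar> \<le> 6 / (1 + \<bar>x\<bar>)"
    using snc_decay[of x] abs_triangle_ineq[of "snc x" "snc y"] by (simp add: add_divide_distrib[symmetric])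
  then have "\<bar>snc x - snc y\<bar> * \<bar>snc x + snc y\<bar> \<le> 3 * \<bar>x - y\<bar> / (1 + \<bar>x\<bar>) * (6 / (1 + \<bar>x\<bar>))"
    by (intro mult_mono snc_lipschitz_decay) auto
  also have "\<dots> = 18 * \<bar>x - y\<bar> / (1 + \<bar>x\<bar>)\<^sup>2"
    by (simp add: power2_eq_square)
  also have "\<dots> \<le> 18 * \<bar>x - y\<bar> / (1 + x\<^sup>2)"
    using one_plus_abs_square_ge[of x] by (intro divide_left_mono) (auto intro!: mult_pos_pos add_pos_nonneg)
  finally show ?thesis
    by (simp add: fejer_def power2_eq_square square_diff_square_factored abs_mult mult_ac)
qed

lemma fejer_ge_half:
  assumes "\<bar>x\<bar> \<le> 1/4"
  shows "1/2 \<le> fejer x"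
proof -
  have "3/4 \<le> snc x"
    using snc_lipschitz[of x 0] assms by (simp add: snc_def[of 0] abs_if split: if_splits)
  then have "(3/4)\<^sup>2 \<le> fejer x"
    unfolding fejer_def by (intro power_mono) auto
  then show ?thesis by (simp add: power2_eq_square)
qed

lemma continuous_fejer: "continuous_on A fejer"
  unfolding fejer_def by (intro continuous_intros continuous_snc)

lemma continuous_on_fejer [continuous_intros]:
  "continuous_on A f \<Longrightarrow> continuous_on A (\<lambda>x. fejer (f x))"
  using continuous_on_compose2[OF continuous_fejer[of UNIV]] by blast

lemma borel_measurable_fejer [measurable]: "fejer \<in> borel_measurable borel"
  by (rule borel_measurable_continuous_onI[OF continuous_fejer])

section \<open>Lattice sums and integrals of the kernel\<close>

text \<open>Comparison with the integral of 1 / (1 + x^2): each term is at most 3 / \<theta> times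
  the increment of arctan over the next step, and the increments telescope to at most pi. Finally 3
  pi is below 10.\<close>

lemma lattice_sum_bound:
  fixes A :: "int set" and \<theta> z :: real
  assumes "finite A" "0 < \<theta>" "\<theta> \<le> 1"
  shows "(\<Sum>n\<in>A. 1 / (1 + (\<theta> * of_int n - z)\<^sup>2)) \<le> 10 / \<theta>"
proof -
  have step: "1 / (1 + u\<^sup>2) \<le> 3 / \<theta> * (arctan (u + \<theta>) - arctan u)" for u
  proof -
    obtain \<xi> where \<xi>: "u < \<xi>" "\<xi> < u + \<theta>"
      and eq: "arctan (u + \<theta>) - arctan u = (u + \<theta> - u) * inverse (1 + \<xi>\<^sup>2)"
      using MVT2[of u "u + \<theta>" arctan "\<lambda>x. inverse (1 + x\<^sup>2)"] DERIV_arctan assms(2) by auto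
    have "\<bar>\<xi>\<bar> \<le> \<bar>u\<bar> + 1" using \<xi> assms by auto
    then have "\<xi>\<^sup>2 \<le> (\<bar>u\<bar> + 1)\<^sup>2"
      by (metis abs_ge_zero power2_abs power_mono)
    also have "\<dots> \<le> 2 * u\<^sup>2 + 2"
      using sum_squares_bound[of "\<bar>u\<bar>" 1] by (simp add: power2_eq_square algebra_simps flip: abs_mult)
    finally have "1 + \<xi>\<^sup>2 \<le> 3 * (1 + u\<^sup>2)" using zero_le_power2[of u] unfolding distrib_left by linarith
    then have "1 / (1 + u\<^sup>2) \<le> 3 / (1 + \<xi>\<^sup>2)"
      by (simp add: divide_simps add_pos_nonneg)
    then show ?thesis
      using eq assms by (simp add: field_simps)
  qed
  obtain a b where ab: "A \<subseteq> {a..<b}" "a \<le> b"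
  proof (cases "A = {}")
    case True
    then show ?thesis using that[of 0 0] by auto
  next
    case False
    have "Min A \<le> Max A" using assms(1) False by simp
    moreover have "A \<subseteq> {Min A..<Max A + 1}" using assms(1) by (auto simp: zless_add1_eq le_less[symmetric])
    ultimately show ?thesis using that[of "Min A" "Max A + 1"] by auto
  qed
  let ?u = "\<lambda>n::int. \<theta> * of_int n - z"
  have tel: "(\<Sum>n\<in>{a..<a + int m}. arctan (?u n + \<theta>) - arctan (?u n)) = arctan (?u (a + int m)) - arctan (?u a)" for m
  proof (induction m)
    case (Suc m)
    have "{a..<a + int (Suc m)} = insert (a + int m) {a..<a + int m}" by auto
    then show ?case using Suc by (simp add: algebra_simps)
  qed auto
  have "(\<Sum>n\<in>A. 1 / (1 + (?u n)\<^sup>2)) \<le> (\<Sum>n\<in>{a..<b}. 1 / (1 + (?u n)\<^sup>2))"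
    using ab by (intro sum_mono2) (auto simp: add_nonneg_nonneg)
  also have "\<dots> \<le> (\<Sum>n\<in>{a..<b}. 3 / \<theta> * (arctan (?u n + \<theta>) - arctan (?u n)))"
    by (intro sum_mono step)
  also have "\<dots> = 3 / \<theta> * (arctan (?u b) - arctan (?u a))"
  proof -
    have "(\<Sum>n\<in>{a..<b}. arctan (?u n + \<theta>) - arctan (?u n)) = arctan (?u b) - arctan (?u a)"
      using tel[of "nat (b - a)"] ab(2) by simp
    then show ?thesis by (simp only: sum_distrib_left[symmetric])
  qed
  also have "\<dots> \<le> 3 / \<theta> * pi"
    using arctan_bounded[of "?u b"] arctan_bounded[of "?u a"] assms
    by (intro mult_left_mono) auto
  also have "\<dots> \<le> 10 / \<theta>"
    using pi_less_4 pi_approx assms by (simp add: divide_simps)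
  finally show ?thesis .
qed

lemma lattice_fejer_sum_bound:
  fixes A :: "int set" and h z \<delta> :: real
  assumes "finite A" "0 < h" "0 < \<delta>" "h * \<delta> \<le> 1"
  shows "(\<Sum>n\<in>A. 1 / (1 + (h * (z - of_int n * \<delta>))\<^sup>2)) \<le> 10 / (h * \<delta>)"
proof -
  have "(h * (z - of_int n * \<delta>))\<^sup>2 = ((h * \<delta>) * of_int n - h * z)\<^sup>2" for n :: int
    by (simp add: power2_eq_square algebra_simps)
  then show ?thesis
    using lattice_sum_bound[of A "h * \<delta>" "h * z"] assms by simp
qed

lemma nn_integral_inverse_1_plus_square:
  "(\<integral>\<^sup>+x. ennreal (1 / (1 + x\<^sup>2)) \<partial>lborel) = ennreal pi"
proof -
  have int: "integrable lborel (\<lambda>x::real. 1 / (1 + x\<^sup>2))"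
    using integrable_inverse_1_plus_square by (simp add: set_integrable_def inverse_eq_divide einterval_def)
  moreover have "(\<integral>x. 1 / (1 + x\<^sup>2) \<partial>lborel) = pi"
    using LBINT_inverse_1_plus_square
    by (simp add: interval_lebesgue_integral_def set_lebesgue_integral_def inverse_eq_divide einterval_def)
  ultimately show ?thesis
    by (subst nn_integral_eq_integral) (auto simp: add_nonneg_nonneg)
qed

lemma nn_integral_fejer_le:
  assumes "h \<noteq> 0"
  shows "(\<integral>\<^sup>+x. ennreal (fejer (c + h * x)) \<partial>lborel) \<le> ennreal (13 / \<bar>h\<bar>)"
proof -
  have "ennreal \<bar>h\<bar> * (\<integral>\<^sup>+x. ennreal (fejer (c + h * x)) \<partial>lborel) = (\<integral>\<^sup>+x. ennreal (fejer x) \<partial>lborel)"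
    using nn_integral_real_affine[of "\<lambda>x. ennreal (fejer x)" h c] assms by simp
  also have "\<dots> \<le> (\<integral>\<^sup>+x. ennreal 4 * ennreal (1 / (1 + x\<^sup>2)) \<partial>lborel)"
    by (intro nn_integral_mono, subst ennreal_mult[symmetric]) (auto simp: fejer_decay intro!: ennreal_leI)
  also have "\<dots> = ennreal 4 * ennreal pi"
    by (subst nn_integral_cmult) (auto simp: nn_integral_inverse_1_plus_square)
  also have "\<dots> = ennreal (4 * pi)"
    by (simp add: ennreal_mult)
  also have "\<dots> \<le> ennreal 13"
    using pi_approx by (intro ennreal_leI) simp
  finally have "ennreal \<bar>h\<bar> * (\<integral>\<^sup>+x. ennreal (fejer (c + h * x)) \<partial>lborel) \<le> ennreal 13" .
  then have "ennreal (1 / \<bar>h\<bar>) * (ennreal \<bar>h\<bar> * (\<integral>\<^sup>+x. ennreal (fejer (c + h * x)) \<partial>lborel)) \<le> ennreal (1 / \<bar>h\<bar>) * ennreal 13"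
    by (intro mult_left_mono) auto
  moreover have "ennreal (1 / \<bar>h\<bar>) * ennreal \<bar>h\<bar> = 1"
    using assms by (simp add: ennreal_mult[symmetric])
  moreover have "ennreal (1 / \<bar>h\<bar>) * ennreal 13 = ennreal (13 / \<bar>h\<bar>)"
    by (subst ennreal_mult[symmetric]) auto
  ultimately show ?thesis
    by (simp add: mult.assoc[symmetric])
qed

lemma integrable_fejer: "integrable lborel fejer"
proof (rule integrableI_bounded)
  have "(\<integral>\<^sup>+x. ennreal (norm (fejer x)) \<partial>lborel) \<le> ennreal 13"
    using nn_integral_fejer_le[of 1 0] by simp
  then show "(\<integral>\<^sup>+x. ennreal (norm (fejer x)) \<partial>lborel) < \<infinity>"
    by (rule order_le_less_trans) simp
qed simp

lemma integral_fejer_scale: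
  assumes "k \<noteq> 0"
  shows "integrable lborel (\<lambda>x. fejer (k * x))" "(\<integral>x. fejer (k * x) \<partial>lborel) = (\<integral>x. fejer x \<partial>lborel) / \<bar>k\<bar>"
  using lborel_integrable_real_affine[OF integrable_fejer assms, of 0]
    lborel_integral_real_affine[OF assms, of fejer 0] assms by auto

section \<open>Compact support of the Fourier transform of the kernel\<close>

text \<open>The integrand is 2 (1 - cos (k x)) / x^2 in disguise. Only the dependence on
  \<bar>k\<bar> matters; the value of the integral of \<open>fejer\<close> is never
  computed.\<close>

lemma integral_fejer_quadratic:
  "integrable lborel (\<lambda>x. k\<^sup>2 * fejer (k * x / 2))"
  "(\<integral>x. k\<^sup>2 * fejer (k * x / 2) \<partial>lborel) = 2 * \<bar>k\<bar> * (\<integral>x. fejer x \<partial>lborel)"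
proof -
  show "integrable lborel (\<lambda>x. k\<^sup>2 * fejer (k * x / 2))"
    using integral_fejer_scale(1)[of "k/2"] by (cases "k = 0") auto
  show "(\<integral>x. k\<^sup>2 * fejer (k * x / 2) \<partial>lborel) = 2 * \<bar>k\<bar> * (\<integral>x. fejer x \<partial>lborel)"
  proof (cases "k = 0")
    case False
    have "(\<integral>x. k\<^sup>2 * fejer (k * x / 2) \<partial>lborel) = k\<^sup>2 * ((\<integral>x. fejer x \<partial>lborel) / \<bar>k / 2\<bar>)"
      using integral_fejer_scale(2)[of "k/2"] False by simp
    also have "\<dots> = \<bar>k\<bar> * \<bar>k\<bar> * ((\<integral>x. fejer x \<partial>lborel) / \<bar>k / 2\<bar>)"
      by (simp add: power2_eq_square)
    also have "\<dots> = 2 * \<bar>k\<bar> * (\<integral>x. fejer x \<partial>lborel)" using False by (simp add: field_simps del: abs_mult_self_eq)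
    finally show ?thesis .
  qed simp
qed

text \<open>The second difference of the even, piecewise linear function \<open>k \<mapsto> \<bar>k\<bar>\<close> vanishes
  away from the kink; this is the compact support of the Fourier transform of \<open>fejer\<close>.\<close>
lemma integral_cos_fejer_eq_0:
  assumes "\<bar>\<xi>\<bar> \<ge> 2"
  shows "(\<integral>x. cos (\<xi> * x) * fejer x \<partial>lborel) = 0"
proof -
  let ?g = "\<lambda>k x. k\<^sup>2 * fejer (k * x / 2)"
  have g: "x\<^sup>2 * ?g k x = 2 * (1 - cos (k * x))" for k x
  proof -
    have "x\<^sup>2 * ?g k x = 4 * ((k * x / 2) * snc (k * x / 2))\<^sup>2"
      by (simp add: fejer_def power2_eq_square)
    also have "\<dots> = 4 * (sin (k * x / 2))\<^sup>2" by (simp only: mult_snc)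
    also have "\<dots> = 2 * (1 - cos (k * x))"
      using cos_double_sin[of "k * x / 2"] by simp
    finally show ?thesis .
  qed
  have eq: "cos (\<xi> * x) * fejer x = (?g (\<xi> + 2) x + ?g (\<xi> - 2) x - 2 * ?g \<xi> x) / 8" for x
  proof (cases "x = 0")
    case True
    then show ?thesis by (simp add: fejer_def snc_def power2_eq_square algebra_simps)
  next
    case False
    have "x\<^sup>2 * (?g (\<xi> + 2) x + ?g (\<xi> - 2) x - 2 * ?g \<xi> x)
      = 2 * (1 - cos ((\<xi> + 2) * x)) + 2 * (1 - cos ((\<xi> - 2) * x)) - 2 * (2 * (1 - cos (\<xi> * x)))"
      using g[of x "\<xi> + 2"] g[of x "\<xi> - 2"] g[of x \<xi>]
      by (simp only: distrib_left right_diff_distrib mult.left_commute[of "x\<^sup>2" 2])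
    also have "\<dots> = 2 * (2 * cos (\<xi> * x) - (cos (\<xi> * x + 2 * x) + cos (\<xi> * x - 2 * x)))"
      by (simp add: algebra_simps)
    also have "cos (\<xi> * x + 2 * x) + cos (\<xi> * x - 2 * x) = 2 * cos (\<xi> * x) * cos (2 * x)"
      by (simp add: cos_add cos_diff)
    also have "2 * (2 * cos (\<xi> * x) - 2 * cos (\<xi> * x) * cos (2 * x)) = 4 * cos (\<xi> * x) * (1 - cos (2 * x))"
      by (simp add: algebra_simps)
    also have "1 - cos (2 * x) = 2 * (x\<^sup>2 * fejer x)"
      using g[of x 2] by simp
    finally have "x\<^sup>2 * (?g (\<xi> + 2) x + ?g (\<xi> - 2) x - 2 * ?g \<xi> x) = x\<^sup>2 * (8 * (cos (\<xi> * x) * fejer x))"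
      by (simp add: mult_ac)
    then show ?thesis using False by simp
  qed
  have "(\<integral>x. cos (\<xi> * x) * fejer x \<partial>lborel) = (2 * \<bar>\<xi> + 2\<bar> + 2 * \<bar>\<xi> - 2\<bar> - 4 * \<bar>\<xi>\<bar>) * (\<integral>x. fejer x \<partial>lborel) / 8"
  proof -
    have "(\<integral>x. (?g (\<xi> + 2) x + ?g (\<xi> - 2) x - 2 * ?g \<xi> x) / 8 \<partial>lborel)
      = (2 * \<bar>\<xi> + 2\<bar> * (\<integral>x. fejer x \<partial>lborel) + 2 * \<bar>\<xi> - 2\<bar> * (\<integral>x. fejer x \<partial>lborel)
        - 2 * (2 * \<bar>\<xi>\<bar> * (\<integral>x. fejer x \<partial>lborel))) / 8"
      unfolding integral_divide_zero integral_fejer_quadratic(2)[symmetric]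
      by (subst Bochner_Integration.integral_diff Bochner_Integration.integral_add
          | intro Bochner_Integration.integrable_add integrable_mult_right integral_fejer_quadratic(1)
          | rule arg_cong2[where f="(-)"] refl integral_mult_right_zero arg_cong2[where f="(/)"])+
    then show ?thesis
      unfolding eq by (simp only: left_diff_distrib distrib_right mult.assoc[symmetric]) simp
  qed
  also have "2 * \<bar>\<xi> + 2\<bar> + 2 * \<bar>\<xi> - 2\<bar> - 4 * \<bar>\<xi>\<bar> = 0"
    using assms by (auto simp: abs_if split: if_splits)
  finally show ?thesis by simp
qed

lemma integrable_cis_fejer:
  assumes "\<tau> > 0"
  shows "integrable lborel (\<lambda>x. cis (\<zeta> * x) * complex_of_real (fejer (\<tau> * x)))"
proof (rule Bochner_Integration.integrable_bound)
  show "integrable lborel (\<lambda>x. fejer (\<tau> * x))"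
    using integral_fejer_scale(1)[of \<tau>] assms by simp
  have "continuous_on UNIV (\<lambda>x. cis (\<zeta> * x) * complex_of_real (fejer (\<tau> * x)))"
    unfolding cis_conv_exp by (intro continuous_intros)
  then show "(\<lambda>x. cis (\<zeta> * x) * complex_of_real (fejer (\<tau> * x))) \<in> borel_measurable lborel"
    by (simp add: borel_measurable_continuous_onI)
qed (simp add: norm_mult)

lemma integral_cis_fejer_eq_0:
  assumes "\<tau> > 0" "\<bar>\<zeta>\<bar> \<ge> 2 * \<tau>"
  shows "(\<integral>x. cis (\<zeta> * x) * complex_of_real (fejer (\<tau> * x)) \<partial>lborel) = 0"
proof -
  define \<xi> where "\<xi> = \<zeta> / \<tau>"
  have xi: "\<bar>\<xi>\<bar> \<ge> 2" using assms by (simp add: \<xi>_def divide_simps)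
  let ?f = "\<lambda>x. cis (\<xi> * x) * complex_of_real (fejer x)"
  have int: "integrable lborel ?f"
    using integrable_cis_fejer[of 1 \<xi>] by simp
  have even: "fejer (- x) = fejer x" for x
    by (simp add: fejer_def snc_def)
  have "Re (\<integral>x. ?f x \<partial>lborel) = (\<integral>x. Re (?f x) \<partial>lborel)"
    using int by (rule integral_Re[symmetric])
  then have re: "Re (\<integral>x. ?f x \<partial>lborel) = 0"
    using integral_cos_fejer_eq_0[OF xi] by simp
  have im: "Im (\<integral>x. ?f x \<partial>lborel) = (\<integral>x. sin (\<xi> * x) * fejer x \<partial>lborel)"
    using integral_Im[OF int] by simp
  have "(\<integral>x. sin (\<xi> * x) * fejer x \<partial>lborel) = - (\<integral>x. sin (\<xi> * x) * fejer x \<partial>lborel)"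
    using lborel_integral_real_affine[of "-1" "\<lambda>x. sin (\<xi> * x) * fejer x" 0] by (simp add: even)
  with re im have "(\<integral>x. ?f x \<partial>lborel) = 0"
    by (simp add: complex_eq_iff)
  moreover have "(\<integral>x. ?f x \<partial>lborel) = \<tau> *\<^sub>R (\<integral>x. cis (\<zeta> * x) * complex_of_real (fejer (\<tau> * x)) \<partial>lborel)"
    using lborel_integral_real_affine[of \<tau> ?f 0] assms by (simp add: \<xi>_def)
  ultimately show ?thesis using assms by simp
qed

section \<open>Band-limited functions and almost orthogonality\<close>

type_synonym pt = "real \<times> real \<times> real"

text \<open>The Fourier transform of this weight is supported in a cube of half side 2 \<tau>, so
  under it frequencies that are not \<open>near\<close> each other are orthogonal exactly, without
  tails. On a ball of radius about 1 / \<tau> it is bounded below (\<open>wt_ge\<close>).\<close>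

definition wt :: "real \<Rightarrow> pt \<Rightarrow> real" where
  "wt \<tau> p = fejer (\<tau> * fst p) * (fejer (\<tau> * fst (snd p)) * fejer (\<tau> * snd (snd p)))"

lemma wt_nonneg [simp]: "0 \<le> wt \<tau> p"
  by (simp add: wt_def)

lemma continuous_wt: "continuous_on A (wt \<tau>)"
  unfolding wt_def by (intro continuous_intros)

lemma integral_lborel_prod_mult:
  fixes f :: "'a::euclidean_space \<Rightarrow> complex" and g :: "'b::euclidean_space \<Rightarrow> complex"
  assumes f: "integrable lborel f" and g: "integrable lborel g"
  shows "integrable lborel (\<lambda>p. f (fst p) * g (snd p))"
    and "(\<integral>p. f (fst p) * g (snd p) \<partial>lborel) = (\<integral>x. f x \<partial>lborel) * (\<integral>y. g y \<partial>lborel)"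
proof -
  have [measurable]: "f \<in> borel_measurable borel" "g \<in> borel_measurable borel"
    using f g by auto
  have int: "integrable (lborel \<Otimes>\<^sub>M lborel) (\<lambda>p. f (fst p) * g (snd p))"
  proof (rule lborel_pair.Fubini_integrable)
    show "integrable lborel (\<lambda>x. \<integral>y. norm (f (fst (x, y)) * g (snd (x, y))) \<partial>lborel)"
      using f by (simp add: norm_mult)
    show "AE x in lborel. integrable lborel (\<lambda>y. f (fst (x, y)) * g (snd (x, y)))"
      using g by simp
  qed measurable
  then show "integrable lborel (\<lambda>p. f (fst p) * g (snd p))"
    by (simp add: lborel_prod)
  have "(\<integral>x. (\<integral>y. f x * g y \<partial>lborel) \<partial>lborel) = (\<integral>p. f (fst p) * g (snd p) \<partial>(lborel \<Otimes>\<^sub>M lborel))"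
    using lborel_pair.integral_fst'[OF int] by simp
  then show "(\<integral>p. f (fst p) * g (snd p) \<partial>lborel) = (\<integral>x. f x \<partial>lborel) * (\<integral>y. g y \<partial>lborel)"
    by (simp add: lborel_prod)
qed

definition near :: "real \<Rightarrow> pt \<Rightarrow> bool" where
  "near \<tau> z \<longleftrightarrow> \<bar>fst z\<bar> < 2 * \<tau> \<and> \<bar>fst (snd z)\<bar> < 2 * \<tau> \<and> \<bar>snd (snd z)\<bar> < 2 * \<tau>"

lemma integral_cis_wt:
  assumes "\<tau> > 0"
  shows "integrable lborel (\<lambda>p. cis (z \<bullet> p) * complex_of_real (wt \<tau> p))"
    and "\<not> near \<tau> z \<Longrightarrow> (\<integral>p. cis (z \<bullet> p) * complex_of_real (wt \<tau> p) \<partial>lborel) = 0"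
proof -
  obtain a b c where z: "z = (a, b, c)" by (cases z)
  let ?k = "\<lambda>\<zeta> x. cis (\<zeta> * x) * complex_of_real (fejer (\<tau> * x))"
  have eq: "cis (z \<bullet> p) * complex_of_real (wt \<tau> p)
      = ?k a (fst p) * (?k b (fst (snd p)) * ?k c (snd (snd p)))" for p :: pt
    by (cases p) (simp add: z wt_def cis_mult[symmetric] mult_ac)
  note i = integrable_cis_fejer[OF assms]
  note 2 = integral_lborel_prod_mult[OF i i, of b c]
  note 3 = integral_lborel_prod_mult[OF i 2(1), of a]
  show "integrable lborel (\<lambda>p. cis (z \<bullet> p) * complex_of_real (wt \<tau> p))"
    unfolding eq by (rule 3(1))
  assume "\<not> near \<tau> z"
  then have "\<bar>a\<bar> \<ge> 2 * \<tau> \<or> \<bar>b\<bar> \<ge> 2 * \<tau> \<or> \<bar>c\<bar> \<ge> 2 * \<tau>"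
    by (auto simp: near_def z)
  then show "(\<integral>p. cis (z \<bullet> p) * complex_of_real (wt \<tau> p) \<partial>lborel) = 0"
    unfolding eq 3(2) 2(2) using integral_cis_fejer_eq_0[OF assms] by auto
qed

lemma integrable_wt:
  assumes "\<tau> > 0"
  shows "integrable lborel (wt \<tau>)"
proof -
  have "complex_integrable lborel (\<lambda>p. complex_of_real (wt \<tau> p))"
    using integral_cis_wt(1)[OF assms, of 0] by simp
  then show ?thesis by (simp only: complex_of_real_integrable_eq)
qed

inductive trig :: "pt set \<Rightarrow> (pt \<Rightarrow> complex) \<Rightarrow> bool" for A where
  trig_zero: "trig A (\<lambda>p. 0)"
| trig_step: "trig A f \<Longrightarrow> \<xi> \<in> A \<Longrightarrow> trig A (\<lambda>p. f p + c * cis (\<xi> \<bullet> p))"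

lemma trig_add:
  assumes "trig A f" "trig A g"
  shows "trig A (\<lambda>p. f p + g p)"
  using assms(2)
proof induction
  case (trig_step g \<xi> c)
  then show ?case
    using trig.trig_step[of A "\<lambda>p. f p + g p" \<xi> c] by (simp add: add.assoc)
qed (use assms in simp)

lemma trig_single: "\<xi> \<in> A \<Longrightarrow> trig A (\<lambda>p. c * cis (\<xi> \<bullet> p))"
  using trig_step[OF trig_zero, of \<xi> A c] by simp

lemma trig_sum: "(\<And>i. i \<in> I \<Longrightarrow> trig A (f i)) \<Longrightarrow> trig A (\<lambda>p. \<Sum>i\<in>I. f i p)"
  by (induction I rule: infinite_finite_induct) (auto intro: trig_zero trig_add)

lemma trig_mult_cis:
  assumes "trig A f" and that: "\<eta> \<in> B"
  shows "trig {a + b |a b. a \<in> A \<and> b \<in> B} (\<lambda>p. f p * (c * cis (\<eta> \<bullet> p)))"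
  using assms(1)
proof induction
  case (trig_step f \<xi> d)
  have "trig {a + b |a b. a \<in> A \<and> b \<in> B} (\<lambda>p. (d * c) * cis ((\<xi> + \<eta>) \<bullet> p))"
    using trig_step.hyps(2) that by (intro trig_single) blast
  from trig_add[OF trig_step.IH this] show ?case
    by (simp add: inner_add_left cis_mult[symmetric] algebra_simps)
qed (auto intro: trig_zero)

lemma trig_mult:
  assumes "trig A f" "trig B g"
  shows "trig {a + b |a b. a \<in> A \<and> b \<in> B} (\<lambda>p. f p * g p)"
  using assms(2)
proof induction
  case (trig_step g \<xi> c)
  from trig_add[OF trig_step.IH trig_mult_cis[OF assms(1) trig_step.hyps(2)], of c] show ?case
    by (simp add: distrib_left)
qed (auto intro: trig_zero)

lemma trig_mono: "trig A f \<Longrightarrow> A \<subseteq> B \<Longrightarrow> trig B f"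
  by (induction rule: trig.induct) (auto intro: trig.intros)

definition bc :: "(pt \<Rightarrow> complex) \<Rightarrow> bool" where
  "bc f \<longleftrightarrow> continuous_on UNIV f \<and> (\<exists>C. \<forall>p. norm (f p) \<le> C)"

lemma bc_add: "bc f \<Longrightarrow> bc g \<Longrightarrow> bc (\<lambda>p. f p + g p)"
  unfolding bc_def by (auto intro!: continuous_intros) (metis add_mono norm_triangle_le)

lemma bc_mult: "bc f \<Longrightarrow> bc g \<Longrightarrow> bc (\<lambda>p. f p * g p)"
  unfolding bc_def
proof (elim conjE exE, intro conjI continuous_on_mult exI allI)
  fix C D p assume "\<forall>p. norm (f p) \<le> C" "\<forall>p. norm (g p) \<le> D"
  then have "norm (f p) \<le> C" "norm (g p) \<le> D" by blast+
  then have "norm (f p) * norm (g p) \<le> C * D"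
    by (intro mult_mono norm_ge_zero order_trans[OF norm_ge_zero \<open>norm (f p) \<le> C\<close>])
  then show "norm (f p * g p) \<le> C * D" by (simp add: norm_mult)
qed auto

lemma bc_const: "bc (\<lambda>p. c)"
  unfolding bc_def by auto

lemma bc_sum: "(\<And>i. i \<in> I \<Longrightarrow> bc (f i)) \<Longrightarrow> bc (\<lambda>p. \<Sum>i\<in>I. f i p)"
  by (induction I rule: infinite_finite_induct) (auto intro: bc_add bc_const)

definition wint :: "real \<Rightarrow> (pt \<Rightarrow> real) \<Rightarrow> real" where
  "wint \<tau> g = (\<integral>p. g p * wt \<tau> p \<partial>lborel)"

definition ip :: "real \<Rightarrow> (pt \<Rightarrow> complex) \<Rightarrow> (pt \<Rightarrow> complex) \<Rightarrow> complex" where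
  "ip \<tau> f g = (\<integral>p. f p * cnj (g p) * complex_of_real (wt \<tau> p) \<partial>lborel)"

lemma integrable_bounded_wt:
  fixes f :: "pt \<Rightarrow> 'a::{banach, second_countable_topology, real_normed_algebra_1}"
  assumes "\<tau> > 0" "continuous_on UNIV f" "\<And>p. norm (f p) \<le> C"
  shows "integrable lborel (\<lambda>p. f p * of_real (wt \<tau> p))"
proof (rule Bochner_Integration.integrable_bound)
  show "integrable lborel (\<lambda>p. C * wt \<tau> p)"
    using integrable_wt[OF assms(1)] by simp
  have "continuous_on UNIV (\<lambda>p. f p * of_real (wt \<tau> p))"
    by (intro continuous_intros assms continuous_wt)
  then show "(\<lambda>p. f p * of_real (wt \<tau> p)) \<in> borel_measurable lborel"
    by (simp add: borel_measurable_continuous_onI)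
  have "norm (f p * of_real (wt \<tau> p)) \<le> C * wt \<tau> p" for p
    using norm_mult_ineq[of "f p" "of_real (wt \<tau> p)"] mult_right_mono[OF assms(3)[of p], of "wt \<tau> p"]
    by simp
  moreover have "0 \<le> C" by (rule order_trans[OF norm_ge_zero assms(3)[of 0]])
  ultimately show "AE p in lborel. norm (f p * of_real (wt \<tau> p)) \<le> norm (C * wt \<tau> p)"
    by (simp add: abs_mult)
qed

lemma integrable_bc_wt: "\<tau> > 0 \<Longrightarrow> bc f \<Longrightarrow> integrable lborel (\<lambda>p. f p * complex_of_real (wt \<tau> p))"
  unfolding bc_def using integrable_bounded_wt[of \<tau> f] by blast

lemma integrable_norm_power_wt:
  "\<tau> > 0 \<Longrightarrow> bc f \<Longrightarrow> integrable lborel (\<lambda>p. norm (f p) ^ k * wt \<tau> p)"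
proof -
  assume "\<tau> > 0" "bc f"
  then obtain C where "\<And>p. norm (f p) \<le> C" "continuous_on UNIV f"
    by (auto simp: bc_def)
  moreover from this have "norm (norm (f p) ^ k) \<le> C ^ k" for p
    by (simp add: power_mono)
  ultimately show ?thesis
    using integrable_bounded_wt[OF \<open>\<tau> > 0\<close>, of "\<lambda>p. norm (f p) ^ k" "C ^ k"]
    by (simp add: continuous_on_power continuous_on_norm)
qed

lemma bc_cnj: "bc f \<Longrightarrow> bc (\<lambda>p. cnj (f p))"
  unfolding bc_def by (auto intro!: continuous_intros)

lemma integrable_ip: "\<tau> > 0 \<Longrightarrow> bc f \<Longrightarrow> bc g \<Longrightarrow> integrable lborel (\<lambda>p. f p * cnj (g p) * complex_of_real (wt \<tau> p))"
  by (intro integrable_bc_wt bc_mult bc_cnj)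

lemma ip_self: "ip \<tau> f f = of_real (wint \<tau> (\<lambda>p. (norm (f p))\<^sup>2))"
proof -
  have "f p * cnj (f p) * complex_of_real (wt \<tau> p) = complex_of_real ((norm (f p))\<^sup>2 * wt \<tau> p)" for p
    by (simp only: complex_norm_square of_real_mult)
  then show ?thesis
    unfolding ip_def wint_def by (simp only: integral_complex_of_real)
qed

lemma ip_commute: "ip \<tau> g f = cnj (ip \<tau> f g)"
  unfolding ip_def by (simp add: Bochner_Integration.integral_cnj[symmetric] mult_ac)

lemma norm_ip_le:
  assumes "\<tau> > 0" "bc f" "bc g"
  shows "norm (ip \<tau> f g) \<le> (wint \<tau> (\<lambda>p. (norm (f p))\<^sup>2) + wint \<tau> (\<lambda>p. (norm (g p))\<^sup>2)) / 2"
proof -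
  have "norm (ip \<tau> f g) \<le> (\<integral>p. norm (f p * cnj (g p) * complex_of_real (wt \<tau> p)) \<partial>lborel)"
    unfolding ip_def by (rule integral_norm_bound)
  also have "\<dots> \<le> (\<integral>p. ((norm (f p))\<^sup>2 * wt \<tau> p + (norm (g p))\<^sup>2 * wt \<tau> p) / 2 \<partial>lborel)"
  proof (rule integral_mono)
    fix p
    have "norm (f p) * norm (g p) \<le> ((norm (f p))\<^sup>2 + (norm (g p))\<^sup>2) / 2"
      using sum_squares_bound[of "norm (f p)" "norm (g p)"] by simp
    then have "norm (f p) * norm (g p) * wt \<tau> p \<le> ((norm (f p))\<^sup>2 + (norm (g p))\<^sup>2) / 2 * wt \<tau> p"
      by (rule mult_right_mono) simp
    then show "norm (f p * cnj (g p) * complex_of_real (wt \<tau> p)) \<le> ((norm (f p))\<^sup>2 * wt \<tau> p + (norm (g p))\<^sup>2 * wt \<tau> p) / 2"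
      by (simp add: norm_mult algebra_simps)
  qed (use assms in \<open>auto intro!: integrable_norm integrable_ip integrable_norm_power_wt\<close>)
  also have "\<dots> = (wint \<tau> (\<lambda>p. (norm (f p))\<^sup>2) + wint \<tau> (\<lambda>p. (norm (g p))\<^sup>2)) / 2"
    unfolding wint_def using assms by (simp add: integrable_norm_power_wt)
  finally show ?thesis .
qed

lemma wint_mono:
  assumes "\<tau> > 0" "bc f" "bc g" "\<And>p. norm (f p) ^ k \<le> c * norm (g p) ^ l"
  shows "wint \<tau> (\<lambda>p. norm (f p) ^ k) \<le> c * wint \<tau> (\<lambda>p. norm (g p) ^ l)"
proof -
  have "wint \<tau> (\<lambda>p. norm (f p) ^ k) \<le> (\<integral>p. c * (norm (g p) ^ l * wt \<tau> p) \<partial>lborel)"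
    unfolding wint_def
  proof (rule integral_mono)
    show "norm (f p) ^ k * wt \<tau> p \<le> c * (norm (g p) ^ l * wt \<tau> p)" for p
      using mult_right_mono[OF assms(4)[of p] wt_nonneg[of \<tau> p]] by (simp add: mult_ac)
  qed (use assms in \<open>auto intro!: integrable_norm_power_wt\<close>)
  then show ?thesis by (simp add: wint_def)
qed

lemma wint_nonneg: "(\<And>p. 0 \<le> g p) \<Longrightarrow> 0 \<le> wint \<tau> g"
  unfolding wint_def by (intro integral_nonneg_AE) auto

lemma wint_le_sum:
  assumes \<tau>: "\<tau> > 0" and "bc f" "finite I" "\<And>i. i \<in> I \<Longrightarrow> bc (u i)" "\<And>p. norm (f p) ^ m \<le> c * (\<Sum>i\<in>I. norm (u i p) ^ n)"
  shows "wint \<tau> (\<lambda>p. norm (f p) ^ m) \<le> c * (\<Sum>i\<in>I. wint \<tau> (\<lambda>p. norm (u i p) ^ n))"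
proof -
  have "wint \<tau> (\<lambda>p. norm (f p) ^ m) \<le> (\<integral>p. c * (\<Sum>i\<in>I. norm (u i p) ^ n * wt \<tau> p) \<partial>lborel)"
    unfolding wint_def
  proof (rule integral_mono)
    show "norm (f p) ^ m * wt \<tau> p \<le> c * (\<Sum>i\<in>I. norm (u i p) ^ n * wt \<tau> p)" for p
      using mult_right_mono[OF assms(5)[of p] wt_nonneg[of \<tau> p]] by (simp add: sum_distrib_right mult.assoc)
  qed (use assms \<tau> in \<open>auto intro!: integrable_norm_power_wt Bochner_Integration.integrable_sum integrable_mult_right\<close>)
  also have "\<dots> = c * (\<Sum>i\<in>I. wint \<tau> (\<lambda>p. norm (u i p) ^ n))"
    unfolding wint_def using assms \<tau> by (simp add: Bochner_Integration.integral_sum integrable_norm_power_wt)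
  finally show ?thesis .
qed

lemma norm_sum_square_le:
  fixes x :: "'i \<Rightarrow> complex"
  shows "(norm (\<Sum>i\<in>I. x i))\<^sup>2 \<le> real (card I) * (\<Sum>i\<in>I. (norm (x i))\<^sup>2)"
proof -
  have "(norm (\<Sum>i\<in>I. x i))\<^sup>2 \<le> (\<Sum>i\<in>I. norm (x i))\<^sup>2"
    by (intro power_mono norm_sum) simp
  also have "\<dots> \<le> (\<Sum>i\<in>I. (norm (x i))\<^sup>2) * card I"
    by (rule sum_squared_le_sum_of_squares)
  finally show ?thesis by (simp add: mult.commute)
qed

lemma norm_sum_power4_le:
  fixes x :: "'i \<Rightarrow> complex"
  shows "norm (\<Sum>i\<in>I. x i) ^ 4 \<le> real (card I) ^ 3 * (\<Sum>i\<in>I. norm (x i) ^ 4)"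
proof -
  have "norm (\<Sum>i\<in>I. x i) ^ 4 = ((norm (\<Sum>i\<in>I. x i))\<^sup>2)\<^sup>2" by (simp add: power_mult[symmetric])
  also have "\<dots> \<le> (real (card I) * (\<Sum>i\<in>I. (norm (x i))\<^sup>2))\<^sup>2"
    by (intro power_mono norm_sum_square_le) simp
  also have "\<dots> = real (card I) ^ 2 * (\<Sum>i\<in>I. (norm (x i))\<^sup>2)\<^sup>2" by (simp add: power_mult_distrib)
  also have "\<dots> \<le> real (card I) ^ 2 * ((\<Sum>i\<in>I. ((norm (x i))\<^sup>2)\<^sup>2) * card I)"
    by (intro mult_left_mono sum_squared_le_sum_of_squares) simp
  also have "\<dots> = real (card I) ^ 3 * (\<Sum>i\<in>I. norm (x i) ^ 4)"
    by (simp add: power_mult[symmetric] power3_eq_cube power2_eq_square[of "real (card I)"] mult_ac)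
  finally show ?thesis .
qed

text \<open>Schur's test: each nonvanishing inner product is at most the mean of the two squared
  norms, and since the pattern of nonvanishing is symmetric, the bound \<open>N\<close> on its rows
  serves both halves of that mean.\<close>

lemma almost_orthogonality:
  fixes f :: "'i \<Rightarrow> pt \<Rightarrow> complex"
  assumes "\<tau> > 0" "finite J" "\<And>j. j \<in> J \<Longrightarrow> bc (f j)"
    and ov: "\<And>j. j \<in> J \<Longrightarrow> real (card {i\<in>J. ip \<tau> (f j) (f i) \<noteq> 0}) \<le> N"
  shows "wint \<tau> (\<lambda>p. (norm (\<Sum>j\<in>J. f j p))\<^sup>2) \<le> N * (\<Sum>j\<in>J. wint \<tau> (\<lambda>p. (norm (f j p))\<^sup>2))"
proof -
  define a where "a = (\<lambda>j. wint \<tau> (\<lambda>p. (norm (f j p))\<^sup>2))"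
  define n where "n = (\<lambda>j i. if ip \<tau> (f j) (f i) \<noteq> 0 then 1 else 0 :: real)"
  have a0: "a j \<ge> 0" for j unfolding a_def by (rule wint_nonneg) simp
  have nsym: "n j i = n i j" for i j
    unfolding n_def using ip_commute[of \<tau> "f i" "f j"] by simp
  have row: "(\<Sum>i\<in>J. n j i) \<le> N" if "j \<in> J" for j
    using ov[OF that] assms(2) by (simp add: n_def sum.If_cases Int_def)
  have "complex_of_real (wint \<tau> (\<lambda>p. (norm (\<Sum>j\<in>J. f j p))\<^sup>2)) = ip \<tau> (\<lambda>p. \<Sum>j\<in>J. f j p) (\<lambda>p. \<Sum>j\<in>J. f j p)"
    by (rule ip_self[symmetric])
  also have "\<dots> = (\<integral>p. (\<Sum>j\<in>J. \<Sum>i\<in>J. f j p * cnj (f i p) * complex_of_real (wt \<tau> p)) \<partial>lborel)"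
    unfolding ip_def by (simp only: cnj_sum sum_product) (simp only: sum_distrib_right)
  also have "\<dots> = (\<Sum>j\<in>J. \<Sum>i\<in>J. ip \<tau> (f j) (f i))"
    unfolding ip_def using assms(1,3)
    by (simp add: Bochner_Integration.integral_sum integrable_ip)
  finally have eq: "complex_of_real (wint \<tau> (\<lambda>p. (norm (\<Sum>j\<in>J. f j p))\<^sup>2)) = (\<Sum>j\<in>J. \<Sum>i\<in>J. ip \<tau> (f j) (f i))" .
  have "wint \<tau> (\<lambda>p. (norm (\<Sum>j\<in>J. f j p))\<^sup>2) \<le> norm (\<Sum>j\<in>J. \<Sum>i\<in>J. ip \<tau> (f j) (f i))"
    unfolding eq[symmetric] norm_of_real by (rule abs_ge_self)
  also have "\<dots> \<le> (\<Sum>j\<in>J. \<Sum>i\<in>J. norm (ip \<tau> (f j) (f i)))"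
    by (rule order_trans[OF norm_sum]) (intro sum_mono norm_sum)
  also have "\<dots> \<le> (\<Sum>j\<in>J. \<Sum>i\<in>J. n j i * ((a j + a i) / 2))"
    using assms norm_ip_le by (intro sum_mono) (auto simp: n_def a_def)
  also have "\<dots> = (\<Sum>j\<in>J. \<Sum>i\<in>J. n j i * a j) / 2 + (\<Sum>j\<in>J. \<Sum>i\<in>J. n j i * a i) / 2"
    by (simp add: sum.distrib add_divide_distrib distrib_left sum_divide_distrib)
  also have "(\<Sum>j\<in>J. \<Sum>i\<in>J. n j i * a i) = (\<Sum>j\<in>J. \<Sum>i\<in>J. n j i * a j)"
    by (subst sum.swap) (simp add: nsym)
  also have "(\<Sum>j\<in>J. \<Sum>i\<in>J. n j i * a j) / 2 + (\<Sum>j\<in>J. \<Sum>i\<in>J. n j i * a j) / 2 = (\<Sum>j\<in>J. (\<Sum>i\<in>J. n j i) * a j)"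
    by (simp add: sum_distrib_right)
  also have "\<dots> \<le> (\<Sum>j\<in>J. N * a j)"
    by (intro sum_mono mult_right_mono row a0)
  finally show ?thesis by (simp add: a_def sum_distrib_left)
qed

text \<open>Functions whose spectrum is contained in \<open>A\<close>, described without Fourier transforms as
  bounded pointwise limits of trigonometric sums with frequencies in \<open>A\<close>.\<close>
definition spec :: "pt set \<Rightarrow> (pt \<Rightarrow> complex) \<Rightarrow> bool" where
  "spec A f \<longleftrightarrow> bc f \<and> (\<exists>g C. (\<forall>n::nat. trig A (g n)) \<and> (\<forall>n p. norm (g n p) \<le> C) \<and> (\<forall>p. (\<lambda>n. g n p) \<longlonglongrightarrow> f p))"

lemma spec_bc: "spec A f \<Longrightarrow> bc f"
  by (simp add: spec_def)

lemma spec_mono: "spec A f \<Longrightarrow> A \<subseteq> B \<Longrightarrow> spec B f"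
  unfolding spec_def using trig_mono by blast

lemma spec_zero: "spec A (\<lambda>p. 0)"
  unfolding spec_def using bc_const trig_zero[of A] by (auto intro!: exI[of _ "\<lambda>n p. 0"] exI[of _ 0])

lemma spec_add:
  assumes "spec A f" "spec A g"
  shows "spec A (\<lambda>p. f p + g p)"
proof -
  from assms obtain f' C g' D where
    f: "\<And>n. trig A (f' n)" "\<And>n p. norm (f' n p) \<le> C" "\<And>p. (\<lambda>n. f' n p) \<longlonglongrightarrow> f p" and
    g: "\<And>n. trig A (g' n)" "\<And>n p. norm (g' n p) \<le> D" "\<And>p. (\<lambda>n. g' n p) \<longlonglongrightarrow> g p"
    unfolding spec_def by blast
  have "norm (f' n p + g' n p) \<le> C + D" for n p
    using f(2)[of n p] g(2)[of n p] norm_triangle_ineq[of "f' n p" "g' n p"] by linarith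
  then show ?thesis
    unfolding spec_def using assms f g
    by (intro conjI exI[of _ "\<lambda>n p. f' n p + g' n p"] exI[of _ "C + D"])
      (auto intro!: bc_add trig_add tendsto_add dest: spec_bc)
qed

lemma spec_sum: "(\<And>i. i \<in> I \<Longrightarrow> spec A (f i)) \<Longrightarrow> spec A (\<lambda>p. \<Sum>i\<in>I. f i p)"
  by (induction I rule: infinite_finite_induct) (auto intro: spec_add spec_zero)

lemma spec_mult:
  assumes "spec A f" "spec B g"
  shows "spec {a + b |a b. a \<in> A \<and> b \<in> B} (\<lambda>p. f p * g p)"
proof -
  from assms obtain f' C g' D where
    f: "\<And>n. trig A (f' n)" "\<And>n p. norm (f' n p) \<le> C" "\<And>p. (\<lambda>n. f' n p) \<longlonglongrightarrow> f p" and
    g: "\<And>n. trig B (g' n)" "\<And>n p. norm (g' n p) \<le> D" "\<And>p. (\<lambda>n. g' n p) \<longlonglongrightarrow> g p"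
    unfolding spec_def by blast
  have "norm (f' n p) * norm (g' n p) \<le> C * D" for n p
    by (intro mult_mono f(2) g(2) norm_ge_zero order_trans[OF norm_ge_zero f(2)[of 0 0]])
  then have "\<forall>n p. norm (f' n p * g' n p) \<le> C * D"
    by (simp add: norm_mult)
  moreover have "\<forall>n. trig {a + b |a b. a \<in> A \<and> b \<in> B} (\<lambda>p. f' n p * g' n p)"
    using trig_mult[OF f(1) g(1)] by blast
  moreover have "\<forall>p. (\<lambda>n. f' n p * g' n p) \<longlonglongrightarrow> f p * g p"
    using tendsto_mult[OF f(3) g(3)] by blast
  ultimately show ?thesis
    unfolding spec_def using bc_mult[OF spec_bc[OF assms(1)] spec_bc[OF assms(2)]]
    by (intro conjI exI[of _ "\<lambda>n p. f' n p * g' n p"] exI[of _ "C * D"])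
qed

lemma spec_cis:
  assumes "\<theta> \<in> A"
  shows "spec A (\<lambda>p. c * cis (\<theta> \<bullet> p))"
  unfolding spec_def
  using trig_single[OF assms, of c]
  by (auto intro!: exI[of _ "\<lambda>n p. c * cis (\<theta> \<bullet> p)"] exI[of _ "norm c"] continuous_intros
      simp: bc_def norm_mult cis_conv_exp)

lemma trig_integrable_wt:
  assumes "\<tau> > 0" "trig D h"
  shows "integrable lborel (\<lambda>p. h p * complex_of_real (wt \<tau> p))"
  using assms(2)
proof induction
  case (trig_step h z c)
  then show ?case
    using integral_cis_wt(1)[OF assms(1), of z]
    by (auto simp: distrib_right mult.assoc intro!: Bochner_Integration.integrable_add)
qed simp

lemma trig_cnj:
  assumes "trig B g"
  shows "trig (uminus ` B) (\<lambda>p. cnj (g p))"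
  using assms
proof induction
  case (trig_step g \<eta> d)
  have "trig (uminus ` B) (\<lambda>p. cnj d * cis ((- \<eta>) \<bullet> p))"
    using trig_step by (intro trig_single) auto
  from trig_add[OF trig_step.IH this] show ?case by (simp add: cis_cnj)
qed (simp add: trig_zero)

text \<open>For single frequencies this is the vanishing of \<open>integral_cis_wt\<close>. It
  extends to trigonometric sums by linearity in each argument and to limits by dominated
  convergence, a multiple of the weight being the majorant.\<close>

lemma ip_eq_0_if_far:
  assumes \<tau>: "\<tau> > 0" and "spec A f" "spec B g"
    and far: "\<And>\<xi> \<eta>. \<xi> \<in> A \<Longrightarrow> \<eta> \<in> B \<Longrightarrow> \<not> near \<tau> (\<xi> - \<eta>)"
  shows "ip \<tau> f g = 0"
proof -
  have single: "ip \<tau> f (\<lambda>p. d * cis (\<eta> \<bullet> p)) = 0" if "trig A f" "\<eta> \<in> B" for f d \<eta>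
    using that(1)
  proof induction
    case (trig_step f \<xi> c)
    have eq: "cis ((\<xi> - \<eta>) \<bullet> p) = cis (\<xi> \<bullet> p) * cis (- (\<eta> \<bullet> p))" for p
      by (simp add: inner_diff_left cis_mult)
    have "(f p + c * cis (\<xi> \<bullet> p)) * cnj (d * cis (\<eta> \<bullet> p)) * complex_of_real (wt \<tau> p)
      = f p * cnj (d * cis (\<eta> \<bullet> p)) * complex_of_real (wt \<tau> p)
        + (c * cnj d) * (cis ((\<xi> - \<eta>) \<bullet> p) * complex_of_real (wt \<tau> p))" for p
      unfolding eq by (simp add: cis_cnj algebra_simps del: cis_mult)
    moreover have "integrable lborel (\<lambda>p. f p * cnj (d * cis (\<eta> \<bullet> p)) * complex_of_real (wt \<tau> p))"
      by (rule trig_integrable_wt[OF \<tau> trig_mult[OF trig_step.hyps(1) trig_cnj[OF trig_single[OF that(2)]]]])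
    ultimately show ?case
      using trig_step integral_cis_wt[OF \<tau>, of "\<xi> - \<eta>"] far[OF trig_step.hyps(2) that(2)]
      unfolding ip_def by simp
  qed (simp add: ip_def)
  have tt: "ip \<tau> f g = 0" if "trig A f" "trig B g" for f g
    using that(2)
  proof induction
    case (trig_step g \<eta> d)
    have 1: "integrable lborel (\<lambda>p. f p * cnj (g p) * complex_of_real (wt \<tau> p))"
      by (rule trig_integrable_wt[OF \<tau> trig_mult[OF that(1) trig_cnj[OF trig_step.hyps(1)]]])
    have 2: "integrable lborel (\<lambda>p. f p * cnj (d * cis (\<eta> \<bullet> p)) * complex_of_real (wt \<tau> p))"
      by (rule trig_integrable_wt[OF \<tau> trig_mult[OF that(1) trig_cnj[OF trig_single[OF trig_step.hyps(2)]]]])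
    show ?case
      using trig_step.IH single[OF that(1) trig_step.hyps(2), of d] 1 2
      unfolding ip_def by (simp add: distrib_left distrib_right)
  qed (simp add: ip_def)
  from assms(2,3) obtain f' C g' D where
    f: "\<And>n. trig A (f' n)" "\<And>n p. norm (f' n p) \<le> C" "\<And>p. (\<lambda>n. f' n p) \<longlonglongrightarrow> f p" and
    g: "\<And>n. trig B (g' n)" "\<And>n p. norm (g' n p) \<le> D" "\<And>p. (\<lambda>n. g' n p) \<longlonglongrightarrow> g p"
    unfolding spec_def by blast
  have bcs: "bc f" "bc g" using assms by (auto dest: spec_bc)
  have meas: "(\<lambda>p. f p * cnj (g p) * complex_of_real (wt \<tau> p)) \<in> borel_measurable lborel"
    using integrable_ip[OF \<tau> bcs] by auto
  have "(\<lambda>n. ip \<tau> (f' n) (g' n)) \<longlonglongrightarrow> ip \<tau> f g"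
    unfolding ip_def
  proof (rule integral_dominated_convergence[where w="\<lambda>p. C * D * wt \<tau> p"])
    show "integrable lborel (\<lambda>p. C * D * wt \<tau> p)"
      using integrable_wt[OF \<tau>] by simp
    show "(\<lambda>p. f' n p * cnj (g' n p) * complex_of_real (wt \<tau> p)) \<in> borel_measurable lborel" for n
      using trig_integrable_wt[OF \<tau> trig_mult[OF f(1) trig_cnj[OF g(1)]]] by auto
    show "AE p in lborel. (\<lambda>n. f' n p * cnj (g' n p) * complex_of_real (wt \<tau> p)) \<longlonglongrightarrow> f p * cnj (g p) * complex_of_real (wt \<tau> p)"
      using f(3) g(3) by (auto intro!: tendsto_intros)
    have "norm (f' n p) * norm (g' n p) * wt \<tau> p \<le> C * D * wt \<tau> p" for n p
      by (intro mult_right_mono mult_mono f(2) g(2) norm_ge_zero wt_nonneg order_trans[OF norm_ge_zero f(2)[of 0 0]])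
    then show "AE p in lborel. norm (f' n p * cnj (g' n p) * complex_of_real (wt \<tau> p)) \<le> C * D * wt \<tau> p" for n
      by (simp add: norm_mult)
  qed (rule meas)
  then show ?thesis
    using tt[OF f(1) g(1)] by (simp add: LIMSEQ_const_iff)
qed

section \<open>Wave packets\<close>

text \<open>A one-dimensional wave packet: frequency about \<open>v\<close> with uncertainty
  \<open>h\<close>, position within about 1 / \<open>h\<close> of the origin.\<close>

definition kf :: "real \<Rightarrow> real \<Rightarrow> real \<Rightarrow> complex" where
  "kf v h z = cis (v * z) * complex_of_real (fejer (h * z))"

lemma norm_kf: "norm (kf v h z) = fejer (h * z)"
  by (simp add: kf_def norm_mult)

lemma norm_kf_le: "norm (kf v h z) \<le> 4 / (1 + (h * z)\<^sup>2)"
  by (simp add: norm_kf fejer_decay)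

text \<open>A shift of at most 1 / \<open>h\<close> does not leave the bulk of the envelope, so the
  decay at \<open>z\<close> also controls \<open>z'\<close>. The rate is
  \<open>\<bar>v\<bar>\<close> from the oscillation plus \<open>h\<close> from the envelope.\<close>

lemma kf_lipschitz:
  assumes "0 \<le> h" "\<bar>z - z'\<bar> \<le> e" "h * e \<le> 1"
  shows "norm (kf v h z - kf v h z') \<le> 18 * (\<bar>v\<bar> + h) * e / (1 + (h * z)\<^sup>2)"
    and "norm (kf v h z') \<le> 22 / (1 + (h * z)\<^sup>2)"
proof -
  let ?d = "1 + (h * z)\<^sup>2"
  have d: "?d > 0" by (simp add: add_pos_nonneg)
  have he: "\<bar>h * z - h * z'\<bar> \<le> h * e"
    using mult_left_mono[OF assms(2,1)] assms(1) by (simp add: right_diff_distrib[symmetric] abs_mult)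
  then have "\<bar>fejer (h * z) - fejer (h * z')\<bar> \<le> 18 * \<bar>h * z - h * z'\<bar> / ?d"
    using assms by (intro fejer_lipschitz_decay) linarith
  also have "\<dots> \<le> 18 * (h * e) / ?d"
    using he d by (intro divide_right_mono mult_left_mono) auto
  finally have 1: "\<bar>fejer (h * z) - fejer (h * z')\<bar> \<le> 18 * (h * e) / ?d" .
  have "norm (cis (v * z) - cis (v * z')) \<le> \<bar>v\<bar> * e"
    using norm_cis_diff_le[of "v * z" "v * z'"] mult_left_mono[OF assms(2), of "\<bar>v\<bar>"]
    by (simp add: right_diff_distrib[symmetric] abs_mult)
  then have 2: "norm (cis (v * z) - cis (v * z')) * fejer (h * z) \<le> (\<bar>v\<bar> * e) * (4 / ?d)"
    using assms(2) by (intro mult_mono fejer_decay) auto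
  have "kf v h z - kf v h z' = (cis (v * z) - cis (v * z')) * of_real (fejer (h * z))
      + cis (v * z') * of_real (fejer (h * z) - fejer (h * z'))"
    by (simp add: kf_def algebra_simps)
  then have "norm (kf v h z - kf v h z') \<le> norm (cis (v * z) - cis (v * z')) * fejer (h * z)
      + \<bar>fejer (h * z) - fejer (h * z')\<bar>"
    using norm_triangle_ineq[of "(cis (v * z) - cis (v * z')) * of_real (fejer (h * z))"
        "cis (v * z') * complex_of_real (fejer (h * z) - fejer (h * z'))"]
    by (simp only: norm_mult norm_of_real norm_cis mult_1 abs_of_nonneg[OF fejer_nonneg])
  also have "\<dots> \<le> (\<bar>v\<bar> * e) * (4 / ?d) + 18 * (h * e) / ?d"
    using 1 2 by linarith
  also have "\<dots> = (4 * \<bar>v\<bar> * e + 18 * h * e) / ?d"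
    by (simp add: add_divide_distrib mult_ac)
  also have "\<dots> \<le> 18 * (\<bar>v\<bar> + h) * e / ?d"
    using d assms(2) by (intro divide_right_mono) (auto simp: algebra_simps intro!: mult_right_mono)
  finally show "norm (kf v h z - kf v h z') \<le> 18 * (\<bar>v\<bar> + h) * e / ?d" .
  have "18 * (h * e) / ?d \<le> 18 / ?d"
    using assms(3) d by (intro divide_right_mono) auto
  then have "fejer (h * z') \<le> 4 / ?d + 18 / ?d"
    using 1 fejer_decay[of "h * z"] by linarith
  then show "norm (kf v h z') \<le> 22 / ?d"
    by (simp add: norm_kf add_divide_distrib[symmetric])
qed

lemma spec_snc:
  assumes "0 \<le> h"
  shows "spec {t *\<^sub>R \<theta> |t. \<bar>t\<bar> \<le> h} (\<lambda>p. complex_of_real (snc (h * (\<theta> \<bullet> p - a))))"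
  unfolding spec_def
proof (intro conjI exI[of _ "\<lambda>n p. dmean n (h * (\<theta> \<bullet> p - a))"] exI[of _ 1] allI)
  show "bc (\<lambda>p. complex_of_real (snc (h * (\<theta> \<bullet> p - a))))"
    unfolding bc_def using abs_snc_le_1
    by (auto intro!: continuous_intros continuous_on_compose2[OF continuous_snc[of UNIV]])
  fix n :: nat
  let ?t = "\<lambda>j. (2 * real j + 1 - real (Suc n)) / real (Suc n)"
  have eq: "dmean n (h * (\<theta> \<bullet> p - a)) = (\<Sum>j<Suc n. (cis (- (?t j * h * a)) / of_nat (Suc n)) * cis (((?t j * h) *\<^sub>R \<theta>) \<bullet> p))" for p
  proof -
    have "cis (t * (h * (\<theta> \<bullet> p - a))) = cis (- (t * h * a)) * cis (((t * h) *\<^sub>R \<theta>) \<bullet> p)" for t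
      by (simp add: cis_mult algebra_simps)
    then show ?thesis
      unfolding dmean_def sum_divide_distrib by (intro sum.cong refl) (simp only: times_divide_eq_left[symmetric])
  qed
  show "trig {t *\<^sub>R \<theta> |t. \<bar>t\<bar> \<le> h} (\<lambda>p. dmean n (h * (\<theta> \<bullet> p - a)))"
    unfolding eq
  proof (intro trig_sum trig_single CollectI exI conjI)
    fix j assume "j \<in> {..<Suc n}"
    then have "\<bar>?t j\<bar> \<le> 1" using dirichlet_node_le[of j n] by simp
    then show "\<bar>?t j * h\<bar> \<le> h"
      unfolding abs_mult using assms mult_right_mono[of "\<bar>?t j\<bar>" 1 "\<bar>h\<bar>"] by linarith
  qed (rule refl)
qed (auto simp: norm_dmean_le dmean_tendsto)

text \<open>The width is 2 \<open>h\<close> because the envelope is a product of two sinc factors,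
  each with frequencies up to \<open>h\<close>.\<close>

lemma spec_kf:
  assumes "0 \<le> h"
  shows "spec {t *\<^sub>R \<theta> |t. \<bar>t - v\<bar> \<le> 2 * h} (\<lambda>p. kf v h (\<theta> \<bullet> p - a))"
proof -
  have c: "spec {v *\<^sub>R \<theta>} (\<lambda>p. cis (- (v * a)) * cis ((v *\<^sub>R \<theta>) \<bullet> p))"
    by (rule spec_cis) simp
  let ?A = "{t *\<^sub>R \<theta> |t. \<bar>t\<bar> \<le> h}"
  have eq: "(\<lambda>p. cis (- (v * a)) * cis ((v *\<^sub>R \<theta>) \<bullet> p) *
     (complex_of_real (snc (h * (\<theta> \<bullet> p - a))) * complex_of_real (snc (h * (\<theta> \<bullet> p - a)))))
     = (\<lambda>p. kf v h (\<theta> \<bullet> p - a))"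
    by (simp add: kf_def fejer_def power2_eq_square cis_mult right_diff_distrib)
  have "spec {x + b |x b. x \<in> {v *\<^sub>R \<theta>} \<and> b \<in> {a + b |a b. a \<in> ?A \<and> b \<in> ?A}} (\<lambda>p. kf v h (\<theta> \<bullet> p - a))"
    unfolding eq[symmetric] by (intro spec_mult c spec_snc assms)
  then show ?thesis
  proof (rule spec_mono)
    show "{x + b |x b. x \<in> {v *\<^sub>R \<theta>} \<and> b \<in> {a + b |a b. a \<in> ?A \<and> b \<in> ?A}}
       \<subseteq> {t *\<^sub>R \<theta> |t. \<bar>t - v\<bar> \<le> 2 * h}"
    proof
      fix x assume "x \<in> {x + b |x b. x \<in> {v *\<^sub>R \<theta>} \<and> b \<in> {a + b |a b. a \<in> {t *\<^sub>R \<theta> |t. \<bar>t\<bar> \<le> h} \<and> b \<in> {t *\<^sub>R \<theta> |t. \<bar>t\<bar> \<le> h}}}"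
      then obtain s t where "\<bar>s\<bar> \<le> h" "\<bar>t\<bar> \<le> h" "x = v *\<^sub>R \<theta> + (s *\<^sub>R \<theta> + t *\<^sub>R \<theta>)"
        by blast
      then have "x = (v + (s + t)) *\<^sub>R \<theta>" "\<bar>(v + (s + t)) - v\<bar> \<le> 2 * h"
        by (auto simp: scaleR_add_left)
      then show "x \<in> {t *\<^sub>R \<theta> |t. \<bar>t - v\<bar> \<le> 2 * h}" by blast
    qed
  qed
qed

section \<open>Coordinates adapted to the cone, and layers of wave packets\<close>

text \<open>On p = (B, C, W), \<open>th2 y\<close> reads off x = W + C y, and \<open>th1 y\<close>
  reads off t + y x with t = W y - B. This basis is preferred to the one for x and t because the
  quadratic form w^2 + 4 u v, taken at (u, v, w), has the value t^2 at the frequency s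
  \<open>th1 y\<close> + t \<open>th2 y\<close>: the second coefficient alone measures the distance
  to the cone, and \<open>th2\<close> is half the derivative of \<open>th1\<close>.\<close>

definition th1 :: "real \<Rightarrow> pt" where "th1 y = (-1, y\<^sup>2, 2 * y)"
definition th2 :: "real \<Rightarrow> pt" where "th2 y = (0, y, 1)"

definition band :: "real \<Rightarrow> real \<Rightarrow> real \<Rightarrow> real \<Rightarrow> real \<Rightarrow> pt set" where
  "band v h r g y = {s *\<^sub>R th1 y + t *\<^sub>R th2 y |s t. \<bar>s - v\<bar> \<le> 2 * h \<and> \<bar>t - r\<bar> \<le> 2 * g}"

text \<open>With c = (m, l) the packet is centred on the lines that pass through x = m \<delta>, t =
  l \<delta> in the slice at height y; the term y m \<delta> appears since \<open>th1\<close> reads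
  t + y x.\<close>

definition pk :: "real \<Rightarrow> real \<Rightarrow> real \<Rightarrow> real \<Rightarrow> real \<Rightarrow> real \<Rightarrow> int \<times> int \<Rightarrow> pt \<Rightarrow> complex" where
  "pk \<delta> v h r g y c p =
     kf v h (th1 y \<bullet> p - (of_int (snd c) * \<delta> + y * (of_int (fst c) * \<delta>))) * kf r g (th2 y \<bullet> p - of_int (fst c) * \<delta>)"

text \<open>The normalisation is uniform in the widths: a packet has weighted integral O(1 / (h g
  \<tau>)) and the packets at one point add up to O(1 / (h g \<delta>^2)), so a layer is O(\<delta>)
  pointwise and carries O(\<delta>^3) of weighted mass, the volume of a cube, per lattice
  point.\<close>

definition layer :: "real \<Rightarrow> real \<Rightarrow> real \<Rightarrow> real \<Rightarrow> real \<Rightarrow> real \<Rightarrow> (int \<times> int) set \<Rightarrow> pt \<Rightarrow> complex" where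
  "layer \<delta> v h r g y S p = complex_of_real (\<delta> ^ 3 * h * g) * (\<Sum>c\<in>S. pk \<delta> v h r g y c p)"

lemma spec_pk:
  assumes "0 \<le> h" "0 \<le> g"
  shows "spec (band v h r g y) (pk \<delta> v h r g y c)"
  unfolding pk_def[abs_def]
  by (rule spec_mono[OF spec_mult[OF spec_kf[OF assms(1)] spec_kf[OF assms(2)]]]) (force simp: band_def)

lemma spec_cmult: "spec A f \<Longrightarrow> spec A (\<lambda>p. c * f p)"
  using spec_mono[OF spec_mult[OF spec_cis[of 0 "{0}" c], of A f], of A] by fastforce

lemma spec_layer:
  assumes "0 \<le> h" "0 \<le> g"
  shows "spec (band v h r g y) (layer \<delta> v h r g y S)"
  unfolding layer_def[abs_def] by (intro spec_cmult spec_sum spec_pk assms)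

text \<open>Summing over \<open>snd c\<close> first is harmless: for fixed \<open>fst c\<close> the
  shear by y only translates the inner sum.\<close>

lemma lattice_cell_sum_bound:
  fixes S :: "(int \<times> int) set" and h g \<delta> \<alpha> \<beta> y :: real
  assumes "finite S" "0 < h" "0 < g" "0 < \<delta>" "h * \<delta> \<le> 1" "g * \<delta> \<le> 1"
  shows "(\<Sum>c\<in>S. 1 / (1 + (h * (\<alpha> - (of_int (snd c) * \<delta> + y * (of_int (fst c) * \<delta>))))\<^sup>2)
      * (1 / (1 + (g * (\<beta> - of_int (fst c) * \<delta>))\<^sup>2))) \<le> 100 / (h * g * \<delta>\<^sup>2)"
proof -
  let ?a = "\<lambda>m n. 1 / (1 + (h * (\<alpha> - (of_int n * \<delta> + y * (of_int m * \<delta>))))\<^sup>2)"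
  let ?b = "\<lambda>m. 1 / (1 + (g * (\<beta> - of_int m * \<delta>))\<^sup>2)"
  have nn: "0 \<le> ?a m n \<and> 0 \<le> ?b m" for m n :: int by simp
  have "(\<Sum>c\<in>S. ?a (fst c) (snd c) * ?b (fst c)) \<le> (\<Sum>c\<in>fst ` S \<times> snd ` S. ?a (fst c) (snd c) * ?b (fst c))"
    using assms(1) nn by (intro sum_mono2 finite_cartesian_product finite_imageI subset_fst_snd) auto
  also have "\<dots> = (\<Sum>m\<in>fst ` S. \<Sum>n\<in>snd ` S. ?a m n * ?b m)"
    by (subst sum.cartesian_product) (simp add: case_prod_beta)
  also have "\<dots> = (\<Sum>m\<in>fst ` S. (\<Sum>n\<in>snd ` S. ?a m n) * ?b m)"
    by (simp only: sum_distrib_right)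
  also have "\<dots> \<le> (\<Sum>m\<in>fst ` S. 10 / (h * \<delta>) * ?b m)"
  proof (intro sum_mono mult_right_mono)
    fix m :: int
    show "0 \<le> ?b m" by simp
    have *: "\<alpha> - (of_int n * \<delta> + y * (of_int m * \<delta>)) = (\<alpha> - y * (of_int m * \<delta>)) - of_int n * \<delta>" for n :: int
      by simp
    show "(\<Sum>n\<in>snd ` S. ?a m n) \<le> 10 / (h * \<delta>)"
      unfolding * using assms by (intro lattice_fejer_sum_bound) auto
  qed
  also have "\<dots> = 10 / (h * \<delta>) * (\<Sum>m\<in>fst ` S. ?b m)"
    by (simp only: sum_distrib_left)
  also have "\<dots> \<le> 10 / (h * \<delta>) * (10 / (g * \<delta>))"
    using lattice_fejer_sum_bound[of "fst ` S" g \<delta> \<beta>] assms by (intro mult_left_mono) auto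
  also have "\<dots> = 100 / (h * g * \<delta>\<^sup>2)"
    by (simp add: power2_eq_square mult_ac)
  finally show ?thesis .
qed

lemma norm_layer_le:
  assumes "finite S" "0 < h" "0 < g" "0 < \<delta>" "h * \<delta> \<le> 1" "g * \<delta> \<le> 1"
  shows "norm (layer \<delta> v h r g y S p) \<le> 1600 * \<delta>"
proof -
  let ?q = "\<lambda>c::int\<times>int. 1 / (1 + (h * (th1 y \<bullet> p - (of_int (snd c) * \<delta> + y * (of_int (fst c) * \<delta>))))\<^sup>2)
      * (1 / (1 + (g * (th2 y \<bullet> p - of_int (fst c) * \<delta>))\<^sup>2))"
  have "norm (\<Sum>c\<in>S. pk \<delta> v h r g y c p) \<le> (\<Sum>c\<in>S. 16 * ?q c)"
  proof (rule order_trans[OF norm_sum], rule sum_mono)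
    fix c
    have "norm (pk \<delta> v h r g y c p) \<le> (4 / (1 + (h * (th1 y \<bullet> p - (of_int (snd c) * \<delta> + y * (of_int (fst c) * \<delta>))))\<^sup>2))
        * (4 / (1 + (g * (th2 y \<bullet> p - of_int (fst c) * \<delta>))\<^sup>2))"
      unfolding pk_def norm_mult by (intro mult_mono norm_kf_le) (auto simp: add_nonneg_nonneg)
    then show "norm (pk \<delta> v h r g y c p) \<le> 16 * ?q c"
      by simp
  qed
  also have "\<dots> = 16 * (\<Sum>c\<in>S. ?q c)" by (simp only: sum_distrib_left)
  also have "\<dots> \<le> 16 * (100 / (h * g * \<delta>\<^sup>2))"
    by (intro mult_left_mono lattice_cell_sum_bound assms) simp
  finally have *: "norm (\<Sum>c\<in>S. pk \<delta> v h r g y c p) \<le> 16 * (100 / (h * g * \<delta>\<^sup>2))" .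
  have "norm (layer \<delta> v h r g y S p) \<le> \<delta> ^ 3 * h * g * (16 * (100 / (h * g * \<delta>\<^sup>2)))"
    unfolding layer_def norm_mult norm_of_real using assms
    by (subst abs_of_nonneg) (simp, rule mult_left_mono[OF *], simp)
  also have "\<dots> = 1600 * \<delta>"
    using assms by (simp add: power2_eq_square power3_eq_cube)
  finally show ?thesis .
qed

lemma inner_th_diff_le:
  fixes p p' :: pt
  assumes "\<bar>fst p - fst p'\<bar> \<le> \<eta>" "\<bar>fst (snd p) - fst (snd p')\<bar> \<le> \<eta>" "\<bar>snd (snd p) - snd (snd p')\<bar> \<le> \<eta>"
    and "\<bar>y\<bar> \<le> Y" "1 \<le> Y"
  shows "\<bar>th1 y \<bullet> p - th1 y \<bullet> p'\<bar> \<le> 4 * Y\<^sup>2 * \<eta>" "\<bar>th2 y \<bullet> p - th2 y \<bullet> p'\<bar> \<le> 4 * Y\<^sup>2 * \<eta>"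
proof -
  obtain a b c a' b' c' where p: "p = (a, b, c)" "p' = (a', b', c')"
    by (cases p; cases p')
  have \<eta>: "0 \<le> \<eta>" using assms(1) by linarith
  have y2: "y\<^sup>2 \<le> Y\<^sup>2" using power_mono[OF assms(4), of 2] by simp
  have YY: "Y \<le> Y\<^sup>2" "1 \<le> Y\<^sup>2" using assms(5) self_le_power[of Y 2] by auto
  have 1: "\<bar>y\<^sup>2 * (b - b')\<bar> \<le> Y\<^sup>2 * \<eta>"
    unfolding abs_mult using assms(2) y2 by (intro mult_mono) (auto simp: p)
  have 2: "\<bar>y * (c - c')\<bar> \<le> Y\<^sup>2 * \<eta>" "\<bar>y * (b - b')\<bar> \<le> Y\<^sup>2 * \<eta>"
    unfolding abs_mult using assms(2,3,4) YY by (intro mult_mono; auto simp: p)+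
  have 3: "\<eta> \<le> Y\<^sup>2 * \<eta>" using mult_right_mono[OF YY(2) \<eta>] by simp
  have "th1 y \<bullet> p - th1 y \<bullet> p' = - (a - a') + y\<^sup>2 * (b - b') + 2 * (y * (c - c'))"
    by (simp add: th1_def p algebra_simps)
  then show "\<bar>th1 y \<bullet> p - th1 y \<bullet> p'\<bar> \<le> 4 * Y\<^sup>2 * \<eta>"
    using 1 2 3 assms(1) by (simp add: p)
  have "th2 y \<bullet> p - th2 y \<bullet> p' = y * (b - b') + (c - c')"
    by (simp add: th2_def p algebra_simps)
  then show "\<bar>th2 y \<bullet> p - th2 y \<bullet> p'\<bar> \<le> 4 * Y\<^sup>2 * \<eta>"
    using 2 3 assms(3) \<eta> by (simp add: p)
qed

text \<open>Compared with the pointwise bound O(\<delta>) the increment gains X e: a layer is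
  essentially constant at scale 1 / X, where X is the size of its frequencies.\<close>

lemma layer_lipschitz:
  assumes "finite S" "0 < h" "0 < g" "0 < \<delta>" "h * \<delta> \<le> 1" "g * \<delta> \<le> 1"
    and e: "\<bar>th1 y \<bullet> p - th1 y \<bullet> p'\<bar> \<le> e" "\<bar>th2 y \<bullet> p - th2 y \<bullet> p'\<bar> \<le> e"
    and X: "\<bar>v\<bar> + h + \<bar>r\<bar> + g \<le> X" "X * e \<le> 1"
  shows "norm (layer \<delta> v h r g y S p - layer \<delta> v h r g y S p') \<le> 40000 * \<delta> * X * e"
proof -
  let ?A = "\<lambda>c::int\<times>int. 1 + (h * (th1 y \<bullet> p - (of_int (snd c) * \<delta> + y * (of_int (fst c) * \<delta>))))\<^sup>2"
  let ?B = "\<lambda>c::int\<times>int. 1 + (g * (th2 y \<bullet> p - of_int (fst c) * \<delta>))\<^sup>2"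
  have AB: "?A c > 0" "?B c > 0" for c by (auto simp: add_pos_nonneg)
  have e0: "0 \<le> e" using e by linarith
  have "h * e \<le> X * e" "g * e \<le> X * e"
    using X(1) assms(2,3) e0 by (auto intro!: mult_right_mono)
  then have he: "h * e \<le> 1" "g * e \<le> 1" using X by auto
  have one: "norm (pk \<delta> v h r g y c p - pk \<delta> v h r g y c p') \<le> 400 * X * e * (1 / ?A c * (1 / ?B c))" for c
  proof -
    let ?u = "of_int (snd c) * \<delta> + y * (of_int (fst c) * \<delta>)" and ?w = "of_int (fst c) * \<delta>"
    let ?k = "kf v h (th1 y \<bullet> p - ?u)" and ?k' = "kf v h (th1 y \<bullet> p' - ?u)"
    let ?l = "kf r g (th2 y \<bullet> p - ?w)" and ?l' = "kf r g (th2 y \<bullet> p' - ?w)"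
    have 1: "norm (?k - ?k') \<le> 18 * (\<bar>v\<bar> + h) * e / ?A c" "norm ?k' \<le> 22 / ?A c"
      using assms e he by (intro kf_lipschitz; simp)+
    have 2: "norm (?l - ?l') \<le> 18 * (\<bar>r\<bar> + g) * e / ?B c"
      using assms e he by (intro kf_lipschitz) simp_all
    have "pk \<delta> v h r g y c p - pk \<delta> v h r g y c p' = (?k - ?k') * ?l + ?k' * (?l - ?l')"
      by (simp add: pk_def algebra_simps)
    then have "norm (pk \<delta> v h r g y c p - pk \<delta> v h r g y c p') \<le> norm (?k - ?k') * norm ?l + norm ?k' * norm (?l - ?l')"
      using norm_triangle_ineq[of "(?k - ?k') * ?l" "?k' * (?l - ?l')"] by (simp only: norm_mult)
    also have "\<dots> \<le> (18 * (\<bar>v\<bar> + h) * e / ?A c) * (4 / ?B c) + (22 / ?A c) * (18 * (\<bar>r\<bar> + g) * e / ?B c)"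
      using 1 2 AB[of c] assms e0 by (intro add_mono mult_mono norm_kf_le) (auto intro!: divide_nonneg_pos)
    also have "\<dots> = (72 * (\<bar>v\<bar> + h) + 396 * (\<bar>r\<bar> + g)) * e * (1 / ?A c * (1 / ?B c))"
      by (simp add: add_divide_distrib[symmetric] algebra_simps)
    also have "\<dots> \<le> (400 * X) * e * (1 / ?A c * (1 / ?B c))"
      using X(1) e0 AB[of c] assms by (intro mult_right_mono) auto
    finally show ?thesis .
  qed
  have X0: "0 \<le> X" using X(1) assms by linarith
  have "norm (layer \<delta> v h r g y S p - layer \<delta> v h r g y S p')
     = \<delta> ^ 3 * h * g * norm (\<Sum>c\<in>S. pk \<delta> v h r g y c p - pk \<delta> v h r g y c p')"
    unfolding layer_def right_diff_distrib[symmetric] sum_subtractf[symmetric] norm_mult norm_of_real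
    using assms by simp
  also have "\<dots> \<le> \<delta> ^ 3 * h * g * (\<Sum>c\<in>S. 400 * X * e * (1 / ?A c * (1 / ?B c)))"
    using assms by (intro mult_left_mono order_trans[OF norm_sum] sum_mono one) auto
  also have "\<dots> = \<delta> ^ 3 * h * g * (400 * X * e * (\<Sum>c\<in>S. 1 / ?A c * (1 / ?B c)))"
    by (simp only: sum_distrib_left)
  also have "\<dots> \<le> \<delta> ^ 3 * h * g * (400 * X * e * (100 / (h * g * \<delta>\<^sup>2)))"
    using assms X0 e0 by (intro mult_left_mono lattice_cell_sum_bound) auto
  also have "\<dots> = 40000 * \<delta> * X * e"
    using assms by (simp add: power2_eq_square power3_eq_cube)
  finally show ?thesis .
qed

text \<open>Integrate in the order B, W, C: the first factor is the only one containing B, with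
  coefficient -1; the second contains W with coefficient 1; the weight alone makes the integral over
  C converge. Each integration costs 13, an upper bound for 4 pi, and 13^3 = 2197.\<close>

lemma nn_integral_pk_le:
  assumes "0 < \<tau>" "0 < h" "0 < g"
  shows "(\<integral>\<^sup>+p. ennreal (norm (pk \<delta> v h r g y c p) * wt \<tau> p) \<partial>lborel) \<le> ennreal (2197 / (h * g * \<tau>))"
proof -
  let ?u = "of_int (snd c) * \<delta> + y * (of_int (fst c) * \<delta>)" and ?w = "of_int (fst c) * \<delta>"
  have [measurable]: "(\<lambda>x. fejer (f x)) \<in> borel_measurable M" if "f \<in> borel_measurable M" for f and M :: "'a measure"
    using measurable_compose[OF that borel_measurable_fejer] .
  have "(\<integral>\<^sup>+p. ennreal (norm (pk \<delta> v h r g y c p) * wt \<tau> p) \<partial>lborel)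
     \<le> (\<integral>\<^sup>+p. ennreal (fejer (h * (th1 y \<bullet> p - ?u))) * (ennreal (fejer (g * (th2 y \<bullet> p - ?w))) * ennreal (fejer (\<tau> * fst (snd p)))) \<partial>lborel)"
  proof (rule nn_integral_mono)
    fix p :: pt
    have "wt \<tau> p \<le> fejer (\<tau> * fst (snd p))"
      unfolding wt_def
      using mult_mono[OF fejer_le_1[of "\<tau> * fst p"] mult_mono[OF order_refl[of "fejer (\<tau> * fst (snd p))"] fejer_le_1[of "\<tau> * snd (snd p)"]]]
      by simp
    then show "ennreal (norm (pk \<delta> v h r g y c p) * wt \<tau> p) \<le> ennreal (fejer (h * (th1 y \<bullet> p - ?u))) * (ennreal (fejer (g * (th2 y \<bullet> p - ?w))) * ennreal (fejer (\<tau> * fst (snd p))))"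
      by (simp add: pk_def norm_mult norm_kf ennreal_mult[symmetric] mult.assoc mult_left_mono ennreal_leI)
  qed
  also have "\<dots> = (\<integral>\<^sup>+q. (\<integral>\<^sup>+B. ennreal (fejer (h * (th1 y \<bullet> (B, q) - ?u))) * (ennreal (fejer (g * (th2 y \<bullet> (B, q) - ?w))) * ennreal (fejer (\<tau> * fst q))) \<partial>lborel) \<partial>lborel)"
  proof -
    have m: "(\<lambda>p. ennreal (fejer (h * (th1 y \<bullet> p - ?u))) * (ennreal (fejer (g * (th2 y \<bullet> p - ?w))) * ennreal (fejer (\<tau> * fst (snd p)))))
        \<in> borel_measurable (lborel :: pt measure)"
      by (intro borel_measurable_times_ennreal measurable_compose[OF _ measurable_ennreal])
        (auto intro!: borel_measurable_continuous_onI continuous_intros)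
    show ?thesis
      using lborel_pair.nn_integral_snd[where f="\<lambda>p. ennreal (fejer (h * (th1 y \<bullet> p - ?u))) * (ennreal (fejer (g * (th2 y \<bullet> p - ?w))) * ennreal (fejer (\<tau> * fst (snd p))))"] m
      by (simp add: lborel_prod)
  qed
  also have "\<dots> \<le> (\<integral>\<^sup>+q. ennreal (13 / h) * (ennreal (fejer (g * (y * fst q + snd q - ?w))) * ennreal (fejer (\<tau> * fst q))) \<partial>(lborel :: (real \<times> real) measure))"
  proof (rule nn_integral_mono)
    fix q :: "real \<times> real"
    have "(\<integral>\<^sup>+B. ennreal (fejer (h * (th1 y \<bullet> (B, q) - ?u))) * (ennreal (fejer (g * (th2 y \<bullet> (B, q) - ?w))) * ennreal (fejer (\<tau> * fst q))) \<partial>lborel)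
      = (\<integral>\<^sup>+B. ennreal (fejer (h * (y\<^sup>2 * fst q + 2 * y * snd q - ?u) + (- h) * B)) \<partial>lborel) * (ennreal (fejer (g * (y * fst q + snd q - ?w))) * ennreal (fejer (\<tau> * fst q)))"
      by (subst nn_integral_multc[symmetric]) (auto simp: th1_def th2_def inner_prod_def algebra_simps intro!: nn_integral_cong)
    also have "\<dots> \<le> ennreal (13 / h) * (ennreal (fejer (g * (y * fst q + snd q - ?w))) * ennreal (fejer (\<tau> * fst q)))"
      using nn_integral_fejer_le[of "- h"] assms by (intro mult_right_mono) auto
    finally show "(\<integral>\<^sup>+B. ennreal (fejer (h * (th1 y \<bullet> (B, q) - ?u))) * (ennreal (fejer (g * (th2 y \<bullet> (B, q) - ?w))) * ennreal (fejer (\<tau> * fst q))) \<partial>lborel)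
      \<le> ennreal (13 / h) * (ennreal (fejer (g * (y * fst q + snd q - ?w))) * ennreal (fejer (\<tau> * fst q)))" .
  qed
  also have "\<dots> = ennreal (13 / h) * (\<integral>\<^sup>+q. ennreal (fejer (g * (y * fst q + snd q - ?w))) * ennreal (fejer (\<tau> * fst q)) \<partial>(lborel :: (real \<times> real) measure))"
    by (rule nn_integral_cmult, intro borel_measurable_times_ennreal measurable_compose[OF _ measurable_ennreal])
      (auto intro!: borel_measurable_continuous_onI continuous_intros)
  also have "(\<integral>\<^sup>+q. ennreal (fejer (g * (y * fst q + snd q - ?w))) * ennreal (fejer (\<tau> * fst q)) \<partial>(lborel :: (real \<times> real) measure))
     = (\<integral>\<^sup>+C. (\<integral>\<^sup>+W. ennreal (fejer (g * (y * C + W - ?w))) * ennreal (fejer (\<tau> * C)) \<partial>lborel) \<partial>lborel)"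
  proof -
    have m: "(\<lambda>q. ennreal (fejer (g * (y * fst q + snd q - ?w))) * ennreal (fejer (\<tau> * fst q)))
        \<in> borel_measurable (lborel :: (real \<times> real) measure)"
      by (intro borel_measurable_times_ennreal measurable_compose[OF _ measurable_ennreal])
        (auto intro!: borel_measurable_continuous_onI continuous_intros)
    show ?thesis
      using lborel.nn_integral_fst[OF m[folded lborel_prod]] by (simp add: lborel_prod)
  qed
  also have "\<dots> \<le> (\<integral>\<^sup>+C. ennreal (13 / g) * ennreal (fejer (\<tau> * C)) \<partial>lborel)"
  proof (rule nn_integral_mono)
    fix C :: real
    have "(\<integral>\<^sup>+W. ennreal (fejer (g * (y * C + W - ?w))) * ennreal (fejer (\<tau> * C)) \<partial>lborel)
      = (\<integral>\<^sup>+W. ennreal (fejer (g * (y * C - ?w) + g * W)) \<partial>lborel) * ennreal (fejer (\<tau> * C))"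
      by (subst nn_integral_multc[symmetric]) (auto simp: algebra_simps intro!: nn_integral_cong)
    also have "\<dots> \<le> ennreal (13 / g) * ennreal (fejer (\<tau> * C))"
      using nn_integral_fejer_le[of g] assms by (intro mult_right_mono) auto
    finally show "(\<integral>\<^sup>+W. ennreal (fejer (g * (y * C + W - ?w))) * ennreal (fejer (\<tau> * C)) \<partial>lborel) \<le> ennreal (13 / g) * ennreal (fejer (\<tau> * C))" .
  qed
  also have "\<dots> = ennreal (13 / g) * (\<integral>\<^sup>+C. ennreal (fejer (0 + \<tau> * C)) \<partial>lborel)"
    by (simp add: nn_integral_cmult)
  also have "\<dots> \<le> ennreal (13 / g) * ennreal (13 / \<tau>)"
    using nn_integral_fejer_le[of \<tau> 0] assms by (intro mult_left_mono) auto
  finally have "(\<integral>\<^sup>+p. ennreal (norm (pk \<delta> v h r g y c p) * wt \<tau> p) \<partial>lborel) \<le> ennreal (13 / h) * (ennreal (13 / g) * ennreal (13 / \<tau>))"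
    by (simp add: mult_left_mono)
  also have "\<dots> = ennreal (2197 / (h * g * \<tau>))"
    using assms by (simp add: ennreal_mult[symmetric] mult_ac)
  finally show ?thesis .
qed

lemma wint_norm_layer_le:
  assumes "0 < \<tau>" "0 < h" "0 < g" "0 < \<delta>"
  shows "wint \<tau> (\<lambda>p. norm (layer \<delta> v h r g y S p)) \<le> 2197 / \<tau> * \<delta> ^ 3 * real (card S)"
proof -
  have bc: "bc (pk \<delta> v h r g y c)" for c
    using spec_bc[OF spec_pk[of h g]] assms by simp
  have int: "integrable lborel (\<lambda>p. norm (pk \<delta> v h r g y c p) * wt \<tau> p)" for c
    using integrable_norm_power_wt[OF assms(1) bc, where k=1] by simp
  have one: "wint \<tau> (\<lambda>p. norm (pk \<delta> v h r g y c p)) \<le> 2197 / (h * g * \<tau>)" for c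
  proof -
    have "ennreal (wint \<tau> (\<lambda>p. norm (pk \<delta> v h r g y c p))) \<le> ennreal (2197 / (h * g * \<tau>))"
      unfolding wint_def using nn_integral_pk_le[of \<tau> h g] assms
      by (subst nn_integral_eq_integral[symmetric]) (auto intro!: int)
    then show ?thesis using assms by (subst (asm) ennreal_le_iff) auto
  qed
  have "wint \<tau> (\<lambda>p. norm (layer \<delta> v h r g y S p)) \<le> (\<integral>p. (\<Sum>c\<in>S. \<delta> ^ 3 * h * g * (norm (pk \<delta> v h r g y c p) * wt \<tau> p)) \<partial>lborel)"
    unfolding wint_def
  proof (rule integral_mono)
    show "integrable lborel (\<lambda>p. norm (layer \<delta> v h r g y S p) * wt \<tau> p)"
      using integrable_norm_power_wt[OF assms(1) spec_bc[OF spec_layer[of h g]], where k=1] assms by simp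
    show "integrable lborel (\<lambda>p. \<Sum>c\<in>S. \<delta> ^ 3 * h * g * (norm (pk \<delta> v h r g y c p) * wt \<tau> p))"
      by (intro Bochner_Integration.integrable_sum integrable_mult_right int)
    fix p
    have "norm (layer \<delta> v h r g y S p) \<le> \<delta> ^ 3 * h * g * (\<Sum>c\<in>S. norm (pk \<delta> v h r g y c p))"
      unfolding layer_def norm_mult norm_of_real using assms by (simp add: mult_left_mono norm_sum)
    from mult_right_mono[OF this wt_nonneg]
    show "norm (layer \<delta> v h r g y S p) * wt \<tau> p \<le> (\<Sum>c\<in>S. \<delta> ^ 3 * h * g * (norm (pk \<delta> v h r g y c p) * wt \<tau> p))"
      by (simp add: sum_distrib_left sum_distrib_right mult.assoc)
  qed
  also have "\<dots> = (\<Sum>c\<in>S. \<delta> ^ 3 * h * g * wint \<tau> (\<lambda>p. norm (pk \<delta> v h r g y c p)))"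
    unfolding wint_def by (subst Bochner_Integration.integral_sum) (auto intro!: int)
  also have "\<dots> \<le> (\<Sum>c\<in>S. \<delta> ^ 3 * h * g * (2197 / (h * g * \<tau>)))"
    using assms by (intro sum_mono mult_left_mono one) auto
  also have "\<dots> = 2197 / \<tau> * \<delta> ^ 3 * real (card S)"
    using assms by (simp add: field_simps)
  finally show ?thesis .
qed

section \<open>Decoupling for the cone\<close>

lemma card_int_interval_le:
  fixes A :: "int set"
  assumes "\<And>i. i \<in> A \<Longrightarrow> a \<le> of_int i \<and> of_int i \<le> b" "a \<le> b"
  shows "finite A" "real (card A) \<le> b - a + 1"
proof -
  have sub: "A \<subseteq> {\<lceil>a\<rceil>..\<lfloor>b\<rfloor>}"
    using assms(1) by (auto simp: ceiling_le_iff le_floor_iff)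
  show "finite A" by (rule finite_subset[OF sub]) simp
  have "card A \<le> card {\<lceil>a\<rceil>..\<lfloor>b\<rfloor>}" by (rule card_mono[OF _ sub]) simp
  also have "\<dots> = nat (\<lfloor>b\<rfloor> - \<lceil>a\<rceil> + 1)" by simp
  finally have "real (card A) \<le> real (nat (\<lfloor>b\<rfloor> - \<lceil>a\<rceil> + 1))" by simp
  also have "\<dots> \<le> b - a + 1"
    using assms(2) by linarith
  finally show "real (card A) \<le> b - a + 1" .
qed

text \<open>The power sums \<open>z\<^sub>1 + z\<^sub>2\<close> and \<open>z\<^sub>1\<^sup>2 + z\<^sub>2\<^sup>2\<close> determine the unordered pair;
  this is the only place where the curvature of the cone enters.\<close>
lemma unordered_pair_determined:
  fixes v \<sigma> \<kappa> \<rho> Q :: real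
  assumes z: "z1 \<in> {0..\<sigma>}" "z2 \<in> {0..\<sigma>}" "z3 \<in> {0..\<sigma>}" "z4 \<in> {0..\<sigma>}" and \<sigma>: "0 < \<sigma>" "\<sigma> \<le> 1" and \<kappa>: "1 \<le> \<kappa>"
    and v: "0 < \<bar>v\<bar>"
    and s: "\<bar>s1 - v\<bar> \<le> \<bar>v\<bar> / \<kappa>\<^sup>2" "\<bar>s2 - v\<bar> \<le> \<bar>v\<bar> / \<kappa>\<^sup>2" "\<bar>s3 - v\<bar> \<le> \<bar>v\<bar> / \<kappa>\<^sup>2" "\<bar>s4 - v\<bar> \<le> \<bar>v\<bar> / \<kappa>\<^sup>2"
    and t: "\<bar>t1\<bar> \<le> \<rho>" "\<bar>t2\<bar> \<le> \<rho>" "\<bar>t3\<bar> \<le> \<rho>" "\<bar>t4\<bar> \<le> \<rho>"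
    and \<rho>: "\<rho> \<le> \<sigma> * \<bar>v\<bar> / \<kappa>\<^sup>2" and Q: "Q \<le> \<sigma>\<^sup>2 * \<bar>v\<bar> / \<kappa>\<^sup>2"
    and psi: "\<bar>(2 * s1 * z1 + t1) + (2 * s2 * z2 + t2) - (2 * s3 * z3 + t3) - (2 * s4 * z4 + t4)\<bar> \<le> Q"
    and phi: "\<bar>(s1 * z1\<^sup>2 + t1 * z1) + (s2 * z2\<^sup>2 + t2 * z2) - (s3 * z3\<^sup>2 + t3 * z3) - (s4 * z4\<^sup>2 + t4 * z4)\<bar> \<le> Q"
  shows "(\<bar>z1 - z3\<bar> \<le> 7 * \<sigma> / \<kappa> \<and> \<bar>z2 - z4\<bar> \<le> 7 * \<sigma> / \<kappa>) \<or> (\<bar>z1 - z4\<bar> \<le> 7 * \<sigma> / \<kappa> \<and> \<bar>z2 - z3\<bar> \<le> 7 * \<sigma> / \<kappa>)"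
proof -
  define \<nu> where "\<nu> = 1 / \<kappa>\<^sup>2"
  define V where "V = \<bar>v\<bar>"
  have \<nu>: "0 < \<nu>" using \<kappa> by (simp add: \<nu>_def)
  have V: "0 < V" using v by (simp add: V_def)
  have s': "\<bar>s1 - v\<bar> \<le> \<nu> * V" "\<bar>s2 - v\<bar> \<le> \<nu> * V" "\<bar>s3 - v\<bar> \<le> \<nu> * V" "\<bar>s4 - v\<bar> \<le> \<nu> * V"
    using s by (auto simp: \<nu>_def V_def)
  have \<rho>': "\<rho> \<le> \<nu> * \<sigma> * V" and Q': "Q \<le> \<nu> * \<sigma>\<^sup>2 * V"
    using \<rho> Q by (simp_all add: \<nu>_def V_def)
  have m: "\<bar>x * y\<bar> \<le> B * C" if "\<bar>x\<bar> \<le> B" "\<bar>y\<bar> \<le> C" for x y B C :: real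
    unfolding abs_mult using that by (intro mult_mono) auto
  have za: "\<bar>z1\<bar> \<le> \<sigma>" "\<bar>z2\<bar> \<le> \<sigma>" "\<bar>z3\<bar> \<le> \<sigma>" "\<bar>z4\<bar> \<le> \<sigma>" using z by auto
  have z2a: "\<bar>z1\<^sup>2\<bar> \<le> \<sigma>\<^sup>2" "\<bar>z2\<^sup>2\<bar> \<le> \<sigma>\<^sup>2" "\<bar>z3\<^sup>2\<bar> \<le> \<sigma>\<^sup>2" "\<bar>z4\<^sup>2\<bar> \<le> \<sigma>\<^sup>2"
    using m[OF za(1) za(1)] m[OF za(2) za(2)] m[OF za(3) za(3)] m[OF za(4) za(4)] by (auto simp: power2_eq_square)
  have \<sigma>2: "\<nu> * \<sigma>\<^sup>2 * V \<le> \<nu> * \<sigma> * V"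
    using \<sigma> \<nu> V by (simp add: power2_eq_square mult_left_le)
  define A where "A = z1 + z2 - z3 - z4"
  define D where "D = z1\<^sup>2 + z2\<^sup>2 - z3\<^sup>2 - z4\<^sup>2"
  have lin: "\<bar>P - (x1 + x2 - x3 - x4) - c * y1 - c * y2 + c * y3 + c * y4\<bar> \<le> Q + 4 * B + 4 * (c * C)"
    if "\<bar>P\<bar> \<le> Q" "\<bar>x1\<bar> \<le> B" "\<bar>x2\<bar> \<le> B" "\<bar>x3\<bar> \<le> B" "\<bar>x4\<bar> \<le> B"
      "\<bar>y1\<bar> \<le> C" "\<bar>y2\<bar> \<le> C" "\<bar>y3\<bar> \<le> C" "\<bar>y4\<bar> \<le> C" "0 \<le> c" for P x1 x2 x3 x4 y1 y2 y3 y4 B C c :: real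
  proof -
    have "\<bar>c * y\<bar> \<le> c * C" if "\<bar>y\<bar> \<le> C" for y
      using that \<open>0 \<le> c\<close> by (simp add: abs_mult mult_left_mono)
    from this[OF that(6)] this[OF that(7)] this[OF that(8)] this[OF that(9)] that(1-5) show ?thesis
      unfolding abs_le_iff by linarith
  qed
  have "2 * (v * A) = ((2 * s1 * z1 + t1) + (2 * s2 * z2 + t2) - (2 * s3 * z3 + t3) - (2 * s4 * z4 + t4))
     - (t1 + t2 - t3 - t4) - 2 * ((s1 - v) * z1) - 2 * ((s2 - v) * z2) + 2 * ((s3 - v) * z3) + 2 * ((s4 - v) * z4)"
    by (simp add: A_def algebra_simps)
  then have "\<bar>2 * (v * A)\<bar> \<le> Q + 4 * \<rho> + 4 * (2 * (\<nu> * V * \<sigma>))"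
    using lin[OF psi t m[OF s'(1) za(1)] m[OF s'(2) za(2)] m[OF s'(3) za(3)] m[OF s'(4) za(4)], of 2] by simp
  also have "\<dots> \<le> 14 * (\<nu> * \<sigma> * V)"
  proof -
    have "\<nu> * V * \<sigma> = \<nu> * \<sigma> * V" by simp
    then show ?thesis
      using \<rho>' Q' \<sigma>2 mult_pos_pos[OF mult_pos_pos[OF \<nu> \<sigma>(1)] V] by linarith
  qed
  finally have "V * \<bar>A\<bar> \<le> V * (7 * (\<nu> * \<sigma>))"
    by (simp add: abs_mult V_def mult_ac)
  then have A: "\<bar>A\<bar> \<le> 7 * (\<nu> * \<sigma>)" using V by simp
  have "v * D = ((s1 * z1\<^sup>2 + t1 * z1) + (s2 * z2\<^sup>2 + t2 * z2) - (s3 * z3\<^sup>2 + t3 * z3) - (s4 * z4\<^sup>2 + t4 * z4))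
     - (t1 * z1 + t2 * z2 - t3 * z3 - t4 * z4) - ((s1 - v) * z1\<^sup>2) - ((s2 - v) * z2\<^sup>2) + ((s3 - v) * z3\<^sup>2) + ((s4 - v) * z4\<^sup>2)"
    by (simp add: D_def algebra_simps)
  then have "\<bar>v * D\<bar> \<le> Q + 4 * (\<rho> * \<sigma>) + 4 * (\<nu> * V * \<sigma>\<^sup>2)"
    using lin[OF phi m[OF t(1) za(1)] m[OF t(2) za(2)] m[OF t(3) za(3)] m[OF t(4) za(4)]
      m[OF s'(1) z2a(1)] m[OF s'(2) z2a(2)] m[OF s'(3) z2a(3)] m[OF s'(4) z2a(4)], of 1] by simp
  also have "\<dots> \<le> 9 * (\<nu> * \<sigma>\<^sup>2 * V)"
  proof -
    have "\<nu> * \<sigma> * V * \<sigma> = \<nu> * \<sigma>\<^sup>2 * V" "\<nu> * V * \<sigma>\<^sup>2 = \<nu> * \<sigma>\<^sup>2 * V" by (simp_all add: power2_eq_square)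
    then show ?thesis
      using mult_right_mono[OF \<rho>', of \<sigma>] Q' \<sigma> by linarith
  qed
  finally have "V * \<bar>D\<bar> \<le> V * (9 * (\<nu> * \<sigma>\<^sup>2))"
    by (simp add: abs_mult V_def mult_ac)
  then have D: "\<bar>D\<bar> \<le> 9 * (\<nu> * \<sigma>\<^sup>2)" using V by simp
  \<comment> \<open>Twice a sum of squares minus the square of the sum is the square of the
    difference, so \<open>A\<close> and \<open>D\<close> together also control the gap within each
    pair.\<close>
  have "(z1 - z2)\<^sup>2 - (z3 - z4)\<^sup>2 = 2 * D - A * (z1 + z2 + z3 + z4)"
    by (simp add: D_def A_def power2_eq_square algebra_simps)
  moreover have "\<bar>A * (z1 + z2 + z3 + z4)\<bar> \<le> 7 * (\<nu> * \<sigma>) * (4 * \<sigma>)"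
    using A za by (intro m) auto
  \<comment> \<open>The constants give 2 times 9 plus 28, which is 46; 49 is used since its root is
    taken next. That root is also why the hypotheses assume errors of relative size 1 /
    \<open>\<kappa>\<^sup>2\<close> while the conclusion only has 1 / \<kappa>.\<close>
  ultimately have P: "\<bar>(z1 - z2)\<^sup>2 - (z3 - z4)\<^sup>2\<bar> \<le> 49 * (\<nu> * \<sigma>\<^sup>2)"
    using D \<nu> \<sigma> mult_pos_pos[OF \<nu> zero_less_power[OF \<sigma>(1), of 2]] by (simp add: power2_eq_square)
  define u w where "u = \<bar>z1 - z2\<bar>" and "w = \<bar>z3 - z4\<bar>"
  have uw: "0 \<le> u" "0 \<le> w" by (auto simp: u_def w_def)
  have "(u - w)\<^sup>2 \<le> \<bar>u\<^sup>2 - w\<^sup>2\<bar>"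
  proof -
    have "(u - w)\<^sup>2 = \<bar>u - w\<bar> * \<bar>u - w\<bar>" by (simp add: power2_eq_square)
    also have "\<dots> \<le> \<bar>u - w\<bar> * \<bar>u + w\<bar>" using uw by (intro mult_left_mono) auto
    also have "\<dots> = \<bar>u\<^sup>2 - w\<^sup>2\<bar>" by (simp add: abs_mult[symmetric] power2_eq_square algebra_simps)
    finally show ?thesis .
  qed
  also have "\<dots> \<le> (7 * \<sigma> / \<kappa>)\<^sup>2"
    using P by (simp add: u_def w_def \<nu>_def power_divide power_mult_distrib)
  finally have uwd: "\<bar>u - w\<bar> \<le> 7 * \<sigma> / \<kappa>"
    using \<sigma> \<kappa> power2_le_imp_le[of "\<bar>u - w\<bar>" "7 * \<sigma> / \<kappa>"] by simp
  have "\<kappa> \<le> \<kappa>\<^sup>2" using \<kappa> self_le_power[of \<kappa> 2] by simp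
  then have "\<nu> \<le> 1 / \<kappa>" using \<kappa> by (simp add: \<nu>_def frac_le)
  then have A': "\<bar>A\<bar> \<le> 7 * \<sigma> / \<kappa>"
    using A mult_right_mono[of \<nu> "1 / \<kappa>" "7 * \<sigma>"] \<sigma> by (simp add: mult_ac)
  have "(\<bar>z1 - z3\<bar> \<le> T \<and> \<bar>z2 - z4\<bar> \<le> T) \<or> (\<bar>z1 - z4\<bar> \<le> T \<and> \<bar>z2 - z3\<bar> \<le> T)"
    if "\<bar>\<bar>z1 - z2\<bar> - \<bar>z3 - z4\<bar>\<bar> \<le> T" "\<bar>z1 + z2 - z3 - z4\<bar> \<le> T" for T
    using that by arith
  from this[OF uwd[unfolded u_def w_def] A'[unfolded A_def]] show ?thesis .
qed

text \<open>One piece of the function F in a fixed pair of frequency windows, cut into slices y = j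
  \<delta>. Of a slice only three facts are kept: its spectrum, a sup bound proportional to
  \<delta>, and a weighted integral bounded by the mass \<open>e j\<close>. The parameter
  \<open>k\<close> is the ratio of consecutive angular scales, and \<open>\<tau> \<le> 1/2\<close>
  makes \<open>near\<close> mean coordinates below 1.\<close>

locale packets =
  fixes \<delta> \<tau> Y :: real and k :: nat and v h r g :: real and J :: "int set"
    and F :: "int \<Rightarrow> pt \<Rightarrow> complex" and e :: "int \<Rightarrow> real" and C1 C2 :: real
  assumes \<delta>: "0 < \<delta>" "\<delta> \<le> 1/8" and \<tau>: "0 < \<tau>" "\<tau> \<le> 1/2" and Y: "1 \<le> Y" and k: "8 \<le> k"
    and J: "finite J" "\<And>j. j \<in> J \<Longrightarrow> \<bar>of_int j * \<delta>\<bar> \<le> Y - 1"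
    and specF: "\<And>j. j \<in> J \<Longrightarrow> spec (band v h r g (of_int j * \<delta>)) (F j)"
    and normF: "\<And>j p. j \<in> J \<Longrightarrow> norm (F j p) \<le> C1 * \<delta>"
    and wintF: "\<And>j. j \<in> J \<Longrightarrow> wint \<tau> (\<lambda>p. norm (F j p)) \<le> C2 * e j"
    and e: "\<And>j. 0 \<le> e j" and C1: "1 \<le> C1" and C2: "0 \<le> C2"
begin

definition FS :: "int set \<Rightarrow> pt \<Rightarrow> complex" where
  "FS A p = (\<Sum>j\<in>A. F j p)"

text \<open>Number of the k-adic interval of length k^(-l) that contains y = j \<delta>. Rounding
  down keeps the levels nested for negative y too, the parent of b being
  \<open>b div int k\<close>.\<close>

definition lev :: "nat \<Rightarrow> int \<Rightarrow> int" where
  "lev l j = \<lfloor>of_int j * \<delta> * real k ^ l\<rfloor>"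

definition arc :: "nat \<Rightarrow> int \<Rightarrow> int set" where
  "arc l a = {j\<in>J. lev l j = a}"

definition idx :: "nat \<Rightarrow> int set" where
  "idx l = lev l ` J"

lemma k0: "0 < k" "0 < real k" using k by auto

lemma arc_subset: "arc l a \<subseteq> J" by (auto simp: arc_def)
lemma finite_arc: "finite (arc l a)" using finite_subset[OF arc_subset J(1)] .
lemma finite_idx: "finite (idx l)" using J(1) by (simp add: idx_def)

lemma arc_bounds:
  assumes "j \<in> arc l a"
  shows "of_int a / real k ^ l \<le> of_int j * \<delta>" "of_int j * \<delta> \<le> of_int a / real k ^ l + 1 / real k ^ l"
proof -
  have "of_int a \<le> of_int j * \<delta> * real k ^ l" "of_int j * \<delta> * real k ^ l < of_int a + 1"
    using assms by (auto simp: arc_def lev_def)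
  then show "of_int a / real k ^ l \<le> of_int j * \<delta>" "of_int j * \<delta> \<le> of_int a / real k ^ l + 1 / real k ^ l"
    using k0 by (auto simp: field_simps)
qed

lemma bcF: "j \<in> J \<Longrightarrow> bc (F j)"
  using spec_bc[OF specF] .

lemma bcFS: "A \<subseteq> J \<Longrightarrow> bc (FS A)"
  unfolding FS_def[abs_def] by (intro bc_sum bcF) auto

lemma lev_Suc: "lev (Suc l) j div int k = lev l j"
proof -
  have "\<lfloor>(of_int j * \<delta> * real k ^ Suc l) / real_of_int (int k)\<rfloor> = \<lfloor>of_int j * \<delta> * real k ^ Suc l\<rfloor> div int k"
    by (rule floor_divide_real_eq_div) simp
  moreover have "of_int j * \<delta> * real k ^ Suc l / real_of_int (int k) = of_int j * \<delta> * real k ^ l"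
    using k0 by simp
  ultimately show ?thesis by (simp only: lev_def)
qed

lemma idx_eq_div: "(\<lambda>b. b div int k) ` idx (Suc l) = idx l"
  by (simp add: idx_def image_image lev_Suc)

lemma FS_arc_Suc: "FS (arc l a) p = (\<Sum>b\<in>{b\<in>idx (Suc l). b div int k = a}. FS (arc (Suc l) b) p)"
proof -
  let ?B = "{b\<in>idx (Suc l). b div int k = a}"
  have fin: "finite ?B" using finite_idx by simp
  have sub: "lev (Suc l) ` arc l a \<subseteq> ?B"
    by (auto simp: arc_def idx_def lev_Suc)
  have "FS (arc l a) p = (\<Sum>b\<in>?B. \<Sum>j\<in>{j. j \<in> arc l a \<and> lev (Suc l) j = b}. F j p)"
    unfolding FS_def by (rule sum.group[OF finite_arc fin sub, symmetric])
  also have "\<dots> = (\<Sum>b\<in>?B. FS (arc (Suc l) b) p)"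
  proof (intro sum.cong refl)
    fix b assume "b \<in> ?B"
    then have "{j. j \<in> arc l a \<and> lev (Suc l) j = b} = arc (Suc l) b"
      by (auto simp: arc_def lev_Suc)
    then show "(\<Sum>j\<in>{j. j \<in> arc l a \<and> lev (Suc l) j = b}. F j p) = FS (arc (Suc l) b) p"
      by (simp add: FS_def)
  qed
  finally show ?thesis .
qed

lemma FS_J: "FS J p = (\<Sum>a\<in>idx l. FS (arc l a) p)"
proof -
  have "FS J p = (\<Sum>a\<in>idx l. \<Sum>j\<in>{j. j \<in> J \<and> lev l j = a}. F j p)"
    unfolding FS_def by (rule sum.group[OF J(1) finite_idx, symmetric]) (simp add: idx_def)
  then show ?thesis by (simp add: FS_def arc_def)
qed

lemma card_children: "card {b\<in>idx (Suc l). b div int k = a} \<le> k"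
proof -
  have "{b\<in>idx (Suc l). b div int k = a} \<subseteq> {a * int k..<a * int k + int k}"
  proof
    fix b assume "b \<in> {b\<in>idx (Suc l). b div int k = a}"
    then have "b = a * int k + b mod int k" using div_mult_mod_eq[of b "int k"] by auto
    moreover have "0 \<le> b mod int k" "b mod int k < int k" using k0 by auto
    ultimately show "b \<in> {a * int k..<a * int k + int k}" by (metis atLeastLessThan_iff add_less_cancel_left le_add_same_cancel1)
  qed
  from card_mono[OF _ this] show ?thesis by simp
qed

lemma sum_children: "(\<Sum>a\<in>idx l. \<Sum>b\<in>{b\<in>idx (Suc l). b div int k = a}. f b) = (\<Sum>b\<in>idx (Suc l). f b)"
  for f :: "int \<Rightarrow> real"
  using sum.group[OF finite_idx finite_idx, of "\<lambda>b. b div int k" "Suc l" l f] by (simp add: idx_eq_div)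

section \<open>Sums of second and fourth powers over the arcs of one level\<close>

definition D2 :: "nat \<Rightarrow> real" where
  "D2 l = (\<Sum>a\<in>idx l. wint \<tau> (\<lambda>p. norm (FS (arc l a) p) ^ 2))"

definition D4 :: "nat \<Rightarrow> real" where
  "D4 l = (\<Sum>a\<in>idx l. wint \<tau> (\<lambda>p. norm (FS (arc l a) p) ^ 4))"

definition mass :: real where "mass = (\<Sum>j\<in>J. e j)"

lemma mass_nonneg: "0 \<le> mass" unfolding mass_def by (intro sum_nonneg e)

lemma D2_Suc: "D2 l \<le> real k * D2 (Suc l)"
proof -
  have "D2 l \<le> (\<Sum>a\<in>idx l. real k * (\<Sum>b\<in>{b\<in>idx (Suc l). b div int k = a}. wint \<tau> (\<lambda>p. norm (FS (arc (Suc l) b) p) ^ 2)))"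
    unfolding D2_def
  proof (rule sum_mono, rule wint_le_sum[OF \<tau>(1)])
    fix a p
    have "(norm (FS (arc l a) p))\<^sup>2 \<le> real (card {b\<in>idx (Suc l). b div int k = a}) * (\<Sum>b\<in>{b\<in>idx (Suc l). b div int k = a}. (norm (FS (arc (Suc l) b) p))\<^sup>2)"
      unfolding FS_arc_Suc[of l a p] by (rule norm_sum_square_le)
    also have "\<dots> \<le> real k * (\<Sum>b\<in>{b\<in>idx (Suc l). b div int k = a}. (norm (FS (arc (Suc l) b) p))\<^sup>2)"
      using card_children by (intro mult_right_mono sum_nonneg) auto
    finally show "(norm (FS (arc l a) p))\<^sup>2 \<le> real k * (\<Sum>b\<in>{b\<in>idx (Suc l). b div int k = a}. (norm (FS (arc (Suc l) b) p))\<^sup>2)" .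
  qed (auto intro!: bcFS arc_subset simp: finite_idx)
  also have "\<dots> = real k * D2 (Suc l)"
    unfolding D2_def sum_distrib_left[symmetric] by (simp only: sum_children)
  finally show ?thesis .
qed

lemma D2_add: "D2 l \<le> real k ^ i * D2 (l + i)"
proof (induction i)
  case (Suc i)
  have "real k ^ i * D2 (l + i) \<le> real k ^ i * (real k * D2 (Suc (l + i)))"
    by (intro mult_left_mono D2_Suc) simp
  with Suc show ?case by (simp add: mult_ac)
qed simp

lemma card_idx_0: "real (card (idx 0)) \<le> 3 * Y"
proof -
  have "-Y \<le> of_int a \<and> of_int a \<le> Y" if a: "a \<in> idx 0" for a
  proof -
    obtain j where "j \<in> J" "a = \<lfloor>of_int j * \<delta>\<rfloor>" using a by (auto simp: idx_def lev_def)
    moreover have "\<bar>of_int j * \<delta>\<bar> \<le> Y - 1" using J(2) \<open>j \<in> J\<close> .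
    ultimately show ?thesis by linarith
  qed
  from card_int_interval_le(2)[of "idx 0", OF this] show ?thesis using Y by simp
qed

lemma total_le_D4: "wint \<tau> (\<lambda>p. norm (FS J p) ^ 4) \<le> (3 * Y) ^ 3 * D4 0"
  unfolding D4_def
proof (rule wint_le_sum[OF \<tau>(1)])
  fix p
  have "norm (FS J p) ^ 4 \<le> real (card (idx 0)) ^ 3 * (\<Sum>a\<in>idx 0. norm (FS (arc 0 a) p) ^ 4)"
    unfolding FS_J[of p 0] by (rule norm_sum_power4_le)
  also have "\<dots> \<le> (3 * Y) ^ 3 * (\<Sum>a\<in>idx 0. norm (FS (arc 0 a) p) ^ 4)"
    by (intro mult_right_mono power_mono card_idx_0 sum_nonneg) auto
  finally show "norm (FS J p) ^ 4 \<le> (3 * Y) ^ 3 * (\<Sum>a\<in>idx 0. norm (FS (arc 0 a) p) ^ 4)" .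
qed (auto intro!: bcFS arc_subset simp: finite_idx)

lemma card_arc: "real (card (arc l a)) \<le> 1 / (real k ^ l * \<delta>) + 1"
proof -
  have "of_int a / real k ^ l / \<delta> \<le> of_int j \<and> of_int j \<le> (of_int a / real k ^ l + 1 / real k ^ l) / \<delta>" if "j \<in> arc l a" for j
    using arc_bounds[OF that] \<delta> by (intro conjI) (simp_all only: pos_divide_le_eq pos_le_divide_eq)
  note * = card_int_interval_le(2)[of "arc l a", OF this]
  have "real (card (arc l a)) \<le> (of_int a / real k ^ l + 1 / real k ^ l) / \<delta> - of_int a / real k ^ l / \<delta> + 1"
    by (rule *, assumption) (use \<delta> in \<open>intro divide_right_mono, simp_all\<close>)
  also have "\<dots> = 1 / (real k ^ l * \<delta>) + 1"
    by (simp add: add_divide_distrib)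
  finally show ?thesis .
qed

lemma norm_FS_arc:
  assumes "\<delta> \<le> 1 / real k ^ l"
  shows "norm (FS (arc l a) p) \<le> 2 * C1 / real k ^ l"
proof -
  have "norm (FS (arc l a) p) \<le> (\<Sum>j\<in>arc l a. C1 * \<delta>)"
    unfolding FS_def using arc_subset by (intro order_trans[OF norm_sum] sum_mono normF) auto
  also have "\<dots> = C1 * (\<delta> * real (card (arc l a)))" by simp
  also have "\<dots> \<le> C1 * (\<delta> * (1 / (real k ^ l * \<delta>) + 1))"
    using C1 \<delta> by (intro mult_left_mono card_arc) auto
  also have "\<delta> * (1 / (real k ^ l * \<delta>) + 1) = 1 / real k ^ l + \<delta>"
    using \<delta> by (simp add: field_simps)
  also have "C1 * (1 / real k ^ l + \<delta>) \<le> C1 * (2 / real k ^ l)"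
    using C1 assms by (intro mult_left_mono) auto
  finally show ?thesis by (simp add: mult.commute)
qed

text \<open>Once decoupling has stopped, two of the four powers are spent on the sup norm, which is
  proportional to the length of the arc; orthogonality handles the other two.\<close>

lemma D4_le_D2:
  assumes "\<delta> \<le> 1 / real k ^ l"
  shows "D4 l \<le> (2 * C1 / real k ^ l)\<^sup>2 * D2 l"
  unfolding D4_def D2_def sum_distrib_left
proof (intro sum_mono wint_mono \<tau> bcFS arc_subset)
  fix a p
  have "norm (FS (arc l a) p) ^ 4 = (norm (FS (arc l a) p))\<^sup>2 * (norm (FS (arc l a) p))\<^sup>2"
    by (simp add: power_add[symmetric])
  also have "\<dots> \<le> (2 * C1 / real k ^ l)\<^sup>2 * (norm (FS (arc l a) p))\<^sup>2"
    by (intro mult_right_mono power_mono norm_FS_arc assms) auto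
  finally show "norm (FS (arc l a) p) ^ 4 \<le> (2 * C1 / real k ^ l)\<^sup>2 * (norm (FS (arc l a) p))\<^sup>2" .
qed

lemma wint_F_square: "j \<in> J \<Longrightarrow> wint \<tau> (\<lambda>p. (norm (F j p))\<^sup>2) \<le> C1 * C2 * \<delta> * e j"
proof -
  assume j: "j \<in> J"
  have "wint \<tau> (\<lambda>p. norm (F j p) ^ 2) \<le> C1 * \<delta> * wint \<tau> (\<lambda>p. norm (F j p) ^ 1)"
    using normF[OF j] by (intro wint_mono \<tau> bcF j) (auto simp: power2_eq_square intro!: mult_right_mono)
  also have "\<dots> \<le> C1 * \<delta> * (C2 * e j)"
    using wintF[OF j] C1 \<delta> by (intro mult_left_mono) auto
  finally show ?thesis by (simp add: mult_ac)
qed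

lemma D2_le_overlap:
  assumes "\<And>a j. j \<in> arc l a \<Longrightarrow> real (card {i\<in>arc l a. ip \<tau> (F j) (F i) \<noteq> 0}) \<le> N" "0 \<le> N"
  shows "D2 l \<le> N * (C1 * C2 * \<delta> * mass)"
proof -
  have "D2 l \<le> (\<Sum>a\<in>idx l. N * (\<Sum>j\<in>arc l a. C1 * C2 * \<delta> * e j))"
    unfolding D2_def
  proof (rule sum_mono)
    fix a
    have "wint \<tau> (\<lambda>p. (norm (FS (arc l a) p))\<^sup>2) \<le> N * (\<Sum>j\<in>arc l a. wint \<tau> (\<lambda>p. (norm (F j p))\<^sup>2))"
      unfolding FS_def using arc_subset by (intro almost_orthogonality \<tau> finite_arc assms(1) bcF) auto
    also have "\<dots> \<le> N * (\<Sum>j\<in>arc l a. C1 * C2 * \<delta> * e j)"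
      using assms(2) arc_subset by (intro mult_left_mono sum_mono wint_F_square) auto
    finally show "wint \<tau> (\<lambda>p. (norm (FS (arc l a) p))\<^sup>2) \<le> N * (\<Sum>j\<in>arc l a. C1 * C2 * \<delta> * e j)" .
  qed
  also have "\<dots> = N * (C1 * C2 * \<delta> * (\<Sum>a\<in>idx l. \<Sum>j\<in>arc l a. e j))"
    by (simp add: sum_distrib_left)
  also have "(\<Sum>a\<in>idx l. \<Sum>j\<in>arc l a. e j) = mass"
    unfolding mass_def arc_def by (rule sum.group[OF J(1) finite_idx]) (simp add: idx_def)
  finally show ?thesis .
qed

lemma D2_trivial: "D2 l \<le> (1 / (real k ^ l * \<delta>) + 1) * (C1 * C2 * \<delta> * mass)"
proof (rule D2_le_overlap)
  fix a j
  have "card {i\<in>arc l a. ip \<tau> (F j) (F i) \<noteq> 0} \<le> card (arc l a)"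
    by (intro card_mono finite_arc) auto
  then show "real (card {i\<in>arc l a. ip \<tau> (F j) (F i) \<noteq> 0}) \<le> 1 / (real k ^ l * \<delta>) + 1"
    using card_arc[of l a] by linarith
qed (use \<delta> in simp)

lemma nearD:
  assumes "near \<tau> (z1, z2, z3)"
  shows "\<bar>z1\<bar> < 1" "\<bar>z2\<bar> < 1" "\<bar>z3\<bar> < 1"
  using assms \<tau> by (auto simp: near_def)

lemma Y_powers: "1 \<le> Y\<^sup>2" "Y \<le> Y\<^sup>2"
  using Y self_le_power[of Y 2] by auto

text \<open>A frequency of the layer \<open>y\<close> reappears in the layer \<open>y + d\<close> only for \<open>d \<approx> 0\<close> and for
  \<open>d \<approx> - t / s\<close>; short arcs exclude the second possibility.\<close>
lemma overlap_two:
  assumes "ip \<tau> (F j) (F i) \<noteq> 0" "j \<in> J" "i \<in> J"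
  obtains s t where "\<bar>s - v\<bar> \<le> 2 * h" "\<bar>t - r\<bar> \<le> 2 * g"
    "\<bar>(of_int i - of_int j) * \<delta> * (s * ((of_int i - of_int j) * \<delta>) + t)\<bar> \<le> 5 * Y\<^sup>2"
proof -
  let ?y = "of_int j * \<delta>" and ?y' = "of_int i * \<delta>"
  obtain \<xi> \<eta> where "\<xi> \<in> band v h r g ?y" "\<eta> \<in> band v h r g ?y'" and near: "near \<tau> (\<xi> - \<eta>)"
    using ip_eq_0_if_far[OF \<tau>(1) specF[OF assms(2)] specF[OF assms(3)]] assms(1) by blast
  then obtain s t s' t' where st: "\<bar>s' - v\<bar> \<le> 2 * h" "\<bar>t' - r\<bar> \<le> 2 * g"
    and \<xi>: "\<xi> = s *\<^sub>R th1 ?y + t *\<^sub>R th2 ?y" and \<eta>: "\<eta> = s' *\<^sub>R th1 ?y' + t' *\<^sub>R th2 ?y'"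
    unfolding band_def by blast
  define y y' where "y = ?y" and "y' = ?y'"
  have y: "\<bar>y\<bar> \<le> Y" using J(2)[OF assms(2)] by (simp add: y_def)
  define z1 z2 z3 where "z1 = - s + s'" and "z2 = (s * y\<^sup>2 + t * y) - (s' * y'\<^sup>2 + t' * y')"
    and "z3 = (2 * s * y + t) - (2 * s' * y' + t')"
  have "\<xi> - \<eta> = (z1, z2, z3)"
    by (simp add: \<xi> \<eta> th1_def th2_def z1_def z2_def z3_def y_def y'_def)
  then have n: "\<bar>z1\<bar> < 1" "\<bar>z2\<bar> < 1" "\<bar>z3\<bar> < 1" using nearD near by metis+
  have eq: "(y' - y) * (s' * (y' - y) + t') = - (z2 - y * z3 - y\<^sup>2 * z1)"
    by (simp add: z1_def z2_def z3_def power2_eq_square algebra_simps)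
  have "\<bar>y * z3\<bar> \<le> Y * 1" "\<bar>y\<^sup>2 * z1\<bar> \<le> Y\<^sup>2 * 1"
    unfolding abs_mult using n y power_mono[OF y, of 2] by (intro mult_mono; simp)+
  then have "\<bar>(y' - y) * (s' * (y' - y) + t')\<bar> \<le> 5 * Y\<^sup>2"
    unfolding eq using n Y_powers by linarith
  then show ?thesis
    using that[OF st] by (simp add: y_def y'_def left_diff_distrib)
qed

text \<open>On arcs this short \<bar>s d\<bar> is at most half of \<bar>t\<bar>, which rules out the
  second root d = - t / s in \<open>overlap_two\<close>. What remains is \<bar>d\<bar> at most 20
  \<open>Y\<^sup>2\<close> / \<rho>, so a frequency occurs in about 1 / (\<rho> \<delta>)
  slices.\<close>

lemma D2_transversal:
  assumes \<rho>: "0 < \<rho>" "\<rho> \<le> 8 / \<delta>" and t: "\<And>t. \<bar>t - r\<bar> \<le> 2 * g \<Longrightarrow> \<rho> / 2 \<le> \<bar>t\<bar>"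
    and short: "(\<bar>v\<bar> + 2 * h) / real k ^ l \<le> \<rho> / 4"
  shows "D2 l \<le> 48 * Y\<^sup>2 / \<rho> * (C1 * C2 * mass)"
proof -
  have "D2 l \<le> (40 * Y\<^sup>2 / (\<rho> * \<delta>) + 1) * (C1 * C2 * \<delta> * mass)"
  proof (rule D2_le_overlap)
    fix a j assume j: "j \<in> arc l a"
    have "of_int j - 20 * Y\<^sup>2 / (\<rho> * \<delta>) \<le> of_int i \<and> of_int i \<le> of_int j + 20 * Y\<^sup>2 / (\<rho> * \<delta>)"
      if i: "i \<in> {i\<in>arc l a. ip \<tau> (F j) (F i) \<noteq> 0}" for i
    proof -
      define d where "d = (of_int i - of_int j) * \<delta>"
      obtain s t where st: "\<bar>s - v\<bar> \<le> 2 * h" "\<bar>t - r\<bar> \<le> 2 * g" and b: "\<bar>d * (s * d + t)\<bar> \<le> 5 * Y\<^sup>2"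
      proof -
        have "ip \<tau> (F j) (F i) \<noteq> 0" "j \<in> J" "i \<in> J" using i j arc_subset by auto
        from overlap_two[OF this, folded d_def] show ?thesis using that by blast
      qed
      have "\<bar>d\<bar> \<le> 1 / real k ^ l"
        using arc_bounds[OF j] arc_bounds[of i l a] i by (auto simp: d_def left_diff_distrib)
      then have "\<bar>s * d\<bar> \<le> (\<bar>v\<bar> + 2 * h) * (1 / real k ^ l)"
        unfolding abs_mult using st(1) by (intro mult_mono) auto
      then have "\<bar>s * d\<bar> \<le> \<rho> / 4" using short by (simp only: times_divide_eq_right mult_1_right)
      with t[OF st(2)] have "\<rho> / 4 \<le> \<bar>s * d + t\<bar>" by linarith
      then have "\<bar>d\<bar> * (\<rho> / 4) \<le> \<bar>d\<bar> * \<bar>s * d + t\<bar>" by (intro mult_left_mono) auto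
      with b have "\<bar>d\<bar> * (\<rho> / 4) \<le> 5 * Y\<^sup>2" by (simp add: abs_mult)
      then have "\<bar>of_int i - of_int j\<bar> * \<delta> \<le> 20 * Y\<^sup>2 / \<rho>"
      proof -
        have "\<bar>d\<bar> = \<bar>of_int i - of_int j\<bar> * \<delta>" using \<delta> by (simp add: d_def abs_mult)
        moreover have "\<bar>d\<bar> \<le> 20 * Y\<^sup>2 / \<rho>" using \<open>\<bar>d\<bar> * (\<rho> / 4) \<le> 5 * Y\<^sup>2\<close> \<rho> by (simp add: pos_le_divide_eq)
        ultimately show ?thesis by simp
      qed
      then have "\<bar>of_int i - of_int j\<bar> \<le> 20 * Y\<^sup>2 / \<rho> / \<delta>"
        using \<delta> by (simp only: pos_le_divide_eq)
      then show ?thesis by (simp add: abs_le_iff)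
    qed
    from card_int_interval_le(2)[of "{i\<in>arc l a. ip \<tau> (F j) (F i) \<noteq> 0}", OF this] show "real (card {i\<in>arc l a. ip \<tau> (F j) (F i) \<noteq> 0}) \<le> 40 * Y\<^sup>2 / (\<rho> * \<delta>) + 1"
      using \<rho> \<delta> by (simp add: mult.commute)
  qed (use \<rho> \<delta> in simp)
  \<comment> \<open>The extra 1 from counting integers in an interval is absorbed by means of \<rho>
    \<delta> at most 8.\<close>
  also have "\<dots> \<le> (48 * Y\<^sup>2 / (\<rho> * \<delta>)) * (C1 * C2 * \<delta> * mass)"
  proof (rule mult_right_mono)
    have "\<rho> * \<delta> \<le> 8 * Y\<^sup>2" using \<rho>(2) \<delta> Y_powers by (simp add: field_simps)
    then have "1 \<le> 8 * Y\<^sup>2 / (\<rho> * \<delta>)" using \<rho> \<delta> by (simp add: pos_le_divide_eq)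
    moreover have "40 * x + 1 \<le> 48 * x" if "1 \<le> 8 * x" for x :: real
      using that by linarith
    ultimately show "40 * Y\<^sup>2 / (\<rho> * \<delta>) + 1 \<le> 48 * Y\<^sup>2 / (\<rho> * \<delta>)"
      unfolding times_divide_eq_right[symmetric] by blast
  qed (use C1 C2 \<delta> mass_nonneg in auto)
  also have "\<dots> = 48 * Y\<^sup>2 / \<rho> * (C1 * C2 * mass)" using \<delta> by simp
  finally show ?thesis .
qed

section \<open>One step of decoupling\<close>

lemma specFS_arc: "spec (\<Union>j\<in>arc l a. band v h r g (of_int j * \<delta>)) (FS (arc l a))"
  unfolding FS_def[abs_def] using arc_subset by (intro spec_sum spec_mono[OF specF]) auto

lemma arc_Suc_subset: "b div int k = a \<Longrightarrow> arc (Suc l) b \<subseteq> arc l a"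
  by (auto simp: arc_def lev_Suc)

text \<open>If the two products have neighbouring frequencies, four points of thin neighbourhoods of
  the cone nearly satisfy x1 + x2 = x3 + x4. After translation to the left end of the parent arc the
  three coordinates of this relation become the hypotheses of
  \<open>unordered_pair_determined\<close>.\<close>

lemma overlap_four:
  assumes ip: "ip \<tau> (\<lambda>p. FS (arc (Suc l) b1) p * FS (arc (Suc l) b2) p) (\<lambda>p. FS (arc (Suc l) b3) p * FS (arc (Suc l) b4) p) \<noteq> 0"
    and b: "b1 div int k = a" "b2 div int k = a" "b3 div int k = a" "b4 div int k = a"
    and v: "0 < \<bar>v\<bar>" "2 * h \<le> \<bar>v\<bar> / (real k)\<^sup>2" and t: "\<And>t. \<bar>t - r\<bar> \<le> 2 * g \<Longrightarrow> \<bar>t\<bar> \<le> \<rho>"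
    and \<rho>: "\<rho> \<le> (1 / real k ^ l) * \<bar>v\<bar> / (real k)\<^sup>2" and Q: "5 * Y\<^sup>2 \<le> (1 / real k ^ l)\<^sup>2 * \<bar>v\<bar> / (real k)\<^sup>2"
  shows "(\<bar>b1 - b3\<bar> \<le> 8 \<and> \<bar>b2 - b4\<bar> \<le> 8) \<or> (\<bar>b1 - b4\<bar> \<le> 8 \<and> \<bar>b2 - b3\<bar> \<le> 8)"
proof -
  let ?S = "\<lambda>b. \<Union>j\<in>arc (Suc l) b. band v h r g (of_int j * \<delta>)"
  let ?T = "\<lambda>b b'. {x + y |x y. x \<in> ?S b \<and> y \<in> ?S b'}"
  have "\<exists>\<xi> \<eta>. \<xi> \<in> ?T b1 b2 \<and> \<eta> \<in> ?T b3 b4 \<and> near \<tau> (\<xi> - \<eta>)"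
  proof (rule ccontr)
    assume no: "\<not> (\<exists>\<xi> \<eta>. \<xi> \<in> ?T b1 b2 \<and> \<eta> \<in> ?T b3 b4 \<and> near \<tau> (\<xi> - \<eta>))"
    have sp: "spec (?T b c) (\<lambda>p. FS (arc (Suc l) b) p * FS (arc (Suc l) c) p)" for b c
      by (rule spec_mult[OF specFS_arc specFS_arc])
    have "ip \<tau> (\<lambda>p. FS (arc (Suc l) b1) p * FS (arc (Suc l) b2) p) (\<lambda>p. FS (arc (Suc l) b3) p * FS (arc (Suc l) b4) p) = 0"
      by (rule ip_eq_0_if_far[OF \<tau>(1) sp[of b1 b2] sp[of b3 b4]])
        (rule notI, rule notE[OF no], intro exI conjI)
    with ip show False by contradiction
  qed
  then obtain \<xi> \<eta> where \<xi>\<eta>: "\<xi> \<in> ?T b1 b2" "\<eta> \<in> ?T b3 b4" and near: "near \<tau> (\<xi> - \<eta>)"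
    by (elim exE conjE)
  from \<xi>\<eta> obtain x1 x2 x3 x4 where x: "x1 \<in> ?S b1" "x2 \<in> ?S b2" "x3 \<in> ?S b3" "x4 \<in> ?S b4" and eq: "\<xi> = x1 + x2" "\<eta> = x3 + x4"
    by blast
  have ex: "\<exists>j s t. j \<in> arc (Suc l) b \<and> \<bar>s - v\<bar> \<le> 2 * h \<and> \<bar>t - r\<bar> \<le> 2 * g \<and>
       x = s *\<^sub>R th1 (of_int j * \<delta>) + t *\<^sub>R th2 (of_int j * \<delta>)" if "x \<in> ?S b" for x b
    using that unfolding band_def by blast
  obtain j1 s1 t1 where 1: "j1 \<in> arc (Suc l) b1" "\<bar>s1 - v\<bar> \<le> 2 * h" "\<bar>t1 - r\<bar> \<le> 2 * g" "x1 = s1 *\<^sub>R th1 (of_int j1 * \<delta>) + t1 *\<^sub>R th2 (of_int j1 * \<delta>)"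
    using ex[OF x(1)] by blast
  obtain j2 s2 t2 where 2: "j2 \<in> arc (Suc l) b2" "\<bar>s2 - v\<bar> \<le> 2 * h" "\<bar>t2 - r\<bar> \<le> 2 * g" "x2 = s2 *\<^sub>R th1 (of_int j2 * \<delta>) + t2 *\<^sub>R th2 (of_int j2 * \<delta>)"
    using ex[OF x(2)] by blast
  obtain j3 s3 t3 where 3: "j3 \<in> arc (Suc l) b3" "\<bar>s3 - v\<bar> \<le> 2 * h" "\<bar>t3 - r\<bar> \<le> 2 * g" "x3 = s3 *\<^sub>R th1 (of_int j3 * \<delta>) + t3 *\<^sub>R th2 (of_int j3 * \<delta>)"
    using ex[OF x(3)] by blast
  obtain j4 s4 t4 where 4: "j4 \<in> arc (Suc l) b4" "\<bar>s4 - v\<bar> \<le> 2 * h" "\<bar>t4 - r\<bar> \<le> 2 * g" "x4 = s4 *\<^sub>R th1 (of_int j4 * \<delta>) + t4 *\<^sub>R th2 (of_int j4 * \<delta>)"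
    using ex[OF x(4)] by blast
  define y0 where "y0 = of_int a / real k ^ l"
  define \<sigma> where "\<sigma> = 1 / real k ^ l"
  define z where "z = (\<lambda>j::int. of_int j * \<delta> - y0)"
  have zin: "z j \<in> {0..\<sigma>}" if "j \<in> arc (Suc l) b" "b div int k = a" for j b
    using arc_bounds[of j l a] arc_Suc_subset[OF that(2), of l] that(1) by (auto simp: z_def y0_def \<sigma>_def)
  have \<sigma>: "0 < \<sigma>" "\<sigma> \<le> 1" using k0 k by (auto simp: \<sigma>_def)
  have y0: "\<bar>y0\<bar> \<le> Y"
  proof -
    have "j1 \<in> J" using 1(1) arc_subset by blast
    then have "\<bar>of_int j1 * \<delta>\<bar> \<le> Y - 1" by (rule J(2))
    moreover have "0 \<le> of_int j1 * \<delta> - y0" "of_int j1 * \<delta> - y0 \<le> \<sigma>" using zin[OF 1(1) b(1)] by (auto simp: z_def)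
    ultimately show ?thesis using \<sigma> by linarith
  qed
  define q where "q = (\<lambda>s (t::real) j. s * (z j)\<^sup>2 + t * z j)"
  define w where "w = (\<lambda>s (t::real) j. 2 * s * z j + t)"
  define e1 where "e1 = - s1 - s2 + s3 + s4"
  define e2 where "e2 = (s1 * (of_int j1 * \<delta>)\<^sup>2 + t1 * (of_int j1 * \<delta>)) + (s2 * (of_int j2 * \<delta>)\<^sup>2 + t2 * (of_int j2 * \<delta>))
     - (s3 * (of_int j3 * \<delta>)\<^sup>2 + t3 * (of_int j3 * \<delta>)) - (s4 * (of_int j4 * \<delta>)\<^sup>2 + t4 * (of_int j4 * \<delta>))"
  define e3 where "e3 = (s1 * (2 * (of_int j1 * \<delta>)) + t1) + (s2 * (2 * (of_int j2 * \<delta>)) + t2) - (s3 * (2 * (of_int j3 * \<delta>)) + t3) - (s4 * (2 * (of_int j4 * \<delta>)) + t4)"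
  have "\<xi> - \<eta> = (e1, e2, e3)"
    by (simp add: eq 1(4) 2(4) 3(4) 4(4) th1_def th2_def e1_def e2_def e3_def)
  then have n: "\<bar>e1\<bar> < 1" "\<bar>e2\<bar> < 1" "\<bar>e3\<bar> < 1" using nearD near by metis+
  \<comment> \<open>The substitution y = y0 + z acts linearly on the triple (e1, e2, e3), with
    coefficients bounded in terms of Y; hence the errors stay below 5
    \<open>Y\<^sup>2\<close>.\<close>
  have psi_eq: "w s1 t1 j1 + w s2 t2 j2 - w s3 t3 j3 - w s4 t4 j4 = e3 + 2 * (y0 * e1)"
    unfolding w_def z_def e1_def e3_def by (simp add: algebra_simps)
  have phi_eq: "q s1 t1 j1 + q s2 t2 j2 - q s3 t3 j3 - q s4 t4 j4 = e2 - y0 * e3 - y0\<^sup>2 * e1"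
    unfolding q_def z_def e1_def e2_def e3_def by (simp add: power2_eq_square algebra_simps)
  have "\<bar>y0 * e1\<bar> \<le> Y * 1" "\<bar>y0 * e3\<bar> \<le> Y * 1" "\<bar>y0\<^sup>2 * e1\<bar> \<le> Y\<^sup>2 * 1"
    unfolding abs_mult using n y0 power_mono[OF y0, of 2] by (intro mult_mono; simp)+
  then have psi: "\<bar>w s1 t1 j1 + w s2 t2 j2 - w s3 t3 j3 - w s4 t4 j4\<bar> \<le> 5 * Y\<^sup>2"
    and phi: "\<bar>q s1 t1 j1 + q s2 t2 j2 - q s3 t3 j3 - q s4 t4 j4\<bar> \<le> 5 * Y\<^sup>2"
    unfolding psi_eq phi_eq using n Y_powers by linarith+
  have sv: "\<bar>s1 - v\<bar> \<le> \<bar>v\<bar> / (real k)\<^sup>2" "\<bar>s2 - v\<bar> \<le> \<bar>v\<bar> / (real k)\<^sup>2" "\<bar>s3 - v\<bar> \<le> \<bar>v\<bar> / (real k)\<^sup>2" "\<bar>s4 - v\<bar> \<le> \<bar>v\<bar> / (real k)\<^sup>2"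
    using 1(2) 2(2) 3(2) 4(2) v(2) by linarith+
  have "1 \<le> real k" using k by simp
  note pair = unordered_pair_determined[OF zin[OF 1(1) b(1)] zin[OF 2(1) b(2)] zin[OF 3(1) b(3)] zin[OF 4(1) b(4)] \<sigma> this v(1)
      sv t[OF 1(3)] t[OF 2(3)] t[OF 3(3)] t[OF 4(3)] \<rho>[folded \<sigma>_def] Q[folded \<sigma>_def] psi[unfolded w_def] phi[unfolded q_def]]
  have close: "\<bar>b - b'\<bar> \<le> 8" if "j \<in> arc (Suc l) b" "j' \<in> arc (Suc l) b'" "\<bar>z j - z j'\<bar> \<le> 7 * \<sigma> / real k" for b b' j j'
  proof -
    have b: "b = \<lfloor>of_int j * \<delta> * real k ^ Suc l\<rfloor>" "b' = \<lfloor>of_int j' * \<delta> * real k ^ Suc l\<rfloor>"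
      using that(1,2) by (auto simp: arc_def lev_def)
    have "\<bar>of_int j * \<delta> * real k ^ Suc l - of_int j' * \<delta> * real k ^ Suc l\<bar> = \<bar>z j - z j'\<bar> * real k ^ Suc l"
      by (simp add: z_def abs_mult flip: left_diff_distrib)
    also have "\<dots> \<le> 7 * \<sigma> / real k * real k ^ Suc l"
      using that(3) by (intro mult_right_mono) auto
    also have "\<dots> = 7" using k0 by (simp add: \<sigma>_def)
    \<comment> \<open>Real numbers at distance at most 7 have integer parts at distance at most
      8.\<close>
    finally show ?thesis unfolding b by linarith
  qed
  from pair show ?thesis
    using close[OF 1(1) 3(1)] close[OF 2(1) 4(1)] close[OF 1(1) 4(1)] close[OF 2(1) 3(1)] by blast
qed

text \<open>One step of \<open>L\<^sup>4\<close> decoupling: at this angular scale the truncated cone is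
  indistinguishable from a parabolic cylinder, so products of pairs of arcs are almost orthogonal.\<close>
lemma D4_Suc:
  assumes v: "0 < \<bar>v\<bar>" "2 * h \<le> \<bar>v\<bar> / (real k)\<^sup>2" and t: "\<And>t. \<bar>t - r\<bar> \<le> 2 * g \<Longrightarrow> \<bar>t\<bar> \<le> \<rho>"
    and \<rho>: "\<rho> \<le> (1 / real k ^ l) * \<bar>v\<bar> / (real k)\<^sup>2" and Q: "5 * Y\<^sup>2 \<le> (1 / real k ^ l)\<^sup>2 * \<bar>v\<bar> / (real k)\<^sup>2"
  shows "D4 l \<le> 578 * real k * D4 (Suc l)"
proof -
  define B where "B = (\<lambda>a. {b\<in>idx (Suc l). b div int k = a})"
  define x where "x = (\<lambda>b. FS (arc (Suc l) b))"
  define W where "W = (\<lambda>b. wint \<tau> (\<lambda>p. norm (x b p) ^ 4))"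
  have W0: "0 \<le> W b" for b unfolding W_def by (rule wint_nonneg) simp
  have finB: "finite (B a)" for a unfolding B_def using finite_idx by simp
  have bcx: "bc (x b)" for b unfolding x_def by (rule bcFS[OF arc_subset])
  have main: "wint \<tau> (\<lambda>p. norm (FS (arc l a) p) ^ 4) \<le> 578 * (real k * (\<Sum>b\<in>B a. W b))" for a
  proof -
    let ?G = "\<lambda>q p. x (fst q) p * x (snd q) p"
    have sq: "norm (FS (arc l a) p) ^ 4 = (norm (\<Sum>q\<in>B a \<times> B a. ?G q p))\<^sup>2" for p
    proof -
      have "FS (arc l a) p * FS (arc l a) p = (\<Sum>q\<in>B a \<times> B a. ?G q p)"
        unfolding FS_arc_Suc[of l a p] sum_product x_def B_def
        by (subst sum.cartesian_product) (simp add: case_prod_beta)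
      then have "(norm (\<Sum>q\<in>B a \<times> B a. ?G q p))\<^sup>2 = (norm (FS (arc l a) p) * norm (FS (arc l a) p))\<^sup>2"
        by (simp only: norm_mult[symmetric])
      then show ?thesis by (simp add: power2_eq_square power4_eq_xxxx mult.assoc)
    qed
    have "wint \<tau> (\<lambda>p. (norm (\<Sum>q\<in>B a \<times> B a. ?G q p))\<^sup>2) \<le> 578 * (\<Sum>q\<in>B a \<times> B a. wint \<tau> (\<lambda>p. (norm (?G q p))\<^sup>2))"
    proof (rule almost_orthogonality[OF \<tau>(1)])
      show "finite (B a \<times> B a)" using finB by simp
      show "bc (?G q)" for q by (intro bc_mult bcx)
      fix q assume q: "q \<in> B a \<times> B a"
      obtain b1 b2 where q12: "q = (b1, b2)" by (cases q)
      \<comment> \<open>A pair of children only meets pairs that agree with it up to 8 in each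
        entry, in either order: 2 times 17^2 = 578 possibilities, whatever \<open>k\<close>
        is.\<close>
      have "{q'\<in>B a \<times> B a. ip \<tau> (?G q) (?G q') \<noteq> 0} \<subseteq> ({b1-8..b1+8} \<times> {b2-8..b2+8}) \<union> ({b2-8..b2+8} \<times> {b1-8..b1+8})"
      proof
        fix q' assume q': "q' \<in> {q'\<in>B a \<times> B a. ip \<tau> (?G q) (?G q') \<noteq> 0}"
        obtain b3 b4 where q34: "q' = (b3, b4)" by (cases q')
        have "(\<bar>b1 - b3\<bar> \<le> 8 \<and> \<bar>b2 - b4\<bar> \<le> 8) \<or> (\<bar>b1 - b4\<bar> \<le> 8 \<and> \<bar>b2 - b3\<bar> \<le> 8)"
          by (rule overlap_four[where a=a and \<rho>=\<rho>, OF _ _ _ _ _ v t \<rho> Q])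
            (use q q' in \<open>auto simp: q12 q34 B_def x_def\<close>)
        then show "q' \<in> ({b1-8..b1+8} \<times> {b2-8..b2+8}) \<union> ({b2-8..b2+8} \<times> {b1-8..b1+8})"
          by (auto simp: q34)
      qed
      from card_mono[OF _ this] have "card {q'\<in>B a \<times> B a. ip \<tau> (?G q) (?G q') \<noteq> 0}
          \<le> card (({b1-8..b1+8} \<times> {b2-8..b2+8}) \<union> ({b2-8..b2+8} \<times> {b1-8..b1+8}))"
        by simp
      also have "\<dots> \<le> card ({b1-8..b1+8} \<times> {b2-8..b2+8}) + card ({b2-8..b2+8} \<times> {b1-8..b1+8})"
        by (rule card_Un_le)
      also have "\<dots> = 578" by (simp add: card_cartesian_product)
      finally show "real (card {q'\<in>B a \<times> B a. ip \<tau> (?G q) (?G q') \<noteq> 0}) \<le> 578" by simp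
    qed
    \<comment> \<open>The arithmetic-geometric mean inequality turns products back into fourth
      powers. Each child is then counted once per sibling, which is the factor \<open>k\<close>; the
      shrinking sup norms of the arcs repay it later.\<close>
    also have "\<dots> \<le> 578 * (\<Sum>q\<in>B a \<times> B a. (W (fst q) + W (snd q)) / 2)"
    proof (intro mult_left_mono sum_mono)
      fix q
      let ?u = "\<lambda>i::bool. if i then x (fst q) else x (snd q)"
      have "wint \<tau> (\<lambda>p. (norm (?G q p))\<^sup>2) \<le> (1/2) * (\<Sum>i\<in>UNIV. wint \<tau> (\<lambda>p. norm (?u i p) ^ 4))"
      proof (rule wint_le_sum[OF \<tau>(1)])
        fix p
        have "(norm (?G q p))\<^sup>2 = (norm (x (fst q) p))\<^sup>2 * (norm (x (snd q) p))\<^sup>2"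
          by (simp add: norm_mult power_mult_distrib)
        also have "\<dots> \<le> (1/2) * (((norm (x (fst q) p))\<^sup>2)\<^sup>2 + ((norm (x (snd q) p))\<^sup>2)\<^sup>2)"
          using sum_squares_bound[of "(norm (x (fst q) p))\<^sup>2" "(norm (x (snd q) p))\<^sup>2"] by simp
        finally show "(norm (?G q p))\<^sup>2 \<le> (1/2) * (\<Sum>i\<in>UNIV. norm (?u i p) ^ 4)"
          by (simp add: UNIV_bool power_mult[symmetric])
      qed (auto intro!: bc_mult bcx)
      then show "wint \<tau> (\<lambda>p. (norm (?G q p))\<^sup>2) \<le> (W (fst q) + W (snd q)) / 2"
        by (simp add: UNIV_bool W_def)
    qed simp
    also have "(\<Sum>q\<in>B a \<times> B a. (W (fst q) + W (snd q)) / 2) = (\<Sum>b\<in>B a. \<Sum>c\<in>B a. (W b + W c) / 2)"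
      by (subst sum.cartesian_product) (simp add: case_prod_beta)
    also have "\<dots> = real (card (B a)) * (\<Sum>b\<in>B a. W b)"
      by (simp add: add_divide_distrib sum.distrib sum_distrib_left[symmetric] sum_divide_distrib[symmetric])
    also have "578 * (real (card (B a)) * (\<Sum>b\<in>B a. W b)) \<le> 578 * (real k * (\<Sum>b\<in>B a. W b))"
      using card_children[of l a] W0 by (intro mult_left_mono mult_right_mono sum_nonneg) (auto simp: B_def)
    finally show ?thesis unfolding sq .
  qed
  have "D4 l \<le> (\<Sum>a\<in>idx l. 578 * (real k * (\<Sum>b\<in>B a. W b)))"
    unfolding D4_def by (intro sum_mono main)
  also have "\<dots> = 578 * real k * (\<Sum>a\<in>idx l. \<Sum>b\<in>B a. W b)"
    by (simp only: sum_distrib_left mult.assoc)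
  also have "(\<Sum>a\<in>idx l. \<Sum>b\<in>B a. W b) = D4 (Suc l)"
    unfolding B_def D4_def W_def x_def by (rule sum_children)
  finally show ?thesis .
qed

lemma D4_iterate:
  assumes v: "0 < \<bar>v\<bar>" "2 * h \<le> \<bar>v\<bar> / (real k)\<^sup>2" and t: "\<And>t. \<bar>t - r\<bar> \<le> 2 * g \<Longrightarrow> \<bar>t\<bar> \<le> \<rho>"
    and c: "\<And>i. i < l \<Longrightarrow> \<rho> \<le> (1 / real k ^ i) * \<bar>v\<bar> / (real k)\<^sup>2 \<and> 5 * Y\<^sup>2 \<le> (1 / real k ^ i)\<^sup>2 * \<bar>v\<bar> / (real k)\<^sup>2"
  shows "D4 0 \<le> (578 * real k) ^ l * D4 l"
  using c
proof (induction l)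
  case (Suc l)
  have "D4 0 \<le> (578 * real k) ^ l * D4 l" using Suc by simp
  also have "\<dots> \<le> (578 * real k) ^ l * (578 * real k * D4 (Suc l))"
    using Suc.prems[of l] by (intro mult_left_mono D4_Suc[OF v t]) auto
  finally show ?case by (simp add: mult_ac)
qed simp

text \<open>The gain 1 / X does not depend on how the frequency is divided between the two
  directions, which is the form the counting needs. \<open>gv\<close> and \<open>gr\<close> say that
  a window is either narrow compared with its distance from the origin or confined to frequencies
  O(\<open>k\<^sup>2\<close>). \<open>L\<close> bounds the number of decoupling steps.\<close>

theorem wint_power4_le:
  assumes hg: "0 < h" "0 < g"
    and gv: "2 * h * (real k)\<^sup>2 \<le> \<bar>v\<bar> \<or> \<bar>v\<bar> + 2 * h \<le> 4 * (real k)\<^sup>2"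
    and gr: "2 * g * (real k)\<^sup>2 \<le> \<bar>r\<bar> \<or> \<bar>r\<bar> + 2 * g \<le> 4 * (real k)\<^sup>2"
    and size: "\<bar>v\<bar> + 2 * h \<le> 8 / \<delta>" "\<bar>r\<bar> + 2 * g \<le> 8 / \<delta>" and vL: "\<bar>v\<bar> \<le> real k ^ (2 * L)"
  defines "X \<equiv> \<bar>v\<bar> + 2 * h + \<bar>r\<bar> + 2 * g"
  shows "wint \<tau> (\<lambda>p. norm (FS J p) ^ 4) \<le> 21600 * Y ^ 5 * C1 ^ 3 * C2 * 578 ^ L * (real k ^ 8 * mass / X)"
proof -
  define \<rho> where "\<rho> = \<bar>r\<bar> + 2 * g"
  define V where "V = \<bar>v\<bar>"
  define \<kappa> where "\<kappa> = real k"
  define C0 where "C0 = C1 ^ 3 * C2 * mass"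
  have C0: "0 \<le> C0" unfolding C0_def using C1 C2 mass_nonneg by simp
  have \<kappa>: "8 \<le> \<kappa>" "0 < \<kappa>" using k by (auto simp: \<kappa>_def)
  have \<rho>0: "0 < \<rho>" using hg by (simp add: \<rho>_def)
  have X0: "0 < X" using hg by (simp add: X_def)
  have Xeq: "X = V + 2 * h + \<rho>" by (simp add: X_def V_def \<rho>_def)
  have \<kappa>2: "64 \<le> \<kappa>\<^sup>2" using power_mono[OF \<kappa>(1), of 2] by simp
  have kp: "\<kappa> ^ m \<le> \<kappa> ^ n" if "m \<le> n" for m n using \<kappa> that by (intro power_increasing) auto
  have Y35: "Y ^ 3 \<le> Y ^ 5" "1 \<le> Y ^ 5" using Y by (auto intro: power_increasing)
  have tup: "\<bar>t\<bar> \<le> \<rho>" if "\<bar>t - r\<bar> \<le> 2 * g" for t using that unfolding \<rho>_def by linarith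
  have goal: "wint \<tau> (\<lambda>p. norm (FS J p) ^ 4) \<le> 21600 * Y ^ 5 * C1 ^ 3 * C2 * 578 ^ L * (real k ^ 8 * mass / X)"
    if "wint \<tau> (\<lambda>p. norm (FS J p) ^ 4) \<le> 21600 * Y ^ 5 * 578 ^ m * C0 * (\<kappa> ^ 8 / X)" "m \<le> L" for m
  proof -
    have "21600 * Y ^ 5 * 578 ^ m * C0 * (\<kappa> ^ 8 / X) \<le> 21600 * Y ^ 5 * 578 ^ L * C0 * (\<kappa> ^ 8 / X)"
      using that(2) C0 \<kappa> X0 Y by (intro mult_right_mono mult_left_mono power_increasing) auto
    also have "\<dots> = 21600 * Y ^ 5 * C1 ^ 3 * C2 * 578 ^ L * (real k ^ 8 * mass / X)"
      by (simp add: C0_def \<kappa>_def)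
    finally show ?thesis using that(1) by linarith
  qed
  have base: "wint \<tau> (\<lambda>p. norm (FS J p) ^ 4) \<le> 27 * Y ^ 3 * D4 0"
    using total_le_D4 by (simp add: power_mult_distrib)
  \<comment> \<open>Squared sup norm of an arc, \<kappa>^(-2 l), times the number of slices in it
    multiplied by \<delta>, which is about \<kappa>^(-l).\<close>
  have trivial: "D4 l \<le> 8 * C0 / \<kappa> ^ (3 * l)" if "\<delta> \<le> 1 / \<kappa> ^ l" for l
  proof -
    have "D2 l \<le> (1 / (\<kappa> ^ l * \<delta>) + 1) * (C1 * C2 * \<delta> * mass)" unfolding \<kappa>_def by (rule D2_trivial)
    also have "\<dots> \<le> (2 / (\<kappa> ^ l * \<delta>)) * (C1 * C2 * \<delta> * mass)"
    proof (rule mult_right_mono)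
      have "1 \<le> 1 / (\<kappa> ^ l * \<delta>)" using that \<delta> \<kappa> by (simp add: field_simps)
      then have "1 / (\<kappa> ^ l * \<delta>) + 1 \<le> 1 / (\<kappa> ^ l * \<delta>) + 1 / (\<kappa> ^ l * \<delta>)" by (rule add_left_mono)
      then show "1 / (\<kappa> ^ l * \<delta>) + 1 \<le> 2 / (\<kappa> ^ l * \<delta>)" by (simp add: mult.commute)
    qed (use C1 C2 \<delta> mass_nonneg in auto)
    also have "\<dots> = 2 * (C1 * C2 * mass) / \<kappa> ^ l" using \<delta> by simp
    finally have d: "D2 l \<le> 2 * (C1 * C2 * mass) / \<kappa> ^ l" .
    have "D4 l \<le> (2 * C1 / \<kappa> ^ l)\<^sup>2 * D2 l" using D4_le_D2[of l] that by (simp add: \<kappa>_def)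
    also have "\<dots> \<le> (2 * C1 / \<kappa> ^ l)\<^sup>2 * (2 * (C1 * C2 * mass) / \<kappa> ^ l)"
      by (intro mult_left_mono d) simp
    also have "\<dots> = 8 * C0 / \<kappa> ^ (3 * l)"
      unfolding C0_def by (simp add: power_divide power2_eq_square power3_eq_cube power_mult[symmetric] power_add[symmetric] mult_ac)
        (simp add: numeral_3_eq_3 power_add mult_ac)
    finally show ?thesis .
  qed
  have transversal: "D4 l \<le> 192 * Y\<^sup>2 * C0 * \<kappa> ^ 3 / (\<rho> * \<kappa> ^ (2 * l))"
    if "\<delta> \<le> 1 / \<kappa> ^ l" "2 * g * \<kappa>\<^sup>2 \<le> \<bar>r\<bar>" "(V + 2 * h) / \<kappa> ^ (l + 3) \<le> \<rho> / 4" for l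
  proof -
    have g: "6 * g \<le> \<bar>r\<bar>"
    proof -
      have "2 * g * 64 \<le> 2 * g * \<kappa>\<^sup>2" using \<kappa>2 hg by (intro mult_left_mono) auto
      then show ?thesis using that(2) hg by linarith
    qed
    have low: "\<rho> / 2 \<le> \<bar>t\<bar>" if "\<bar>t - r\<bar> \<le> 2 * g" for t
    proof -
      have "\<bar>r\<bar> \<le> \<bar>t\<bar> + \<bar>t - r\<bar>" by linarith
      with that have "\<bar>r\<bar> \<le> \<bar>t\<bar> + 2 * g" by linarith
      then show ?thesis using g by (simp add: \<rho>_def)
    qed
    \<comment> \<open>Cauchy-Schwarz over three further levels, at the affordable price \<kappa>^3,
      makes the arcs short enough for \<open>D2_transversal\<close>.\<close>
    have "D2 l \<le> real k ^ 3 * D2 (l + 3)" by (rule D2_add)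
    also have "\<dots> \<le> real k ^ 3 * (48 * Y\<^sup>2 / \<rho> * (C1 * C2 * mass))"
      using \<rho>0 size(2) low that(3) unfolding V_def \<kappa>_def by (intro mult_left_mono D2_transversal) (auto simp: \<rho>_def)
    finally have d: "D2 l \<le> \<kappa> ^ 3 * (48 * Y\<^sup>2 / \<rho> * (C1 * C2 * mass))" by (simp add: \<kappa>_def)
    have "D4 l \<le> (2 * C1 / \<kappa> ^ l)\<^sup>2 * D2 l" using D4_le_D2[of l] that by (simp add: \<kappa>_def)
    also have "\<dots> \<le> (2 * C1 / \<kappa> ^ l)\<^sup>2 * (\<kappa> ^ 3 * (48 * Y\<^sup>2 / \<rho> * (C1 * C2 * mass)))"
      by (intro mult_left_mono d) simp
    also have "\<dots> = 192 * Y\<^sup>2 * C0 * \<kappa> ^ 3 / (\<rho> * \<kappa> ^ (2 * l))"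
    proof -
      have "(\<kappa> ^ l)\<^sup>2 = \<kappa> ^ (2 * l)" by (simp add: power_mult[symmetric] mult.commute)
      then show ?thesis
        unfolding C0_def by (simp add: power_divide power_mult_distrib power3_eq_cube[of C1] power2_eq_square[of C1] mult_ac)
    qed
    finally show ?thesis .
  qed
  \<comment> \<open>In case A the allowed loss \<kappa>^8 covers X, so nothing has to be gained. In
    B the frequencies are far from the cone and no decoupling takes place. The threshold in B and C
    is high enough to exclude the low-frequency alternatives of \<open>gv\<close> and
    \<open>gr\<close> where they would hurt.\<close>
  consider (A) "X \<le> 100 * \<kappa> ^ 8" | (B) "100 * \<kappa> ^ 8 < X" "V \<le> \<rho> * \<kappa>\<^sup>2" | (C) "100 * \<kappa> ^ 8 < X" "\<rho> * \<kappa>\<^sup>2 < V"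
    by linarith
  then show ?thesis
  proof cases
    case A
    have "D4 0 \<le> 8 * C0" using trivial[of 0] \<delta> by simp
    then have "wint \<tau> (\<lambda>p. norm (FS J p) ^ 4) \<le> 27 * Y ^ 3 * (8 * C0)"
      using base Y by (smt (verit) mult_left_mono zero_le_power)
    also have "\<dots> \<le> 216 * Y ^ 5 * C0 * 1"
      using mult_right_mono[OF Y35(1) C0] by simp
    also have "\<dots> \<le> 216 * Y ^ 5 * C0 * (100 * \<kappa> ^ 8 / X)"
      using A X0 C0 Y by (intro mult_left_mono) auto
    finally have "wint \<tau> (\<lambda>p. norm (FS J p) ^ 4) \<le> 21600 * Y ^ 5 * 578 ^ 0 * C0 * (\<kappa> ^ 8 / X)"
      by simp
    then show ?thesis by (rule goal) simp
  next
    case B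
    have "2 * h * 1 \<le> 2 * h * \<kappa>\<^sup>2" using hg \<kappa>2 by (intro mult_left_mono) auto
    then have hv: "2 * h \<le> V \<or> V + 2 * h \<le> 4 * \<kappa>\<^sup>2"
      using gv[folded V_def \<kappa>_def] by linarith
    have "\<kappa>\<^sup>2 \<le> \<kappa> ^ 8" by (rule kp) simp
    have X3: "X \<le> 3 * (\<rho> * \<kappa>\<^sup>2)"
    proof -
      have "\<rho> \<le> \<rho> * \<kappa>\<^sup>2" using \<rho>0 \<kappa>2 by simp
      moreover note hv
      moreover have "0 < \<rho> * \<kappa>\<^sup>2" using \<rho>0 \<kappa> by simp
      ultimately show ?thesis
        using B \<open>\<kappa>\<^sup>2 \<le> \<kappa> ^ 8\<close> \<kappa>2 unfolding Xeq by linarith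
    qed
    have V\<rho>: "V + 2 * h \<le> 2 * (\<rho> * \<kappa>\<^sup>2)"
    proof -
      have "\<rho> \<le> \<rho> * \<kappa>\<^sup>2" using \<rho>0 \<kappa>2 by simp
      moreover note hv
      ultimately show ?thesis
        using B \<open>\<kappa>\<^sup>2 \<le> \<kappa> ^ 8\<close> \<kappa>2 unfolding Xeq by linarith
    qed
    \<comment> \<open>A low window in the second direction would give \<rho> at most 4
      \<open>\<kappa>\<^sup>2\<close>, hence X at most 12 \<kappa>^4, contrary to the
      threshold.\<close>
    have rg: "2 * g * \<kappa>\<^sup>2 \<le> \<bar>r\<bar>"
    proof (rule ccontr)
      assume "\<not> 2 * g * \<kappa>\<^sup>2 \<le> \<bar>r\<bar>"
      then have "\<rho> \<le> 4 * \<kappa>\<^sup>2" using gr by (simp add: \<rho>_def \<kappa>_def)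
      then have "\<rho> * \<kappa>\<^sup>2 \<le> 4 * \<kappa>\<^sup>2 * \<kappa>\<^sup>2" by (intro mult_right_mono) auto
      also have "\<dots> = 4 * \<kappa> ^ 4" by (simp add: power2_eq_square power4_eq_xxxx)
      also have "\<dots> \<le> 4 * \<kappa> ^ 8" by (intro mult_left_mono kp) auto
      finally show False using X3 B(1) zero_less_power[OF \<kappa>(2), of 8] by linarith
    qed
    have "(V + 2 * h) / \<kappa> ^ (0 + 3) \<le> 2 * (\<rho> * \<kappa>\<^sup>2) / \<kappa> ^ 3"
      using V\<rho> \<kappa> by (simp add: divide_right_mono)
    also have "\<dots> = 2 * \<rho> / \<kappa>" using \<kappa> by (simp add: power2_eq_square power3_eq_cube)
    also have "\<dots> \<le> 2 * \<rho> / 8" using \<kappa> \<rho>0 by (intro divide_left_mono) auto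
    finally have sh: "(V + 2 * h) / \<kappa> ^ (0 + 3) \<le> \<rho> / 4" by simp
    have "D4 0 \<le> 192 * Y\<^sup>2 * C0 * \<kappa> ^ 3 / \<rho>" using transversal[OF _ rg sh] \<delta> by simp
    also have "\<dots> \<le> 192 * Y\<^sup>2 * C0 * (3 * \<kappa> ^ 5 / X)"
    proof -
      have "1 / \<rho> \<le> 3 * \<kappa>\<^sup>2 / X" using X3 X0 \<rho>0 by (simp add: field_simps)
      then have "192 * Y\<^sup>2 * C0 * \<kappa> ^ 3 * (1 / \<rho>) \<le> 192 * Y\<^sup>2 * C0 * \<kappa> ^ 3 * (3 * \<kappa>\<^sup>2 / X)"
        using C0 \<kappa> by (intro mult_left_mono) auto
      then show ?thesis by (simp add: power2_eq_square power3_eq_cube numeral_eq_Suc mult_ac)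
    qed
    also have "\<dots> \<le> 192 * Y\<^sup>2 * C0 * (3 * \<kappa> ^ 8 / X)"
      using C0 X0 kp[of 5 8] by (intro mult_left_mono divide_right_mono) auto
    finally have "27 * Y ^ 3 * D4 0 \<le> 27 * Y ^ 3 * (192 * Y\<^sup>2 * C0 * (3 * \<kappa> ^ 8 / X))"
      using Y by (intro mult_left_mono) auto
    also have "\<dots> = 15552 * (Y ^ 5 * C0 * (\<kappa> ^ 8 / X))"
      by (simp add: numeral_eq_Suc mult_ac)
    also have "\<dots> \<le> 21600 * (Y ^ 5 * C0 * (\<kappa> ^ 8 / X))"
      using Y C0 X0 \<kappa> by (intro mult_right_mono) auto
    finally have "wint \<tau> (\<lambda>p. norm (FS J p) ^ 4) \<le> 21600 * Y ^ 5 * 578 ^ 0 * C0 * (\<kappa> ^ 8 / X)"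
      using base by (simp add: mult_ac)
    then show ?thesis by (rule goal) simp
  next
    case C
    have V0: "0 < V" using C(2) \<rho>0 \<kappa> by (smt (verit) mult_pos_pos zero_less_power)
    have "\<rho> \<le> \<rho> * \<kappa>\<^sup>2" using \<rho>0 \<kappa>2 by simp
    then have \<rho>V: "\<rho> < V" using C by linarith
    have "\<kappa>\<^sup>2 \<le> \<kappa> ^ 8" by (rule kp) simp
    have vg: "2 * h * \<kappa>\<^sup>2 \<le> V"
    proof (rule ccontr)
      assume "\<not> 2 * h * \<kappa>\<^sup>2 \<le> V"
      then have "V + 2 * h \<le> 4 * \<kappa>\<^sup>2" using gv by (simp add: V_def \<kappa>_def)
      then show False using C(1) \<rho>V \<open>\<kappa>\<^sup>2 \<le> \<kappa> ^ 8\<close> hg \<kappa>2 unfolding Xeq by linarith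
    qed
    have "2 * h * 1 \<le> 2 * h * \<kappa>\<^sup>2" using hg \<kappa>2 by (intro mult_left_mono) auto
    then have hV: "2 * h \<le> V" using vg by linarith
    have X3: "X \<le> 3 * V" using hV \<rho>V unfolding Xeq by linarith
    \<comment> \<open>A level is bad when a hypothesis of \<open>D4_Suc\<close> fails there.
      Decoupling runs to the first bad level, and the hypothesis that fails decides how the
      remaining arcs are estimated.\<close>
    define bad where "bad = (\<lambda>l. V < \<rho> * \<kappa> ^ (l + 2) \<or> V < 5 * Y\<^sup>2 * \<kappa> ^ (2 * l + 2))"
    have "\<exists>l. bad l"
    proof -
      obtain l where "V / \<rho> < \<kappa> ^ l" using real_arch_pow[of \<kappa> "V / \<rho>"] \<kappa> by auto
      also have "\<kappa> ^ l \<le> \<kappa> ^ (l + 2)" by (rule kp) simp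
      finally show ?thesis using \<rho>0 unfolding bad_def by (auto simp: pos_divide_less_eq mult.commute)
    qed
    define l where "l = (LEAST l. bad l)"
    have bad: "bad l" unfolding l_def using \<open>\<exists>l. bad l\<close> by (rule LeastI_ex)
    have good: "\<rho> * \<kappa> ^ (i + 2) \<le> V \<and> 5 * Y\<^sup>2 * \<kappa> ^ (2 * i + 2) \<le> V" if "i < l" for i
      using not_less_Least[OF that[unfolded l_def]] unfolding bad_def by auto
    have dec: "D4 0 \<le> (578 * \<kappa>) ^ l * D4 l"
      unfolding \<kappa>_def
    proof (rule D4_iterate[where \<rho>=\<rho>, OF _ _ tup])
      show "0 < \<bar>v\<bar>" using V0 by (simp add: V_def)
      show "2 * h \<le> \<bar>v\<bar> / (real k)\<^sup>2" using vg \<kappa> by (simp add: V_def \<kappa>_def pos_le_divide_eq)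
      fix i assume "i < l"
      have gen: "x \<le> 1 / P * V / q" if "x * (P * q) \<le> V" "0 < P" "0 < q" for x P q
        using that by (simp add: field_simps)
      have e1: "\<kappa> ^ (i + 2) = \<kappa> ^ i * \<kappa>\<^sup>2" by (rule power_add)
      have e2: "\<kappa> ^ (2 * i + 2) = (\<kappa> ^ i)\<^sup>2 * \<kappa>\<^sup>2"
        by (simp only: power_add power_even_eq)
      have e3: "(1 / \<kappa> ^ i)\<^sup>2 = 1 / (\<kappa> ^ i)\<^sup>2" by (simp add: power_divide)
      from good[OF \<open>i < l\<close>] have "\<rho> \<le> 1 / \<kappa> ^ i * V / \<kappa>\<^sup>2 \<and> 5 * Y\<^sup>2 \<le> (1 / \<kappa> ^ i)\<^sup>2 * V / \<kappa>\<^sup>2"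
        unfolding e1 e2 e3 using \<kappa> by (intro conjI gen) auto
      then show "\<rho> \<le> 1 / real k ^ i * \<bar>v\<bar> / (real k)\<^sup>2 \<and> 5 * Y\<^sup>2 \<le> (1 / real k ^ i)\<^sup>2 * \<bar>v\<bar> / (real k)\<^sup>2"
        by (simp only: V_def \<kappa>_def)
    qed
    \<comment> \<open>This bounds the number of steps by \<open>L\<close>, and, as V is at most 8 /
      \<delta>, keeps the arcs longer than \<delta>.\<close>
    have lV: "\<kappa> ^ (2 * l) \<le> V"
    proof (cases l)
      case 0
      have "1 \<le> \<kappa> ^ 8" using \<kappa> by simp
      then show ?thesis using 0 X3 C(1) by simp
    next
      case (Suc i)
      have "\<kappa> ^ (2 * l) = \<kappa> ^ (2 * i + 2)" by (simp add: Suc)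
      also have "\<dots> \<le> 5 * Y\<^sup>2 * \<kappa> ^ (2 * i + 2)" using Y_powers \<kappa> by simp
      finally show ?thesis using good[of i] Suc by simp
    qed
    have lL: "l \<le> L"
    proof -
      have "\<kappa> ^ (2 * l) \<le> \<kappa> ^ (2 * L)" using lV vL by (simp add: V_def \<kappa>_def)
      then show ?thesis using \<kappa> by (simp add: power_increasing_iff)
    qed
    have dl: "\<delta> \<le> 1 / \<kappa> ^ l"
    proof -
      have "\<kappa> ^ (2 * l) \<le> 8 / \<delta>" using lV size(1) hg by (simp add: V_def)
      also have "\<dots> \<le> 1 / \<delta>\<^sup>2" using \<delta> by (simp add: power2_eq_square field_simps)
      finally have "(\<kappa> ^ l)\<^sup>2 \<le> (1 / \<delta>)\<^sup>2" by (simp add: power_mult[symmetric] mult.commute power_divide)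
      then have "\<kappa> ^ l \<le> 1 / \<delta>" by (rule power2_le_imp_le) (use \<delta> in simp)
      then show ?thesis using \<delta> \<kappa> by (simp add: field_simps)
    qed
    \<comment> \<open>The factor \<kappa>^l accumulated by decoupling has to be recovered from
      \<open>D4 l\<close>; only 578^l is a genuine loss.\<close>
    have fin: "wint \<tau> (\<lambda>p. norm (FS J p) ^ 4) \<le> 21600 * Y ^ 5 * 578 ^ l * C0 * (\<kappa> ^ 8 / X)"
      if "\<kappa> ^ l * D4 l \<le> 600 * Y\<^sup>2 * C0 * (\<kappa> ^ 8 / X)"
    proof -
      have "27 * Y ^ 3 * D4 0 \<le> 27 * Y ^ 3 * ((578 * \<kappa>) ^ l * D4 l)"
        using dec Y by (intro mult_left_mono) auto
      also have "\<dots> = 27 * Y ^ 3 * 578 ^ l * (\<kappa> ^ l * D4 l)" by (simp add: power_mult_distrib mult_ac)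
      also have "\<dots> \<le> 27 * Y ^ 3 * 578 ^ l * (600 * Y\<^sup>2 * C0 * (\<kappa> ^ 8 / X))"
        using that Y by (intro mult_left_mono) auto
      also have "\<dots> = 16200 * (Y ^ 5 * 578 ^ l * C0 * (\<kappa> ^ 8 / X))" by (simp add: numeral_eq_Suc mult_ac)
      also have "\<dots> \<le> 21600 * (Y ^ 5 * 578 ^ l * C0 * (\<kappa> ^ 8 / X))"
        using Y C0 X0 \<kappa> by (intro mult_right_mono) auto
      finally show ?thesis using base by (simp add: mult_ac)
    qed
    have "\<kappa> ^ l * D4 l \<le> 600 * Y\<^sup>2 * C0 * (\<kappa> ^ 8 / X)"
    proof (cases "V < 5 * Y\<^sup>2 * \<kappa> ^ (2 * l + 2)")
      case True
      have "\<kappa> ^ l * D4 l \<le> \<kappa> ^ l * (8 * C0 / \<kappa> ^ (3 * l))"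
        using \<kappa> by (intro mult_left_mono trivial[OF dl]) auto
      also have "\<dots> = 8 * C0 * (1 / \<kappa> ^ (2 * l))"
        using \<kappa> by (simp add: numeral_3_eq_3 numeral_2_eq_2 power_add)
      also have "\<dots> \<le> 8 * C0 * (15 * Y\<^sup>2 * \<kappa>\<^sup>2 / X)"
      proof (intro mult_left_mono)
        have "X \<le> 3 * (5 * Y\<^sup>2 * \<kappa> ^ (2 * l + 2))" using X3 True by linarith
        also have "\<dots> = 15 * Y\<^sup>2 * \<kappa>\<^sup>2 * \<kappa> ^ (2 * l)" by (simp add: power_add power2_eq_square mult_ac)
        finally have "X \<le> 15 * Y\<^sup>2 * \<kappa>\<^sup>2 * \<kappa> ^ (2 * l)" .
        then show "1 / \<kappa> ^ (2 * l) \<le> 15 * Y\<^sup>2 * \<kappa>\<^sup>2 / X" using X0 \<kappa> by (simp add: field_simps)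
      qed (use C0 in simp)
      also have "\<dots> = 120 * Y\<^sup>2 * C0 * (\<kappa>\<^sup>2 / X)" by simp
      also have "\<dots> \<le> 600 * Y\<^sup>2 * C0 * (\<kappa> ^ 8 / X)"
        using C0 X0 kp[of 2 8] by (intro mult_mono divide_right_mono) auto
      finally show ?thesis .
    next
      case False
      then have Vl: "5 * Y\<^sup>2 * \<kappa> ^ (2 * l + 2) \<le> V" and \<rho>l: "V < \<rho> * \<kappa> ^ (l + 2)"
        using bad unfolding bad_def by auto
      \<comment> \<open>If the window were low, \<rho> would be at most 4
        \<open>\<kappa>\<^sup>2\<close> and V below 4 \<kappa>^3 \<kappa>^(l + 1). Since \<kappa>^(2
        l + 2) is at most V at this level, squaring gives V below 16 \<kappa>^6, too small for case
        C.\<close>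
      have rg: "2 * g * \<kappa>\<^sup>2 \<le> \<bar>r\<bar>"
      proof (rule ccontr)
        assume "\<not> 2 * g * \<kappa>\<^sup>2 \<le> \<bar>r\<bar>"
        then have "\<rho> \<le> 4 * \<kappa>\<^sup>2" using gr by (simp add: \<rho>_def \<kappa>_def)
        then have "\<rho> * \<kappa> ^ (l + 2) \<le> 4 * \<kappa>\<^sup>2 * \<kappa> ^ (l + 2)" using \<kappa> by (intro mult_right_mono) auto
        also have "\<dots> = 4 * \<kappa> ^ 3 * \<kappa> ^ (l + 1)" by (simp add: power_add numeral_eq_Suc)
        finally have "V < 4 * \<kappa> ^ 3 * \<kappa> ^ (l + 1)" using \<rho>l by linarith
        then have "V\<^sup>2 < (4 * \<kappa> ^ 3 * \<kappa> ^ (l + 1))\<^sup>2" using V0 by (intro power_strict_mono) auto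
        also have "\<dots> = 16 * \<kappa> ^ 6 * \<kappa> ^ (2 * l + 2)"
        proof -
          have "(\<kappa> ^ (l + 1))\<^sup>2 = \<kappa> ^ (2 * l + 2)"
            unfolding power_mult[symmetric] by (rule arg_cong[where f="power \<kappa>"]) simp
          moreover have "(\<kappa> ^ 3)\<^sup>2 = \<kappa> ^ 6"
            unfolding power_mult[symmetric] by (rule arg_cong[where f="power \<kappa>"]) simp
          ultimately show ?thesis by (simp only: power_mult_distrib) simp
        qed
        also have "\<dots> \<le> 16 * \<kappa> ^ 6 * V"
        proof (intro mult_left_mono)
          have "1 * \<kappa> ^ (2 * l + 2) \<le> (5 * Y\<^sup>2) * \<kappa> ^ (2 * l + 2)" using Y_powers \<kappa> by (intro mult_right_mono) auto
          then show "\<kappa> ^ (2 * l + 2) \<le> V" using Vl by linarith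
        qed (use \<kappa> in auto)
        finally have "V < 16 * \<kappa> ^ 6" using V0 by (simp add: power2_eq_square)
        then show False using X3 C(1) kp[of 6 8] zero_less_power[OF \<kappa>(2), of 6] by linarith
      qed
      have "(V + 2 * h) / \<kappa> ^ (l + 3) \<le> 2 * (\<rho> * \<kappa> ^ (l + 2)) / \<kappa> ^ (l + 3)"
        using hV \<rho>l \<kappa> by (intro divide_right_mono) auto
      also have "\<dots> = 2 * \<rho> / \<kappa>" using \<kappa> by (simp add: power_add numeral_eq_Suc)
      also have "\<dots> \<le> 2 * \<rho> / 8" using \<kappa> \<rho>0 by (intro divide_left_mono) auto
      finally have sh: "(V + 2 * h) / \<kappa> ^ (l + 3) \<le> \<rho> / 4" by simp
      have "\<kappa> ^ l * D4 l \<le> \<kappa> ^ l * (192 * Y\<^sup>2 * C0 * \<kappa> ^ 3 / (\<rho> * \<kappa> ^ (2 * l)))"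
        using \<kappa> by (intro mult_left_mono transversal[OF dl rg sh]) auto
      also have "\<dots> = 192 * Y\<^sup>2 * C0 * \<kappa> ^ 3 * (1 / (\<rho> * \<kappa> ^ l))"
        using \<kappa> by (simp add: mult_2 power_add)
      also have "\<dots> \<le> 192 * Y\<^sup>2 * C0 * \<kappa> ^ 3 * (3 * \<kappa>\<^sup>2 / X)"
      proof (intro mult_left_mono)
        have "X \<le> 3 * (\<rho> * \<kappa> ^ (l + 2))" using X3 \<rho>l by linarith
        also have "\<dots> = 3 * \<kappa>\<^sup>2 * (\<rho> * \<kappa> ^ l)" by (simp add: power_add power2_eq_square mult_ac)
        finally have "X \<le> 3 * \<kappa>\<^sup>2 * (\<rho> * \<kappa> ^ l)" .
        then show "1 / (\<rho> * \<kappa> ^ l) \<le> 3 * \<kappa>\<^sup>2 / X" using X0 \<rho>0 \<kappa> by (simp add: field_simps)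
      qed (use C0 \<kappa> in simp)
      also have "\<dots> = 576 * Y\<^sup>2 * C0 * (\<kappa> ^ 5 / X)" by (simp add: numeral_eq_Suc mult_ac)
      also have "\<dots> \<le> 600 * Y\<^sup>2 * C0 * (\<kappa> ^ 8 / X)"
        using C0 X0 kp[of 5 8] \<kappa> by (intro mult_mono divide_right_mono) auto
      finally show ?thesis .
    qed
    from goal[OF fin[OF this] lL] show ?thesis .
  qed
qed

end

section \<open>Large values and frequency windows\<close>

definition qb :: "pt \<Rightarrow> real \<Rightarrow> pt set" where
  "qb a \<rho> = {p. \<bar>fst p - fst a\<bar> \<le> \<rho> \<and> \<bar>fst (snd p) - fst (snd a)\<bar> \<le> \<rho> \<and> \<bar>snd (snd p) - snd (snd a)\<bar> \<le> \<rho>}"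

lemma measure_lborel_cube:
  fixes a b c \<eta> :: real
  assumes "0 \<le> \<eta>"
  shows "emeasure lborel ({a..<a + \<eta>} \<times> ({b..<b + \<eta>} \<times> {c..<c + \<eta>})) = ennreal (\<eta> ^ 3)"
proof -
  have 1: "emeasure lborel ({b..<b + \<eta>} \<times> {c..<c + \<eta>}) = ennreal (\<eta> * \<eta>)"
    unfolding lborel_prod[symmetric] using assms
    by (subst lborel.emeasure_pair_measure_Times) (auto simp: ennreal_mult)
  have "emeasure (lborel \<Otimes>\<^sub>M lborel) ({a..<a + \<eta>} \<times> ({b..<b + \<eta>} \<times> {c..<c + \<eta>}))
     = emeasure lborel {a..<a + \<eta>} * emeasure lborel ({b..<b + \<eta>} \<times> {c..<c + \<eta>})"
    by (intro lborel.emeasure_pair_measure_Times) (auto intro!: borel_Times)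
  then show ?thesis
    using assms unfolding 1 lborel_prod by (simp add: ennreal_mult[symmetric] power3_eq_cube mult_ac)
qed

lemma wt_ge:
  assumes "\<tau> * M \<le> 1/4" "0 \<le> \<tau>" "\<bar>fst p\<bar> \<le> M" "\<bar>fst (snd p)\<bar> \<le> M" "\<bar>snd (snd p)\<bar> \<le> M"
  shows "1/8 \<le> wt \<tau> p"
proof -
  have "1/2 \<le> fejer (\<tau> * x)" if "\<bar>x\<bar> \<le> M" for x
  proof (rule fejer_ge_half)
    show "\<bar>\<tau> * x\<bar> \<le> 1/4"
      using mult_left_mono[OF that assms(2)] assms(1,2) by (simp add: abs_mult)
  qed
  then have "1/2 * (1/2 * (1/2)) \<le> wt \<tau> p"
    unfolding wt_def using assms by (intro mult_mono) auto
  then show ?thesis by simp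
qed

text \<open>Chebyshev's inequality on a grid of half-open cubes of side \<eta>: a cube that meets
  \<open>P\<close> has \<bar>f\<bar> at least t / 2 throughout and contains few points of
  \<open>P\<close>. The maximum of \<eta> and \<delta> enters because the spacing says nothing below
  scale \<delta>.\<close>

lemma count_large_values:
  assumes P: "finite P" "\<And>p. p \<in> P \<Longrightarrow> \<bar>fst p\<bar> \<le> Y \<and> \<bar>fst (snd p)\<bar> \<le> Y \<and> \<bar>snd (snd p)\<bar> \<le> Y"
    and \<tau>: "0 < \<tau>" "\<tau> * (Y + 1) \<le> 1/4" and f: "bc f" and \<eta>: "0 < \<eta>" "\<eta> \<le> 1" and t: "0 < t" and \<delta>: "0 < \<delta>" and Q: "0 \<le> Q"
    and large: "\<And>p p'. p \<in> P \<Longrightarrow> p' \<in> qb p \<eta> \<Longrightarrow> t / 2 \<le> norm (f p')"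
    and spacing: "\<And>a \<rho>. \<delta> \<le> \<rho> \<Longrightarrow> real (card (P \<inter> qb a \<rho>)) \<le> Q * (\<rho> / \<delta>)\<^sup>2"
  shows "real (card P) * (\<eta> ^ 3 * (t / 2) ^ 4 / 8) \<le> Q * (max \<eta> \<delta> / \<delta>)\<^sup>2 * wint \<tau> (\<lambda>p. norm (f p) ^ 4)"
proof -
  define cl where "cl = (\<lambda>p::pt. (\<lfloor>fst p / \<eta>\<rfloor>, \<lfloor>fst (snd p) / \<eta>\<rfloor>, \<lfloor>snd (snd p) / \<eta>\<rfloor>))"
  define bx where "bx = (\<lambda>(a::int, b::int, c::int). {of_int a * \<eta>..<of_int a * \<eta> + \<eta>} \<times> ({of_int b * \<eta>..<of_int b * \<eta> + \<eta>} \<times> {of_int c * \<eta>..<of_int c * \<eta> + \<eta>}))"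
  have fl: "\<lfloor>x / \<eta>\<rfloor> = i \<longleftrightarrow> of_int i * \<eta> \<le> x \<and> x < of_int i * \<eta> + \<eta>" for x i
    using \<eta>(1) by (simp add: floor_eq_iff pos_le_divide_eq pos_divide_less_eq distrib_right)
  have bx_iff: "p \<in> bx c \<longleftrightarrow> cl p = c" for p c
    by (cases c; cases p) (auto simp: bx_def cl_def fl)
  have close: "p' \<in> qb p \<eta>" if "cl p = cl p'" for p p'
  proof -
    have "\<bar>x' - x\<bar> \<le> \<eta>" if "\<lfloor>x / \<eta>\<rfloor> = \<lfloor>x' / \<eta>\<rfloor>" for x x'
      using that fl[of x "\<lfloor>x / \<eta>\<rfloor>"] fl[of x' "\<lfloor>x / \<eta>\<rfloor>"] by (simp add: abs_le_iff)
    then show ?thesis using that by (auto simp: cl_def qb_def)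
  qed
  let ?C = "cl ` P"
  have finC: "finite ?C" using P by simp
  let ?q = "Q * (max \<eta> \<delta> / \<delta>)\<^sup>2"
  have "card P = (\<Sum>c\<in>?C. card {p\<in>P. cl p = c})"
    using sum.group[OF P(1) finC, of cl "\<lambda>_. 1::nat"] by simp
  then have "real (card P) = (\<Sum>c\<in>?C. real (card {p\<in>P. cl p = c}))" by simp
  also have "\<dots> \<le> (\<Sum>c\<in>?C. ?q)"
  proof (rule sum_mono)
    fix c assume "c \<in> ?C"
    then obtain p where p: "p \<in> P" "cl p = c" by auto
    have "{x\<in>P. cl x = c} \<subseteq> P \<inter> qb p (max \<eta> \<delta>)"
    proof
      fix x assume x: "x \<in> {x\<in>P. cl x = c}"
      then have "x \<in> qb p \<eta>" using close[of p x] p(2) by simp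
      then show "x \<in> P \<inter> qb p (max \<eta> \<delta>)" using x by (auto simp: qb_def le_max_iff_disj)
    qed
    then have "card {x\<in>P. cl x = c} \<le> card (P \<inter> qb p (max \<eta> \<delta>))"
      using P(1) by (intro card_mono) auto
    then show "real (card {x\<in>P. cl x = c}) \<le> ?q" using spacing[of "max \<eta> \<delta>" p] by simp
  qed
  also have "\<dots> = real (card ?C) * ?q" by simp
  finally have cP: "real (card P) \<le> real (card ?C) * ?q" .
  have meas: "bx c \<in> sets lborel" for c
  proof (cases c)
    case (fields a b d)
    show ?thesis
      unfolding fields bx_def by (auto intro!: borel_Times)
  qed
  have em: "emeasure lborel (bx c) = ennreal (\<eta> ^ 3)" for c
    unfolding bx_def using \<eta>(1) by (cases c) (simp add: measure_lborel_cube)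
  have int1: "integrable lborel (indicator (bx c) :: pt \<Rightarrow> real)" for c
    using meas em[of c] by (simp add: integrable_indicator_iff)
  have "real (card ?C) * (\<eta> ^ 3 * (t / 2) ^ 4 / 8) = (\<integral>p. (\<Sum>c\<in>?C. indicator (bx c) p * ((t / 2) ^ 4 / 8)) \<partial>lborel)"
    using em int1 meas \<eta>(1) by (simp add: Bochner_Integration.integral_sum measure_def)
  also have "\<dots> \<le> wint \<tau> (\<lambda>p. norm (f p) ^ 4)"
    unfolding wint_def
  proof (rule integral_mono)
    show "integrable lborel (\<lambda>p. \<Sum>c\<in>?C. indicator (bx c) p * ((t / 2) ^ 4 / 8))"
      by (intro Bochner_Integration.integrable_sum integrable_mult_left int1)
    show "integrable lborel (\<lambda>p. norm (f p) ^ 4 * wt \<tau> p)"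
      by (rule integrable_norm_power_wt[OF \<tau>(1) f])
    fix p :: pt
    have "(\<Sum>c\<in>?C. indicator (bx c) p * ((t / 2) ^ 4 / 8)) = (\<Sum>c\<in>?C. if c = cl p then (t / 2) ^ 4 / 8 else 0)"
      by (intro sum.cong refl) (auto simp: indicator_def bx_iff)
    also have "\<dots> = (if cl p \<in> ?C then (t / 2) ^ 4 / 8 else 0)"
      using finC by simp
    also have "\<dots> \<le> norm (f p) ^ 4 * wt \<tau> p"
    proof (cases "cl p \<in> ?C")
      case True
      then obtain p0 where p0: "p0 \<in> P" "cl p0 = cl p" by auto
      have pq: "p \<in> qb p0 \<eta>" using close[OF p0(2)] .
      have "1/8 \<le> wt \<tau> p"
        using P(2)[OF p0(1)] pq \<eta>(2) \<tau> by (intro wt_ge[of \<tau> "Y + 1"]) (auto simp: qb_def)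
      moreover have "(t / 2) ^ 4 \<le> norm (f p) ^ 4"
        using large[OF p0(1) pq] t by (intro power_mono) auto
      ultimately have "(t / 2) ^ 4 * (1/8) \<le> norm (f p) ^ 4 * wt \<tau> p"
        by (intro mult_mono) auto
      then show ?thesis using True by simp
    qed simp
    finally show "(\<Sum>c\<in>?C. indicator (bx c) p * ((t / 2) ^ 4 / 8)) \<le> norm (f p) ^ 4 * wt \<tau> p" .
  qed
  finally have cC: "real (card ?C) * (\<eta> ^ 3 * (t / 2) ^ 4 / 8) \<le> wint \<tau> (\<lambda>p. norm (f p) ^ 4)" .
  have "real (card P) * (\<eta> ^ 3 * (t / 2) ^ 4 / 8) \<le> real (card ?C) * ?q * (\<eta> ^ 3 * (t / 2) ^ 4 / 8)"
    using cP \<eta> by (intro mult_right_mono) auto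
  also have "\<dots> = ?q * (real (card ?C) * (\<eta> ^ 3 * (t / 2) ^ 4 / 8))"
    by (simp only: mult_ac)
  also have "\<dots> \<le> ?q * wint \<tau> (\<lambda>p. norm (f p) ^ 4)"
    using cC Q by (intro mult_left_mono) auto
  finally show ?thesis .
qed

section \<open>Decomposition into frequency windows\<close>

text \<open>Both sinc factors of the kernel are expanded by \<open>snc_mult_nat\<close>. On the
  frequency side a wide triangle becomes a positive combination of narrow ones.\<close>

lemma kf_refine:
  assumes "K > 0"
  shows "of_nat K * kf v (real K * h) z = (\<Sum>j<K. \<Sum>i<K. kf (v + 2 * (real j + real i + 1 - real K) * h) h z) / of_nat K"
proof -
  let ?S = "\<Sum>j<K. cis ((2 * real j + 1 - real K) * (h * z))"
  have s: "complex_of_real (snc (real K * h * z)) = ?S * of_real (snc (h * z)) / of_nat K"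
    using snc_mult_nat[OF assms, of "h * z"] by (simp add: mult.assoc)
  have "of_nat K * kf v (real K * h) z = of_nat K * (cis (v * z) * (?S * of_real (snc (h * z)) / of_nat K) * (?S * of_real (snc (h * z)) / of_nat K))"
    unfolding kf_def fejer_def power2_eq_square of_real_mult s by (simp only: mult.assoc)
  also have "\<dots> = cis (v * z) * (?S * ?S) * (of_real (snc (h * z)) * of_real (snc (h * z))) / of_nat K"
    using assms by (simp add: field_simps)
  also have "\<dots> = (\<Sum>j<K. \<Sum>i<K. kf (v + 2 * (real j + real i + 1 - real K) * h) h z) / of_nat K"
  proof -
    have "cis (v * z) * (cis ((2 * real j + 1 - real K) * (h * z)) * cis ((2 * real i + 1 - real K) * (h * z)))
        = cis ((v + 2 * (real j + real i + 1 - real K) * h) * z)" for i j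
      by (simp add: cis_mult) (rule arg_cong[where f=cis], simp add: algebra_simps)
    then have "cis (v * z) * (?S * ?S) = (\<Sum>j<K. \<Sum>i<K. cis ((v + 2 * (real j + real i + 1 - real K) * h) * z))"
      by (simp only: sum_product) (simp only: sum_distrib_left)
    then show ?thesis
      unfolding kf_def fejer_def power2_eq_square of_real_mult by (simp only: sum_distrib_right)
  qed
  finally show ?thesis .
qed

text \<open>Window number i at level e. The spectrum has half width 2 K^e and the centres are 2 K^e
  apart, so neighbours overlap by half; the factor K^e gives the envelopes of all levels the same
  integral.\<close>

definition wn :: "nat \<Rightarrow> nat \<Rightarrow> int \<Rightarrow> real \<Rightarrow> complex" where
  "wn K e i z = of_nat (K ^ e) * kf (2 * of_int i * real (K ^ e)) (real (K ^ e)) z"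

lemma wn_refine:
  assumes "K > 0"
  shows "wn K (Suc e) i z = (\<Sum>j<K. \<Sum>l<K. wn K e (i * int K + int j + int l + 1 - int K) z) / of_nat K"
proof -
  let ?h = "real (K ^ e)"
  have "wn K (Suc e) i z = of_nat (K ^ e) * (of_nat K * kf (2 * of_int i * real (K ^ Suc e)) (real K * ?h) z)"
    by (simp add: wn_def mult_ac)
  also have "\<dots> = of_nat (K ^ e) * ((\<Sum>j<K. \<Sum>l<K. kf (2 * of_int i * real (K ^ Suc e) + 2 * (real j + real l + 1 - real K) * ?h) ?h z) / of_nat K)"
    by (simp only: kf_refine[OF assms])
  also have "\<dots> = (\<Sum>j<K. \<Sum>l<K. of_nat (K ^ e) * kf (2 * of_int i * real (K ^ Suc e) + 2 * (real j + real l + 1 - real K) * ?h) ?h z) / of_nat K"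
    by (simp add: sum_distrib_left)
  also have "\<dots> = (\<Sum>j<K. \<Sum>l<K. wn K e (i * int K + int j + int l + 1 - int K) z) / of_nat K"
  proof -
    have "2 * of_int i * real (K ^ Suc e) + 2 * (real j + real l + 1 - real K) * ?h
        = 2 * of_int (i * int K + int j + int l + 1 - int K) * ?h" for j l
      by (simp add: algebra_simps)
    then show ?thesis by (simp only: wn_def)
  qed
  finally show ?thesis .
qed

text \<open>A family of windows near the origin is rewritten one level down. The coefficients do not
  grow, since the overlapping triangles behave like a partition of unity.\<close>

lemma wn_level:
  fixes c :: "int \<Rightarrow> real"
  assumes K: "K > 0" and c: "\<And>i. 0 \<le> c i \<and> c i \<le> 1"
  obtains c' :: "int \<Rightarrow> real" where "\<And>i. 0 \<le> c' i \<and> c' i \<le> 1"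
    "\<And>z. (\<Sum>i\<in>{i. \<bar>i\<bar> < int K}. of_real (c i) * wn K (Suc e) i z) = (\<Sum>m\<in>{m. \<bar>m\<bar> < int K ^ 2}. of_real (c' m) * wn K e m z)"
proof -
  define T where "T = {i. \<bar>i\<bar> < int K} \<times> ({..<K} \<times> {..<K})"
  define \<phi> where "\<phi> = (\<lambda>(i, j, l). i * int K + int j + int l + 1 - int K)"
  define M where "M = {m. \<bar>m\<bar> < int K ^ 2}"
  have fi: "finite {i::int. \<bar>i\<bar> < n}" for n
    by (rule finite_subset[of _ "{-n..n}"]) auto
  have finT: "finite T" and finM: "finite M" using fi by (auto simp: T_def M_def)
  have img: "\<phi> ` T \<subseteq> M"
  proof
    fix m assume "m \<in> \<phi> ` T"
    then obtain i j l where ijl: "\<bar>i\<bar> < int K" "j < K" "l < K" "m = i * int K + int j + int l + 1 - int K"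
      by (auto simp: T_def \<phi>_def)
    have "\<bar>i * int K\<bar> \<le> (int K - 1) * int K" using ijl by (simp add: abs_mult mult_right_mono)
    then show "m \<in> M" using ijl(2-) by (auto simp: M_def power2_eq_square left_diff_distrib)
  qed
  define c' where "c' = (\<lambda>m. (\<Sum>x\<in>{x. x \<in> T \<and> \<phi> x = m}. c (fst x)) / real K)"
  have c'1: "0 \<le> c' m \<and> c' m \<le> 1" for m
  proof
    let ?A = "{x. x \<in> T \<and> \<phi> x = m}"
    show "0 \<le> c' m" unfolding c'_def using c by (intro divide_nonneg_nonneg sum_nonneg) auto
    \<comment> \<open>For a given target m the index j determines i K + l, hence i and l. So at most
      K triples contribute, which cancels the division by K.\<close>
    have "inj_on (\<lambda>x. fst (snd x)) ?A"
    proof (rule inj_onI)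
      fix x y assume xy: "x \<in> ?A" "y \<in> ?A" "fst (snd x) = fst (snd y)"
      obtain i j l i' j' l' where e: "x = (i, j, l)" "y = (i', j', l')" by (cases x; cases y)
      have "i * int K + int l = i' * int K + int l'" "l < K" "l' < K" using xy by (auto simp: e T_def \<phi>_def)
      then have "(i * int K + int l) div int K = (i' * int K + int l') div int K" by simp
      then have "i = i'" using \<open>l < K\<close> \<open>l' < K\<close> K by simp
      then show "x = y" using xy \<open>i * int K + int l = i' * int K + int l'\<close> by (simp add: e)
    qed
    moreover have "(\<lambda>x. fst (snd x)) ` ?A \<subseteq> {..<K}" by (auto simp: T_def)
    ultimately have "card ?A \<le> card {..<K}" by (rule card_inj_on_le) simp
    then have "real (card ?A) \<le> real K" by simp
    moreover have "(\<Sum>x\<in>?A. c (fst x)) \<le> (\<Sum>x\<in>?A. 1)" using c by (intro sum_mono) auto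
    ultimately show "c' m \<le> 1" unfolding c'_def using K by simp
  qed
  have eq: "(\<Sum>i\<in>{i. \<bar>i\<bar> < int K}. of_real (c i) * wn K (Suc e) i z) = (\<Sum>m\<in>M. of_real (c' m) * wn K e m z)" for z
  proof -
    have "(\<Sum>i\<in>{i. \<bar>i\<bar> < int K}. of_real (c i) * wn K (Suc e) i z)
       = (\<Sum>i\<in>{i. \<bar>i\<bar> < int K}. \<Sum>j<K. \<Sum>l<K. of_real (c i) * wn K e (\<phi> (i, j, l)) z / of_nat K)"
      by (simp add: wn_refine[OF K] \<phi>_def sum_distrib_left sum_divide_distrib)
    also have "\<dots> = (\<Sum>x\<in>T. of_real (c (fst x)) * wn K e (\<phi> x) z / of_nat K)"
      unfolding T_def by (simp add: sum.cartesian_product case_prod_beta)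
    also have "\<dots> = (\<Sum>m\<in>M. \<Sum>x\<in>{x. x \<in> T \<and> \<phi> x = m}. of_real (c (fst x)) * wn K e (\<phi> x) z / of_nat K)"
      by (rule sum.group[OF finT finM img, symmetric])
    also have "\<dots> = (\<Sum>m\<in>M. of_real (c' m) * wn K e m z)"
    proof (rule sum.cong[OF refl])
      fix m
      have "(\<Sum>x\<in>{x. x \<in> T \<and> \<phi> x = m}. of_real (c (fst x)) * wn K e (\<phi> x) z / of_nat K)
         = (\<Sum>x\<in>{x. x \<in> T \<and> \<phi> x = m}. of_real (c (fst x)) * (wn K e m z / of_nat K))"
        by (intro sum.cong refl) auto
      also have "\<dots> = of_real (c' m) * wn K e m z"
        by (simp only: sum_distrib_right[symmetric]) (simp add: c'_def)
      finally show "(\<Sum>x\<in>{x. x \<in> T \<and> \<phi> x = m}. of_real (c (fst x)) * wn K e (\<phi> x) z / of_nat K) = of_real (c' m) * wn K e m z" .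
    qed
    finally show ?thesis .
  qed
  show ?thesis by (rule that[of c']) (use c'1 eq in \<open>auto simp: M_def\<close>)
qed

text \<open>Frequency windows whose width is at most \<open>1 / K\<close> times their distance from the origin,
  except for the bounded frequencies at level \<open>0\<close>.\<close>
definition Om :: "nat \<Rightarrow> nat \<Rightarrow> (nat \<times> int) set" where
  "Om K n = {(e, i). e \<le> n \<and> \<bar>i\<bar> < int K ^ 2 \<and> (e = 0 \<or> int K \<le> \<bar>i\<bar>)}"

lemma Om_bounds:
  shows "finite (Om K n)" "real (card (Om K n)) \<le> 3 * (real n + 1) * (real K ^ 2 + 1)"
proof -
  have sub: "Om K n \<subseteq> {..n} \<times> {- (int K ^ 2)..(int K ^ 2)}" by (auto simp: Om_def)
  show "finite (Om K n)" by (rule finite_subset[OF sub]) simp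
  have "card (Om K n) \<le> card ({..n} \<times> {- (int K ^ 2)..(int K ^ 2)})" by (rule card_mono[OF _ sub]) simp
  also have "\<dots> = (n + 1) * nat (2 * int K ^ 2 + 1)" by (simp add: card_cartesian_product)
  finally have "real (card (Om K n)) \<le> real ((n + 1) * nat (2 * int K ^ 2 + 1))"
    by (simp only: of_nat_le_iff)
  also have "\<dots> = (real n + 1) * real (nat (2 * int K ^ 2 + 1))"
    by (simp only: of_nat_mult of_nat_add of_nat_1)
  also have "real (nat (2 * int K ^ 2 + 1)) = 2 * real K ^ 2 + 1"
    by (simp add: nat_add_distrib nat_mult_distrib nat_power_eq)
  also have "(real n + 1) * (2 * real K ^ 2 + 1) \<le> (real n + 1) * (3 * (real K ^ 2 + 1))"
    by (intro mult_left_mono) auto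
  also have "\<dots> = 3 * (real n + 1) * (real K ^ 2 + 1)" by (simp only: mult_ac)
  finally show "real (card (Om K n)) \<le> 3 * (real n + 1) * (real K ^ 2 + 1)" .
qed

text \<open>After one refinement the windows with \<bar>m\<bar> at least K are narrow compared with
  their distance from 0 and are final; those with \<bar>m\<bar> below K again form a central family,
  one level lower. Each level adds at most 1 to a coefficient.\<close>

lemma window_decomposition_aux:
  fixes c :: "int \<Rightarrow> real"
  assumes K: "K > 1" and c: "\<And>i. 0 \<le> c i \<and> c i \<le> 1"
  shows "\<exists>d :: nat \<times> int \<Rightarrow> real. (\<forall>w. 0 \<le> d w \<and> d w \<le> real e + 1) \<and>
    (\<forall>z. (\<Sum>i\<in>{i. \<bar>i\<bar> < int K}. of_real (c i) * wn K e i z) = (\<Sum>w\<in>Om K e. of_real (d w) * wn K (fst w) (snd w) z))"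
  using c
proof (induction e arbitrary: c)
  case 0
  let ?d = "\<lambda>w::nat \<times> int. if fst w = 0 \<and> \<bar>snd w\<bar> < int K then c (snd w) else 0"
  have "int K * 1 < int K * int K" using K by (intro mult_strict_left_mono) auto
  then have KK: "\<bar>x\<bar> < int K \<Longrightarrow> \<bar>x\<bar> < (int K)\<^sup>2" for x
    unfolding power2_eq_square by linarith
  have "(\<Sum>w\<in>Om K 0. of_real (?d w) * wn K (fst w) (snd w) z) = (\<Sum>i\<in>{i. \<bar>i\<bar> < int K}. of_real (c i) * wn K 0 i z)" for z
  proof -
    have "(\<Sum>w\<in>Om K 0. of_real (?d w) * wn K (fst w) (snd w) z) = (\<Sum>w\<in>Pair 0 ` {i. \<bar>i\<bar> < int K}. of_real (?d w) * wn K (fst w) (snd w) z)"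
      using KK by (intro sum.mono_neutral_right Om_bounds) (auto simp: Om_def image_iff)
    also have "\<dots> = (\<Sum>i\<in>{i. \<bar>i\<bar> < int K}. of_real (c i) * wn K 0 i z)"
      by (subst sum.reindex) (auto simp: inj_on_def)
    finally show ?thesis .
  qed
  then show ?case using 0 by (intro exI[of _ ?d]) auto
next
  case (Suc e)
  have K0: "K > 0" using K by simp
  obtain c' where c': "\<And>i. 0 \<le> c' i \<and> c' i \<le> 1"
    and eq: "\<And>z. (\<Sum>i\<in>{i. \<bar>i\<bar> < int K}. of_real (c i) * wn K (Suc e) i z) = (\<Sum>m\<in>{m. \<bar>m\<bar> < int K ^ 2}. of_real (c' m) * wn K e m z)"
  proof (rule wn_level[where c=c and e=e, OF K0 Suc.prems])
    fix c' :: "int \<Rightarrow> real"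
    assume a: "\<And>i. 0 \<le> c' i \<and> c' i \<le> 1"
      "\<And>z. (\<Sum>i\<in>{i. \<bar>i\<bar> < int K}. of_real (c i) * wn K (Suc e) i z) = (\<Sum>m\<in>{m. \<bar>m\<bar> < int K ^ 2}. of_real (c' m) * wn K e m z)"
    show thesis by (rule that[OF a])
  qed
  obtain d where d: "\<forall>w. 0 \<le> d w \<and> d w \<le> real e + 1"
    and deq: "\<forall>z. (\<Sum>i\<in>{i. \<bar>i\<bar> < int K}. of_real (c' i) * wn K e i z) = (\<Sum>w\<in>Om K e. of_real (d w) * wn K (fst w) (snd w) z)"
    using Suc.IH[of c'] c' by blast
  let ?H = "{m. int K \<le> \<bar>m\<bar> \<and> \<bar>m\<bar> < int K ^ 2}"
  let ?d1 = "\<lambda>w. if fst w \<le> e then d w else 0"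
  let ?d2 = "\<lambda>w::nat \<times> int. if fst w = e \<and> int K \<le> \<bar>snd w\<bar> then c' (snd w) else 0"
  have "int K * 1 < int K * int K" using K by (intro mult_strict_left_mono) auto
  then have KK: "\<bar>x\<bar> < int K \<Longrightarrow> \<bar>x\<bar> < (int K)\<^sup>2" for x
    unfolding power2_eq_square by linarith
  have finH: "finite {m::int. \<bar>m\<bar> < n}" for n by (rule finite_subset[of _ "{-n..n}"]) auto
  have "(\<Sum>i\<in>{i. \<bar>i\<bar> < int K}. of_real (c i) * wn K (Suc e) i z) = (\<Sum>w\<in>Om K (Suc e). of_real (?d1 w + ?d2 w) * wn K (fst w) (snd w) z)" for z
  proof -
    have split: "{m. \<bar>m\<bar> < int K ^ 2} = {m. \<bar>m\<bar> < int K} \<union> ?H" using KK by auto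
    have "(\<Sum>m\<in>{m. \<bar>m\<bar> < int K ^ 2}. of_real (c' m) * wn K e m z)
       = (\<Sum>m\<in>{m. \<bar>m\<bar> < int K}. of_real (c' m) * wn K e m z) + (\<Sum>m\<in>?H. of_real (c' m) * wn K e m z)"
      unfolding split using finH[of "int K"] finite_subset[OF _ finH[of "int K ^ 2"], of ?H] by (intro sum.union_disjoint) auto
    also have "(\<Sum>m\<in>?H. of_real (c' m) * wn K e m z) = (\<Sum>w\<in>Pair e ` ?H. of_real (?d2 w) * wn K (fst w) (snd w) z)"
      by (subst sum.reindex) (auto simp: inj_on_def)
    also have "\<dots> = (\<Sum>w\<in>Om K (Suc e). of_real (?d2 w) * wn K (fst w) (snd w) z)"
      by (intro sum.mono_neutral_left Om_bounds) (auto simp: Om_def image_iff)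
    also have "(\<Sum>m\<in>{m. \<bar>m\<bar> < int K}. of_real (c' m) * wn K e m z) = (\<Sum>w\<in>Om K e. of_real (?d1 w) * wn K (fst w) (snd w) z)"
      unfolding deq[rule_format] by (intro sum.cong refl) (auto simp: Om_def)
    also have "\<dots> = (\<Sum>w\<in>Om K (Suc e). of_real (?d1 w) * wn K (fst w) (snd w) z)"
      by (intro sum.mono_neutral_left Om_bounds) (auto simp: Om_def)
    finally show ?thesis
      unfolding eq by (simp only: of_real_add distrib_right sum.distrib)
  qed
  moreover have "0 \<le> ?d1 w + ?d2 w \<and> ?d1 w + ?d2 w \<le> real (Suc e) + 1" for w
    using d[rule_format, of w] c'[of "snd w"] by auto
  ultimately show ?case by (intro exI[of _ "\<lambda>w. ?d1 w + ?d2 w"]) blast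
qed

text \<open>The Fejer kernel of width K^n is the single central window of level n.\<close>

lemma window_decomposition:
  assumes K: "K > 1"
  obtains d :: "nat \<times> int \<Rightarrow> real" where "\<And>w. 0 \<le> d w \<and> d w \<le> real n + 1"
    "\<And>z. complex_of_real (real K ^ n * fejer (real K ^ n * z)) = (\<Sum>w\<in>Om K n. of_real (d w) * wn K (fst w) (snd w) z)"
proof -
  let ?c = "\<lambda>i::int. if i = 0 then 1 else 0 :: real"
  obtain d where d: "\<forall>w. 0 \<le> d w \<and> d w \<le> real n + 1"
    and eq: "\<forall>z. (\<Sum>i\<in>{i. \<bar>i\<bar> < int K}. of_real (?c i) * wn K n i z) = (\<Sum>w\<in>Om K n. of_real (d w) * wn K (fst w) (snd w) z)"
  proof -
    have "0 \<le> ?c i \<and> ?c i \<le> 1" for i by auto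
    then show ?thesis using window_decomposition_aux[OF K, where c="?c" and e=n] that by blast
  qed
  have fin: "finite {i::int. \<bar>i\<bar> < int K}" by (rule finite_subset[of _ "{- int K..int K}"]) auto
  have "(\<Sum>i\<in>{i. \<bar>i\<bar> < int K}. of_real (?c i) * wn K n i z) = (\<Sum>i\<in>{i. \<bar>i\<bar> < int K}. if i = 0 then wn K n 0 z else 0)" for z
    by (intro sum.cong refl) auto
  also have "(\<Sum>i\<in>{i. \<bar>i\<bar> < int K}. if i = 0 then wn K n 0 z else 0) = wn K n 0 z" for z
    using K fin by simp
  finally have "complex_of_real (real K ^ n * fejer (real K ^ n * z)) = (\<Sum>w\<in>Om K n. of_real (d w) * wn K (fst w) (snd w) z)" for z
    using eq by (simp add: wn_def kf_def)
  with d that show ?thesis by blast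
qed

section \<open>The discretised estimate\<close>

text \<open>Lines are points (B, C, W) of \<open>P\<close>, and a triple (j, m, l) of
  \<open>E\<close> is a cube at y = j \<delta>, x = m \<delta>, t = l \<delta>. \<open>rich\<close>
  asks that a line pass within Q \<delta> of cubes in at least lam / \<delta> slices.
  \<open>k_le\<close> and \<open>k_ge\<close> fix k^(2 (n + 2)) as comparable to 1 / \<delta>; the
  factor 2 in \<open>k_ge\<close> allows for \<open>k\<close> being an integer.\<close>

locale discrete_kakeya =
  fixes \<delta> Q lam :: real and k n :: nat and P :: "pt set" and E :: "(int \<times> int \<times> int) set"
  assumes Q: "1 \<le> Q" and \<delta>: "0 < \<delta>" "\<delta> \<le> 1/8" and k: "8 \<le> k" and lam: "0 < lam"
    and k_le: "8 * Q\<^sup>2 * \<delta> * real k ^ (2 * (n + 2)) \<le> 1"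
    and k_ge: "1 \<le> 8 * Q\<^sup>2 * \<delta> * (2 * real k) ^ (2 * (n + 2))"
    and P: "finite P" "\<And>p. p \<in> P \<Longrightarrow> \<bar>fst p\<bar> \<le> Q \<and> \<bar>fst (snd p)\<bar> \<le> Q \<and> \<bar>snd (snd p)\<bar> \<le> Q"
    and E: "finite E" "\<And>x. x \<in> E \<Longrightarrow> \<bar>of_int (fst x) * \<delta>\<bar> \<le> Q"
    and rich: "\<And>p. p \<in> P \<Longrightarrow> lam / \<delta> \<le> real (card {j. \<exists>m l. (j, m, l) \<in> E \<and>
        \<bar>snd (snd p) + fst (snd p) * (of_int j * \<delta>) - of_int m * \<delta>\<bar> \<le> Q * \<delta> \<and>
        \<bar>snd (snd p) * (of_int j * \<delta>) - fst p - of_int l * \<delta>\<bar> \<le> Q * \<delta>})"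
    and spacing: "\<And>a \<rho>. \<delta> \<le> \<rho> \<Longrightarrow> real (card (P \<inter> qb a \<rho>)) \<le> Q * (\<rho> / \<delta>)\<^sup>2"
begin

text \<open>The decoupling step with angular ratio \<open>k\<close> needs windows of relative width
  1 / \<open>k\<^sup>2\<close>, hence the square.\<close>

definition K :: nat where "K = k\<^sup>2"
definition J :: "int set" where "J = fst ` E"
definition S :: "int \<Rightarrow> (int \<times> int) set" where "S j = {c. (j, c) \<in> E}"
definition Y :: real where "Y = Q + 1"
text \<open>Makes \<tau> (Y + 1) equal to 1/4, so that the weight is at least 1/8 on the unit
  neighbourhood of \<open>P\<close>.\<close>

definition \<tau> :: real where "\<tau> = 1 / (4 * (Q + 2))"
definition fr :: "nat \<times> int \<Rightarrow> real" where "fr w = 2 * of_int (snd w) * real (K ^ fst w)"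
definition wd :: "nat \<times> int \<Rightarrow> real" where "wd w = real (K ^ fst w)"
definition F :: "nat \<times> int \<Rightarrow> nat \<times> int \<Rightarrow> int \<Rightarrow> pt \<Rightarrow> complex" where
  "F w w' j = layer \<delta> (fr w) (wd w) (fr w') (wd w') (of_int j * \<delta>) (S j)"
definition tot :: "nat \<times> int \<Rightarrow> nat \<times> int \<Rightarrow> pt \<Rightarrow> complex" where
  "tot w w' p = (\<Sum>j\<in>J. F w w' j p)"
text \<open>Lipschitz constant of \<open>tot\<close>, per unit of frequency: 40000 from
  \<open>layer_lipschitz\<close>, 4 \<open>Y\<^sup>2\<close> from \<open>inner_th_diff_le\<close>,
  and 3 Q from the number of slices.\<close>

definition A :: real where "A = 480000 * Q * Y\<^sup>2"
definition Cp :: real where "Cp = 21600 * Y ^ 5 * 1600 ^ 3 * (2197 / \<tau>) * 578 ^ (n + 3)"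

lemma finite_J: "finite J" using E by (simp add: J_def)
lemma finite_S: "finite (S j)"
proof -
  have "S j \<subseteq> snd ` E" by (force simp: S_def)
  then show ?thesis using E(1) finite_subset by blast
qed

lemma J_bound: "j \<in> J \<Longrightarrow> \<bar>of_int j * \<delta>\<bar> \<le> Q"
  using E(2) by (auto simp: J_def)

lemma card_E: "real (card E) = (\<Sum>j\<in>J. real (card (S j)))"
proof -
  have "card E = (\<Sum>j\<in>J. card {x. x \<in> E \<and> fst x = j})"
    using sum.group[OF E(1) finite_J, of fst "\<lambda>_. 1::nat"] by (simp add: J_def)
  moreover have "card {x. x \<in> E \<and> fst x = j} = card (S j)" for j
  proof -
    have "{x. x \<in> E \<and> fst x = j} = Pair j ` S j" by (auto simp: S_def)
    then show ?thesis by (simp add: card_image inj_on_def)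
  qed
  ultimately show ?thesis by simp
qed

lemma constants: "1 \<le> Y" "0 < \<tau>" "\<tau> \<le> 1/2" "\<tau> * (Y + 1) \<le> 1/4" "0 < A" "0 \<le> Cp"
  using Q by (auto simp: Y_def \<tau>_def A_def Cp_def divide_simps)

lemma card_J: "real (card J) \<le> 3 * Q / \<delta>"
proof -
  have "- Q / \<delta> \<le> of_int j \<and> of_int j \<le> Q / \<delta>" if "j \<in> J" for j
  proof -
    have "- Q \<le> of_int j * \<delta>" "of_int j * \<delta> \<le> Q" using J_bound[OF that] by (auto simp: abs_le_iff)
    then show ?thesis using \<delta>(1) by (simp only: pos_le_divide_eq pos_divide_le_eq)
  qed
  from card_int_interval_le(2)[of J, OF this] have "real (card J) \<le> Q / \<delta> - (- Q / \<delta>) + 1"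
    using Q \<delta> by (simp add: divide_right_mono)
  also have "\<dots> = 2 * (Q / \<delta>) + 1" by simp
  also have "1 \<le> Q / \<delta>" using Q \<delta> by (simp add: pos_le_divide_eq)
  finally show ?thesis by simp
qed

lemma kpow: "real k ^ (2 * (n + 2)) * \<delta> \<le> 1/8"
proof -
  have "1 * (real k ^ (2 * (n + 2)) * \<delta>) \<le> Q\<^sup>2 * (real k ^ (2 * (n + 2)) * \<delta>)"
    using Q \<delta> by (intro mult_right_mono) auto
  then show ?thesis using k_le by (simp add: mult_ac)
qed

lemma window_facts:
  assumes "w \<in> Om K n"
  shows "1 \<le> wd w" "2 * wd w * (real k)\<^sup>2 \<le> \<bar>fr w\<bar> \<or> \<bar>fr w\<bar> + 2 * wd w \<le> 4 * (real k)\<^sup>2"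
    "\<bar>fr w\<bar> + 2 * wd w \<le> 1 / (4 * \<delta>)" "wd w * \<delta> \<le> 1" "\<bar>fr w\<bar> \<le> real k ^ (2 * (n + 3))"
proof -
  obtain e i where w: "w = (e, i)" "e \<le> n" "\<bar>i\<bar> < int K ^ 2" "e = 0 \<or> int K \<le> \<bar>i\<bar>"
    using assms by (auto simp: Om_def)
  have K1: "1 \<le> K" using k by (simp add: K_def)
  have wd: "wd w = real K ^ e" by (simp add: wd_def w)
  have fr: "\<bar>fr w\<bar> = 2 * real_of_int \<bar>i\<bar> * real K ^ e" by (simp add: fr_def w abs_mult)
  show 1: "1 \<le> wd w" unfolding wd using K1 by simp
  have Kr: "real K = (real k)\<^sup>2" by (simp add: K_def)
  have ile: "real_of_int \<bar>i\<bar> + 1 \<le> real K ^ 2"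
  proof -
    have "\<bar>i\<bar> + 1 \<le> int K ^ 2" using w(3) by simp
    then have "real_of_int (\<bar>i\<bar> + 1) \<le> real_of_int (int K ^ 2)" by (simp only: of_int_le_iff)
    then show ?thesis by simp
  qed
  have Kn: "real K ^ 2 * real K ^ n = real k ^ (2 * (n + 2))"
    unfolding Kr power_mult[symmetric] power_add[symmetric]
    by (rule arg_cong[where f="power (real k)"]) simp
  have "\<bar>fr w\<bar> + 2 * wd w = 2 * ((real_of_int \<bar>i\<bar> + 1) * real K ^ e)" by (simp add: fr wd algebra_simps)
  also have "\<dots> \<le> 2 * (real K ^ 2 * real K ^ n)"
    using ile w(2) K1 by (intro mult_left_mono mult_mono power_increasing) auto
  finally have b: "\<bar>fr w\<bar> + 2 * wd w \<le> 2 * real k ^ (2 * (n + 2))" by (simp only: Kn)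
  also have "\<dots> \<le> 1 / (4 * \<delta>)" using kpow \<delta> by (simp add: field_simps)
  finally show 3: "\<bar>fr w\<bar> + 2 * wd w \<le> 1 / (4 * \<delta>)" .
  have "2 * wd w \<le> 1 / (4 * \<delta>)" using 3 by linarith
  then show "wd w * \<delta> \<le> 1" using \<delta> by (simp add: field_simps)
  have "\<bar>fr w\<bar> \<le> 2 * real k ^ (2 * (n + 2))" using b 1 by linarith
  also have "\<dots> \<le> (real k)\<^sup>2 * real k ^ (2 * (n + 2))"
    using power_mono[of 8 "real k" 2] k by (intro mult_right_mono) auto
  also have "\<dots> = real k ^ (2 * (n + 3))"
    unfolding power_add[symmetric] by (rule arg_cong[where f="power (real k)"]) simp
  finally show "\<bar>fr w\<bar> \<le> real k ^ (2 * (n + 3))" .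
  show "2 * wd w * (real k)\<^sup>2 \<le> \<bar>fr w\<bar> \<or> \<bar>fr w\<bar> + 2 * wd w \<le> 4 * (real k)\<^sup>2"
  proof (cases "int K \<le> \<bar>i\<bar>")
    case True
    then have "real_of_int (int K) \<le> real_of_int \<bar>i\<bar>" by (simp only: of_int_le_iff)
    then have "real K \<le> real_of_int \<bar>i\<bar>" by simp
    then have "real K * real K ^ e \<le> real_of_int \<bar>i\<bar> * real K ^ e" by (intro mult_right_mono) auto
    then show ?thesis by (simp add: fr wd Kr mult_ac)
  next
    case False
    then have "\<bar>i\<bar> + 1 \<le> int K" by simp
    then have "real_of_int (\<bar>i\<bar> + 1) \<le> real_of_int (int K)" by (simp only: of_int_le_iff)
    then have "real_of_int \<bar>i\<bar> + 1 \<le> real K" by simp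
    moreover have "e = 0" using False w(4) by simp
    ultimately show ?thesis by (simp add: fr wd Kr)
  qed
qed

text \<open>All powers of the frequency X cancel: a cube on which the piece stays large has volume
  of order (t / X)^3, it holds O((X \<delta>)^(-2)) lines, and the fourth moment gains 1 / X. The
  exponent 7 is 4 from the fourth moment plus 3 from that volume.\<close>

lemma piece_count:
  assumes w: "w \<in> Om K n" "w' \<in> Om K n" and t: "0 < t"
  shows "real (card {p\<in>P. t \<le> norm (tot w w' p)}) * \<delta>\<^sup>2 * t ^ 7 \<le> 1024 * A ^ 3 * Q * Cp * (real k ^ 8 * (\<delta> ^ 3 * real (card E)))"
proof (cases "{p\<in>P. t \<le> norm (tot w w' p)} = {}")
  case True
  then show ?thesis
    using constants Q \<delta> by (simp only: card.empty) simp
next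
  case False
  let ?v = "fr w" and ?h = "wd w" and ?r = "fr w'" and ?g = "wd w'"
  let ?P = "{p\<in>P. t \<le> norm (tot w w' p)}"
  let ?e = "\<lambda>j. \<delta> ^ 3 * real (card (S j))"
  note f1 = window_facts[OF w(1)] and f2 = window_facts[OF w(2)]
  have pos: "0 < ?h" "0 < ?g" using f1(1) f2(1) by auto
  interpret packets \<delta> \<tau> Y k ?v ?h ?r ?g J "F w w'" ?e 1600 "2197 / \<tau>"
  proof (unfold_locales)
    show "spec (band ?v ?h ?r ?g (of_int j * \<delta>)) (F w w' j)" for j
      unfolding F_def using pos by (intro spec_layer) auto
    show "norm (F w w' j p) \<le> 1600 * \<delta>" for j p
      unfolding F_def using pos \<delta> f1(4) f2(4) finite_S by (intro norm_layer_le) auto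
    show "wint \<tau> (\<lambda>p. norm (F w w' j p)) \<le> 2197 / \<tau> * ?e j" for j
      unfolding F_def using wint_norm_layer_le[of \<tau> ?h ?g \<delta>] pos \<delta> constants by (simp add: mult_ac)
    show "\<bar>of_int j * \<delta>\<bar> \<le> Y - 1" if "j \<in> J" for j
      using J_bound[OF that] by (simp add: Y_def)
  qed (rule \<delta> constants(1-3) k finite_J divide_nonneg_nonneg less_imp_le[OF constants(2)]
      mult_nonneg_nonneg zero_le_power less_imp_le[OF \<delta>(1)] of_nat_0_le_iff | simp)+
  define X where "X = \<bar>?v\<bar> + 2 * ?h + \<bar>?r\<bar> + 2 * ?g"
  have X4: "4 \<le> X" using f1(1) f2(1) by (simp add: X_def)
  have X\<delta>: "X \<le> 1 / (2 * \<delta>)"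
  proof -
    have "X \<le> 1 / (4 * \<delta>) + 1 / (4 * \<delta>)" using f1(3) f2(3) unfolding X_def by linarith
    then show ?thesis by simp
  qed
  have tot: "tot w w' = FS J" by (simp add: tot_def FS_def fun_eq_iff)
  have big: "1 / (4 * \<delta>) \<le> 8 / \<delta>" using \<delta> by (simp add: field_simps)
  have "wint \<tau> (\<lambda>p. norm (FS J p) ^ 4) \<le> 21600 * Y ^ 5 * 1600 ^ 3 * (2197 / \<tau>) * 578 ^ (n + 3) * (real k ^ 8 * mass / X)"
    unfolding X_def
    by (rule wint_power4_le) (use pos f1 f2 big in \<open>auto intro: order_trans\<close>)
  also have "mass = \<delta> ^ 3 * real (card E)"
    unfolding mass_def card_E sum_distrib_left ..
  finally have wi: "wint \<tau> (\<lambda>p. norm (FS J p) ^ 4) \<le> Cp * (real k ^ 8 * (\<delta> ^ 3 * real (card E)) / X)"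
    by (simp add: Cp_def)
  \<comment> \<open>The largest displacement for which the Lipschitz constant A X guarantees a
    change of at most t / 2.\<close>
  define \<eta> where "\<eta> = t / (2 * A * X)"
  have \<eta>0: "0 < \<eta>" using t X4 constants by (simp add: \<eta>_def)
  \<comment> \<open>A value that is attained cannot exceed the trivial bound for \<open>tot\<close>.
    This keeps \<eta> below 1 / X, the range in which \<open>layer_lipschitz\<close>
    applies.\<close>
  have tle: "t \<le> 4800 * Q"
  proof -
    obtain p where "p \<in> ?P" using False by blast
    then have "t \<le> norm (FS J p)" by (simp add: tot)
    also have "\<dots> \<le> (\<Sum>j\<in>J. 1600 * \<delta>)" unfolding FS_def by (intro order_trans[OF norm_sum] sum_mono normF)
    also have "\<dots> = 1600 * (\<delta> * real (card J))" by simp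
    also have "\<dots> \<le> 1600 * (\<delta> * (3 * Q / \<delta>))" using card_J \<delta> by (intro mult_left_mono) auto
    finally show ?thesis using \<delta> by simp
  qed
  have X\<eta>: "X * (4 * Y\<^sup>2 * \<eta>) \<le> 1"
  proof -
    have "X * (4 * Y\<^sup>2 * \<eta>) = 2 * Y\<^sup>2 * t / A" using X4 by (simp add: \<eta>_def)
    also have "\<dots> \<le> 1" using tle Y_powers Q constants mult_left_mono[OF tle, of "2 * Y\<^sup>2"]
      by (simp add: A_def mult_ac)
    finally show ?thesis .
  qed
  have \<eta>X: "\<eta> \<le> 1 / X"
  proof -
    have "X * \<eta> * 1 \<le> X * \<eta> * (4 * Y\<^sup>2)" using X4 \<eta>0 Y_powers by (intro mult_left_mono) auto
    then have "X * \<eta> \<le> 1" using X\<eta> by (simp add: mult_ac)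
    then show ?thesis using X4 by (simp add: field_simps)
  qed
  have lip: "norm (FS J p - FS J p') \<le> t / 2" if "p' \<in> qb p \<eta>" for p p'
  proof -
    have "norm (FS J p - FS J p') \<le> (\<Sum>j\<in>J. 40000 * \<delta> * X * (4 * Y\<^sup>2 * \<eta>))"
      unfolding FS_def sum_subtractf[symmetric]
    proof (intro order_trans[OF norm_sum] sum_mono)
      fix j assume j: "j \<in> J"
      have yY: "\<bar>of_int j * \<delta>\<bar> \<le> Y" using J_bound[OF j] by (simp add: Y_def)
      have d: "\<bar>fst p - fst p'\<bar> \<le> \<eta>" "\<bar>fst (snd p) - fst (snd p')\<bar> \<le> \<eta>" "\<bar>snd (snd p) - snd (snd p')\<bar> \<le> \<eta>"
        using that by (auto simp: qb_def abs_minus_commute)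
      show "norm (F w w' j p - F w w' j p') \<le> 40000 * \<delta> * X * (4 * Y\<^sup>2 * \<eta>)"
        unfolding F_def
        by (rule layer_lipschitz[OF finite_S pos \<delta>(1) f1(4) f2(4) inner_th_diff_le[OF d yY constants(1)] _ X\<eta>])
          (use pos in \<open>simp add: X_def\<close>)
    qed
    also have "\<dots> = 160000 * X * Y\<^sup>2 * \<eta> * (\<delta> * real (card J))" by simp
    also have "\<dots> \<le> 160000 * X * Y\<^sup>2 * \<eta> * (\<delta> * (3 * Q / \<delta>))"
      using card_J \<delta> \<eta>0 X4 by (intro mult_left_mono) auto
    also have "\<dots> = A * X * \<eta>" using \<delta> by (simp add: A_def)
    also have "\<dots> = t / 2" using X4 constants by (simp add: \<eta>_def)
    finally show ?thesis .
  qed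
  have X1: "1 / X \<le> 1" using X4 by simp
  have "real (card ?P) * (\<eta> ^ 3 * (t / 2) ^ 4 / 8) \<le> Q * (max \<eta> \<delta> / \<delta>)\<^sup>2 * wint \<tau> (\<lambda>p. norm (FS J p) ^ 4)"
  proof (rule count_large_values)
    show "finite ?P" using P by simp
    show "\<bar>fst p\<bar> \<le> Y \<and> \<bar>fst (snd p)\<bar> \<le> Y \<and> \<bar>snd (snd p)\<bar> \<le> Y" if "p \<in> ?P" for p
      using P(2)[of p] that by (auto simp: Y_def)
    show "bc (FS J)" by (rule bcFS) simp
    show "t / 2 \<le> norm (FS J p')" if "p \<in> ?P" "p' \<in> qb p \<eta>" for p p'
    proof -
      have "t \<le> norm (FS J p)" using that(1) by (simp add: tot)
      also have "\<dots> \<le> norm (FS J p') + norm (FS J p - FS J p')" by (rule norm_triangle_sub)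
      finally show ?thesis using lip[OF that(2)] by linarith
    qed
    show "real (card (?P \<inter> qb a \<rho>)) \<le> Q * (\<rho> / \<delta>)\<^sup>2" if "\<delta> \<le> \<rho>" for a \<rho>
    proof -
      have "card (?P \<inter> qb a \<rho>) \<le> card (P \<inter> qb a \<rho>)" using P(1) by (intro card_mono) auto
      then show ?thesis using spacing[OF that, of a] by linarith
    qed
  qed (use constants \<eta>0 \<eta>X X1 t \<delta> Q in \<open>auto intro: order_trans\<close>)
  also have "\<dots> \<le> Q * (1 / X / \<delta>)\<^sup>2 * (Cp * (real k ^ 8 * (\<delta> ^ 3 * real (card E)) / X))"
  proof (intro mult_mono mult_left_mono power_mono divide_right_mono wi)
    have "\<delta> \<le> 1 / X" using X\<delta> X4 \<delta> by (simp add: field_simps)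
    then show "max \<eta> \<delta> \<le> 1 / X" using \<eta>X by simp
  qed (use Q \<delta> \<eta>0 X4 in \<open>auto intro!: wint_nonneg\<close>)
  finally have main: "real (card ?P) * (\<eta> ^ 3 * (t / 2) ^ 4 / 8) \<le> Q * (1 / X / \<delta>)\<^sup>2 * (Cp * (real k ^ 8 * (\<delta> ^ 3 * real (card E)) / X))" .
  define Z where "Z = Cp * (real k ^ 8 * (\<delta> ^ 3 * real (card E)))"
  \<comment> \<open>1024 is 8 from the cube of 2 in \<eta>, times 16 from (t / 2)^4, times 8 from
    the weight.\<close>
  have "real (card ?P) * \<delta>\<^sup>2 * t ^ 7 = 1024 * A ^ 3 * X ^ 3 * \<delta>\<^sup>2 * (real (card ?P) * (\<eta> ^ 3 * (t / 2) ^ 4 / 8))"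
    using X4 constants(5) by (simp add: \<eta>_def power_divide power_mult_distrib power_add[symmetric] field_simps)
  also have "\<dots> \<le> 1024 * A ^ 3 * X ^ 3 * \<delta>\<^sup>2 * (Q * (1 / X / \<delta>)\<^sup>2 * (Z / X))"
    using main X4 constants(5) \<delta> by (intro mult_left_mono) (auto simp: Z_def)
  also have "\<dots> = 1024 * A ^ 3 * Q * Z"
    using X4 \<delta> by (simp add: power2_eq_square power3_eq_cube field_simps)
  finally show ?thesis by (simp add: Z_def mult_ac)
qed

section \<open>Each rich line is large in some piece\<close>

text \<open>Half the lower bound lam / (4 \<open>q\<^sup>2\<close> k^8) for the complete sum, with q
  = 8 \<open>Q\<^sup>2\<close> 4^(n + 2), divided by the at most 36 (n + 1)^2 k^8 pairs of windows
  and their weights (n + 1)^2. The power k^16 is kept outside.\<close>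

definition ct :: real where
  "ct = 1 / (288 * (8 * Q\<^sup>2 * 4 ^ (n + 2))\<^sup>2 * (real n + 1) ^ 4)"

lemma ct_pos: "0 < ct"
  using Q by (simp add: ct_def)

lemma card_Om: "real (card (Om K n)) \<le> 6 * (real n + 1) * real k ^ 4"
proof -
  have "1 \<le> real K ^ 2" using k by (simp add: K_def)
  then have le: "3 * (real n + 1) * (real K ^ 2 + 1) \<le> 3 * (real n + 1) * (2 * real K ^ 2)"
    by (intro mult_left_mono) auto
  have "real K ^ 2 = real k ^ 4" by (simp add: K_def power_mult[symmetric])
  then have "3 * (real n + 1) * (2 * real K ^ 2) = 6 * (real n + 1) * real k ^ 4" by simp
  with order_trans[OF Om_bounds(2)[of K n] le] show ?thesis by (simp only:)
qed

text \<open>Summed over all pairs of windows with their weights, the pieces give products of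
  nonnegative Fejer kernels at the top frequency N. There every nearby cube counts fully, so a rich
  line sees a large total, and one of the few pieces must account for its share.\<close>

lemma exists_large_piece:
  assumes p: "p \<in> P"
  shows "\<exists>w\<in>Om K n. \<exists>w'\<in>Om K n. lam * ct / real k ^ 16 \<le> norm (tot w w' p)"
proof (rule ccontr)
  assume no: "\<not> ?thesis"
  define t where "t = lam * ct / real k ^ 16"
  have small: "norm (tot w w' p) \<le> t" if "w \<in> Om K n" "w' \<in> Om K n" for w w'
    using no that unfolding t_def by (meson linear)
  have "8 ^ 2 \<le> K" unfolding K_def using k by (intro power_mono) auto
  then have K1: "K > 1" by simp
  obtain d where d: "\<And>w. 0 \<le> d w \<and> d w \<le> real n + 1"
    and deq: "\<And>z. complex_of_real (real K ^ n * fejer (real K ^ n * z)) = (\<Sum>w\<in>Om K n. of_real (d w) * wn K (fst w) (snd w) z)"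
    using window_decomposition[OF K1, of n] by blast
  define N where "N = real K ^ n"
  have N0: "0 < N" using K1 by (simp add: N_def)
  have wnk: "wn K (fst w) (snd w) z = of_real (wd w) * kf (fr w) (wd w) z" for w z
    by (simp add: wn_def wd_def fr_def)
  let ?al = "\<lambda>j (c::int\<times>int). th1 (of_int j * \<delta>) \<bullet> p - (of_int (snd c) * \<delta> + of_int j * \<delta> * (of_int (fst c) * \<delta>))"
  let ?be = "\<lambda>j (c::int\<times>int). th2 (of_int j * \<delta>) \<bullet> p - of_int (fst c) * \<delta>"
  have Fs: "(\<Sum>w\<in>Om K n. \<Sum>w'\<in>Om K n. of_real (d w * d w') * F w w' j p)
      = of_real (\<delta> ^ 3 * (\<Sum>c\<in>S j. (N * fejer (N * ?al j c)) * (N * fejer (N * ?be j c))))" for j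
  proof -
    have "(\<Sum>w\<in>Om K n. \<Sum>w'\<in>Om K n. of_real (d w * d w') * F w w' j p)
      = (\<Sum>w\<in>Om K n. \<Sum>w'\<in>Om K n. \<Sum>c\<in>S j. of_real (\<delta> ^ 3) * ((of_real (d w) * wn K (fst w) (snd w) (?al j c)) * (of_real (d w') * wn K (fst w') (snd w') (?be j c))))"
      unfolding F_def layer_def pk_def wnk
      by (intro sum.cong refl) (simp add: sum_distrib_left mult_ac)
    also have "\<dots> = (\<Sum>c\<in>S j. \<Sum>w\<in>Om K n. \<Sum>w'\<in>Om K n. of_real (\<delta> ^ 3) * ((of_real (d w) * wn K (fst w) (snd w) (?al j c)) * (of_real (d w') * wn K (fst w') (snd w') (?be j c))))"
      by (subst sum.swap[of _ "S j" "Om K n"], subst sum.swap[of _ "S j" "Om K n"]) (rule refl)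
    also have "\<dots> = (\<Sum>c\<in>S j. of_real (\<delta> ^ 3) * (complex_of_real (N * fejer (N * ?al j c)) * complex_of_real (N * fejer (N * ?be j c))))"
      unfolding N_def deq sum_product by (simp only: sum_distrib_left)
    also have "\<dots> = of_real (\<delta> ^ 3 * (\<Sum>c\<in>S j. (N * fejer (N * ?al j c)) * (N * fejer (N * ?be j c))))"
      by (simp add: sum_distrib_left)
    finally show ?thesis .
  qed
  let ?G = "\<lambda>j. \<delta> ^ 3 * (\<Sum>c\<in>S j. (N * fejer (N * ?al j c)) * (N * fejer (N * ?be j c)))"
  have G0: "0 \<le> ?G j" for j using \<delta> N0 by (intro mult_nonneg_nonneg sum_nonneg) auto
  let ?H = "{j. \<exists>m l. (j, m, l) \<in> E \<and>
        \<bar>snd (snd p) + fst (snd p) * (of_int j * \<delta>) - of_int m * \<delta>\<bar> \<le> Q * \<delta> \<and>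
        \<bar>snd (snd p) * (of_int j * \<delta>) - fst p - of_int l * \<delta>\<bar> \<le> Q * \<delta>}"
  have HJ: "?H \<subseteq> J" by (force simp: J_def)
  \<comment> \<open>Origin of the constant in \<open>k_le\<close>: a cube counted by
    \<open>rich\<close> is within 2 \<open>Q\<^sup>2\<close> \<delta> in both coordinates, the
    square coming from y x in the coordinate of \<open>th1\<close>, and the kernel is at least 1/2
    up to distance 1 / (4 N).\<close>
  have N\<delta>: "N * (2 * Q\<^sup>2 * \<delta>) \<le> 1/4"
  proof -
    have "N = real k ^ (2 * n)" by (simp add: N_def K_def power_mult)
    also have "\<dots> \<le> real k ^ (2 * (n + 2))" using k by (intro power_increasing) auto
    finally have "8 * Q\<^sup>2 * \<delta> * N \<le> 8 * Q\<^sup>2 * \<delta> * real k ^ (2 * (n + 2))"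
      using \<delta> by (intro mult_left_mono) auto
    then show ?thesis using k_le by (simp add: mult_ac)
  qed
  have Gl: "\<delta> ^ 3 * (N\<^sup>2 / 4) \<le> ?G j" if jH: "j \<in> ?H" for j
  proof -
    obtain m l where ml: "(j, m, l) \<in> E" and b: "\<bar>snd (snd p) + fst (snd p) * (of_int j * \<delta>) - of_int m * \<delta>\<bar> \<le> Q * \<delta>"
      and a: "\<bar>snd (snd p) * (of_int j * \<delta>) - fst p - of_int l * \<delta>\<bar> \<le> Q * \<delta>"
      using jH by blast
    let ?c = "(m, l)"
    have cS: "?c \<in> S j" using ml by (simp add: S_def)
    have be: "?be j ?c = snd (snd p) + fst (snd p) * (of_int j * \<delta>) - of_int m * \<delta>"
      by (cases p) (simp add: th2_def)
    have al: "?al j ?c = (snd (snd p) * (of_int j * \<delta>) - fst p - of_int l * \<delta>)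
        + (of_int j * \<delta>) * (snd (snd p) + fst (snd p) * (of_int j * \<delta>) - of_int m * \<delta>)"
      by (cases p) (simp add: th1_def power2_eq_square algebra_simps)
    have jQ: "\<bar>of_int j * \<delta>\<bar> \<le> Q" using J_bound HJ jH by blast
    have QQ: "Q \<le> Q\<^sup>2" using Q self_le_power[of Q 2] by simp
    have "\<bar>(of_int j * \<delta>) * (snd (snd p) + fst (snd p) * (of_int j * \<delta>) - of_int m * \<delta>)\<bar> \<le> Q * (Q * \<delta>)"
      unfolding abs_mult[of "of_int j * \<delta>"] using jQ b Q by (intro mult_mono) auto
    then have "\<bar>?al j ?c\<bar> \<le> Q * \<delta> + Q * (Q * \<delta>)"
      unfolding al using a by linarith
    also have "\<dots> \<le> 2 * Q\<^sup>2 * \<delta>" using mult_right_mono[OF QQ, of \<delta>] \<delta> by (simp add: power2_eq_square mult_ac)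
    finally have al2: "\<bar>?al j ?c\<bar> \<le> 2 * Q\<^sup>2 * \<delta>" .
    have "Q \<le> 2 * Q\<^sup>2" using QQ zero_le_power2[of Q] by linarith
    then have "Q * \<delta> \<le> 2 * Q\<^sup>2 * \<delta>" using \<delta> by (intro mult_right_mono) auto
    then have be2: "\<bar>?be j ?c\<bar> \<le> 2 * Q\<^sup>2 * \<delta>" unfolding be using b by linarith
    have half: "1/2 \<le> fejer (N * x)" if "\<bar>x\<bar> \<le> 2 * Q\<^sup>2 * \<delta>" for x
    proof (rule fejer_ge_half)
      have "N * \<bar>x\<bar> \<le> N * (2 * Q\<^sup>2 * \<delta>)" using that N0 by (intro mult_left_mono) auto
      then have "N * \<bar>x\<bar> \<le> 1/4" using N\<delta> by (rule order_trans)
      then show "\<bar>N * x\<bar> \<le> 1/4" using N0 by (simp add: abs_mult)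
    qed
    have "N * (1/2) * (N * (1/2)) \<le> (N * fejer (N * ?al j ?c)) * (N * fejer (N * ?be j ?c))"
      using half[OF al2] half[OF be2] N0 by (intro mult_mono) auto
    also have "\<dots> \<le> (\<Sum>c\<in>S j. (N * fejer (N * ?al j c)) * (N * fejer (N * ?be j c)))"
      using N0 by (intro member_le_sum[OF cS _ finite_S]) auto
    finally show ?thesis using \<delta> by (intro mult_left_mono) (auto simp: power2_eq_square)
  qed
  \<comment> \<open>N is smaller than 1 / \<delta> by the factor K^2 = k^4 left for the window
    centres, and by 4^(n + 2) from rounding \<open>k\<close>.\<close>
  have dN: "1 / (8 * Q\<^sup>2 * 4 ^ (n + 2) * real k ^ 4) \<le> \<delta> * N"
  proof -
    have "(2 * real k) ^ (2 * (n + 2)) = 4 ^ (n + 2) * (real k ^ 4 * N)"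
    proof -
      have "(2 * real k) ^ (2 * (n + 2)) = (2::real) ^ (2 * (n + 2)) * real k ^ (2 * (n + 2))"
        by (rule power_mult_distrib)
      also have "(2::real) ^ (2 * (n + 2)) = 4 ^ (n + 2)" by (simp only: power_mult) simp
      also have "real k ^ (2 * (n + 2)) = real k ^ 4 * N"
        unfolding N_def K_def of_nat_power power_mult[symmetric] power_add[symmetric]
        by (rule arg_cong[where f="power (real k)"]) simp
      finally show ?thesis .
    qed
    then have "1 \<le> (\<delta> * N) * (8 * Q\<^sup>2 * 4 ^ (n + 2) * real k ^ 4)"
      using k_ge by (simp only: mult_ac)
    then show ?thesis using Q k by (subst pos_divide_le_eq) auto
  qed
  define q where "q = 8 * Q\<^sup>2 * 4 ^ (n + 2)"
  have q0: "0 < q" using Q by (simp add: q_def)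
  have low: "lam / (4 * q\<^sup>2 * real k ^ 8) \<le> (\<Sum>j\<in>J. ?G j)"
  proof -
    have "lam / (4 * q\<^sup>2 * real k ^ 8) = (1 / (q * real k ^ 4))\<^sup>2 * (lam / 4)"
      by (simp add: power_divide power_mult_distrib power_mult[symmetric])
    also have "\<dots> \<le> (\<delta> * N)\<^sup>2 * (lam / 4)"
      using dN q0 lam by (intro mult_right_mono power_mono) (auto simp: q_def)
    also have "\<dots> = (lam / \<delta>) * (\<delta> ^ 3 * (N\<^sup>2 / 4))"
      using \<delta> by (simp add: power2_eq_square power3_eq_cube)
    also have "\<dots> \<le> real (card ?H) * (\<delta> ^ 3 * (N\<^sup>2 / 4))"
      using rich[OF p] \<delta> by (intro mult_right_mono) auto
    also have "\<dots> = (\<Sum>j\<in>?H. \<delta> ^ 3 * (N\<^sup>2 / 4))" by simp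
    also have "\<dots> \<le> (\<Sum>j\<in>?H. ?G j)" by (intro sum_mono Gl)
    also have "\<dots> \<le> (\<Sum>j\<in>J. ?G j)" using HJ finite_J G0 by (intro sum_mono2) auto
    finally show ?thesis .
  qed
  have "complex_of_real (\<Sum>j\<in>J. ?G j) = (\<Sum>j\<in>J. \<Sum>w\<in>Om K n. \<Sum>w'\<in>Om K n. of_real (d w * d w') * F w w' j p)"
    unfolding of_real_sum Fs ..
  also have "\<dots> = (\<Sum>w\<in>Om K n. \<Sum>w'\<in>Om K n. of_real (d w * d w') * tot w w' p)"
    unfolding tot_def sum_distrib_left
    by (subst sum.swap[of _ "Om K n" J], intro sum.cong refl, subst sum.swap) (rule refl)
  finally have eq: "complex_of_real (\<Sum>j\<in>J. ?G j) = (\<Sum>w\<in>Om K n. \<Sum>w'\<in>Om K n. of_real (d w * d w') * tot w w' p)" .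
  have t0: "0 \<le> t" using lam ct_pos by (simp add: t_def)
  have "(\<Sum>j\<in>J. ?G j) \<le> norm (complex_of_real (\<Sum>j\<in>J. ?G j))" unfolding norm_of_real by (rule abs_ge_self)
  also have "\<dots> \<le> (\<Sum>w\<in>Om K n. \<Sum>w'\<in>Om K n. (real n + 1) * (real n + 1) * t)"
    unfolding eq
  proof (rule order_trans[OF norm_sum], rule sum_mono, rule order_trans[OF norm_sum], rule sum_mono)
    fix w w' assume ww: "w \<in> Om K n" "w' \<in> Om K n"
    have "\<bar>d w * d w'\<bar> \<le> (real n + 1) * (real n + 1)"
      unfolding abs_mult using d[of w] d[of w'] by (intro mult_mono) auto
    then show "norm (of_real (d w * d w') * tot w w' p) \<le> (real n + 1) * (real n + 1) * t"
      unfolding norm_mult norm_of_real using small[OF ww] by (intro mult_mono) auto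
  qed
  also have "\<dots> = (real (card (Om K n)))\<^sup>2 * ((real n + 1)\<^sup>2 * t)"
    by (simp add: power2_eq_square)
  also have "\<dots> \<le> (6 * (real n + 1) * real k ^ 4)\<^sup>2 * ((real n + 1)\<^sup>2 * t)"
    using card_Om t0 by (intro mult_right_mono power_mono) auto
  also have "\<dots> = 36 * (real n + 1) ^ 4 * real k ^ 8 * t"
    by (simp only: power_mult_distrib power_mult[symmetric]) (simp add: power_add[symmetric] flip: mult.assoc)
  also have "\<dots> = lam / (8 * q\<^sup>2 * real k ^ 8)"
  proof -
    have "36 * m * a8 * (lam * (1 / (288 * q\<^sup>2 * m)) / (a8 * a8)) = lam / (8 * q\<^sup>2 * a8)" if "m > 0" "a8 > 0" for m a8 :: real
      using that q0 by (simp add: field_simps)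
    from this[of "(real n + 1) ^ 4" "real k ^ 8"] show ?thesis
      using k by (simp add: t_def ct_def q_def power_add[symmetric])
  qed
  finally have "lam / (4 * q\<^sup>2 * real k ^ 8) \<le> lam / (8 * q\<^sup>2 * real k ^ 8)" using low by linarith
  moreover have "lam / (8 * q\<^sup>2 * real k ^ 8) < lam / (4 * q\<^sup>2 * real k ^ 8)"
    using lam q0 k by (intro divide_strict_left_mono) auto
  ultimately show False by linarith
qed

definition CC :: real where
  "CC = 36 * (real n + 1)\<^sup>2 * (1024 * A ^ 3 * Q * Cp) / ct ^ 7"

text \<open>A union bound over pairs of windows. The exponent 128 collects 8 from the number of
  pairs, 8 from \<open>piece_count\<close>, and 7 times 16 from the threshold t.\<close>

theorem discrete_bound:
  "lam ^ 7 * (\<delta>\<^sup>2 * real (card P)) \<le> CC * real k ^ 128 * (\<delta> ^ 3 * real (card E))"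
proof -
  define t where "t = lam * ct / real k ^ 16"
  have t0: "0 < t" using lam ct_pos k by (simp add: t_def)
  define B where "B = 1024 * A ^ 3 * Q * Cp * (real k ^ 8 * (\<delta> ^ 3 * real (card E)))"
  have B0: "0 \<le> B" unfolding B_def using constants Q \<delta> by (intro mult_nonneg_nonneg) auto
  have sub: "P \<subseteq> (\<Union>w\<in>Om K n. \<Union>w'\<in>Om K n. {p\<in>P. t \<le> norm (tot w w' p)})"
    using exists_large_piece unfolding t_def by blast
  have fin: "finite (Om K n)" by (rule Om_bounds)
  have "card P \<le> card (\<Union>w\<in>Om K n. \<Union>w'\<in>Om K n. {p\<in>P. t \<le> norm (tot w w' p)})"
    using fin P(1) by (intro card_mono sub) auto
  also have "\<dots> \<le> (\<Sum>w\<in>Om K n. card (\<Union>w'\<in>Om K n. {p\<in>P. t \<le> norm (tot w w' p)}))"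
    by (rule card_UN_le[OF fin])
  also have "\<dots> \<le> (\<Sum>w\<in>Om K n. \<Sum>w'\<in>Om K n. card {p\<in>P. t \<le> norm (tot w w' p)})"
    by (intro sum_mono card_UN_le fin)
  finally have "real (card P) \<le> real (\<Sum>w\<in>Om K n. \<Sum>w'\<in>Om K n. card {p\<in>P. t \<le> norm (tot w w' p)})"
    by (simp only: of_nat_le_iff)
  then have "real (card P) * (\<delta>\<^sup>2 * t ^ 7) \<le> (\<Sum>w\<in>Om K n. \<Sum>w'\<in>Om K n. real (card {p\<in>P. t \<le> norm (tot w w' p)})) * (\<delta>\<^sup>2 * t ^ 7)"
    using t0 by (intro mult_right_mono) auto
  also have "\<dots> = (\<Sum>w\<in>Om K n. \<Sum>w'\<in>Om K n. real (card {p\<in>P. t \<le> norm (tot w w' p)}) * \<delta>\<^sup>2 * t ^ 7)"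
    by (simp only: sum_distrib_right mult.assoc)
  also have "\<dots> \<le> (\<Sum>w\<in>Om K n. \<Sum>w'\<in>Om K n. B)"
    unfolding B_def by (intro sum_mono piece_count t0)
  also have "\<dots> = (real (card (Om K n)))\<^sup>2 * B" by (simp add: power2_eq_square)
  also have "\<dots> \<le> (6 * (real n + 1) * real k ^ 4)\<^sup>2 * B"
    using card_Om B0 by (intro mult_right_mono power_mono) auto
  also have "\<dots> = 36 * (real n + 1)\<^sup>2 * real k ^ 8 * B"
    by (simp only: power_mult_distrib power_mult[symmetric]) simp
  finally have *: "real (card P) * (\<delta>\<^sup>2 * t ^ 7) \<le> 36 * (real n + 1)\<^sup>2 * real k ^ 8 * B" .
  have t7: "t ^ 7 = lam ^ 7 * (ct ^ 7 / real k ^ 112)"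
    by (simp add: t_def power_divide power_mult_distrib power_mult[symmetric])
  have "lam ^ 7 * (\<delta>\<^sup>2 * real (card P)) = real (card P) * (\<delta>\<^sup>2 * t ^ 7) * (real k ^ 112 / ct ^ 7)"
    unfolding t7 using k ct_pos by simp
  also have "\<dots> \<le> 36 * (real n + 1)\<^sup>2 * real k ^ 8 * B * (real k ^ 112 / ct ^ 7)"
    using * ct_pos by (intro mult_right_mono) auto
  also have "\<dots> = CC * (real k ^ 8 * real k ^ 8 * real k ^ 112) * (\<delta> ^ 3 * real (card E))"
    by (simp add: B_def CC_def mult_ac)
  also have "real k ^ 8 * real k ^ 8 * real k ^ 112 = real k ^ 128"
    by (simp only: power_add[symmetric]) simp
  finally show ?thesis .
qed

end

section \<open>From lines to the discretised estimate\<close>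

lemma card_ge_of_interval_cover:
  fixes T :: "real set" and c :: "int \<Rightarrow> real"
  assumes "finite H" "T \<subseteq> (\<Union>j\<in>H. {c j - \<mu>..c j + \<mu>})" "0 \<le> \<mu>" "lam \<le> measure lebesgue T" "0 < lam"
  shows "lam \<le> real (card H) * (2 * \<mu>)"
proof -
  \<comment> \<open>A set that is not measurable has \<open>measure\<close> 0 by convention, so a
    positive value forces measurability.\<close>
  have T: "T \<in> sets lebesgue"
    using assms(4,5) measure_notin_sets[of T lebesgue] by fastforce
  have "lam \<le> measure lebesgue T" by fact
  also have "\<dots> \<le> measure lebesgue (\<Union>j\<in>H. {c j - \<mu>..c j + \<mu>})"
    using assms(1,2) T by (intro measure_mono_fmeasurable fmeasurable.finite_UN) auto
  also have "\<dots> \<le> (\<Sum>j\<in>H. measure lebesgue {c j - \<mu>..c j + \<mu>})"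
    using assms(1) by (intro measure_UNION_le) auto
  also have "\<dots> = real (card H) * (2 * \<mu>)" using assms(3) by simp
  finally show ?thesis .
qed

text \<open>The functions \<alpha>, \<beta>, \<gamma>, \<zeta> are the parameters a, b, c, d in
  either of two orders, so that one statement covers lines with d not small and lines with c not
  small. Exchanging the first two coordinates of space reverses the determinant, which
  \<open>om\<close> records.\<close>

lemma chart_bound:
  fixes \<alpha> \<beta> \<gamma> \<zeta> :: "real^4 \<Rightarrow> real" and om :: int and KK :: "(int \<times> int \<times> int) set"
  assumes R: "1 \<le> R" and om: "om = 1 \<or> om = -1" and finL: "finite L"
    and det: "\<And>p. p \<in> L \<Longrightarrow> \<alpha> p * \<zeta> p - \<beta> p * \<gamma> p = of_int om"
    and bd: "\<And>p. p \<in> L \<Longrightarrow> \<bar>\<alpha> p\<bar> \<le> R \<and> \<bar>\<beta> p\<bar> \<le> R \<and> \<bar>\<gamma> p\<bar> \<le> R \<and> \<bar>\<zeta> p\<bar> \<le> R"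
    and low: "\<And>p. p \<in> L \<Longrightarrow> 1 \<le> 2 * R * \<bar>\<zeta> p\<bar>"
    and nrm: "\<And>p q. norm (p - q) \<le> \<bar>\<alpha> p - \<alpha> q\<bar> + \<bar>\<beta> p - \<beta> q\<bar> + \<bar>\<gamma> p - \<gamma> q\<bar> + \<bar>\<zeta> p - \<zeta> q\<bar>"
    and N1: "1 \<le> N1" "real (card L) \<le> N1 / \<delta>\<^sup>2"
    and ball: "\<And>x \<rho>. \<delta> \<le> \<rho> \<Longrightarrow> \<rho> \<le> 1 \<Longrightarrow> real (card (L \<inter> ball x \<rho>)) \<le> (\<rho> / \<delta>)\<^sup>2"
    and KK: "finite KK" "\<And>x. x \<in> KK \<Longrightarrow> \<bar>of_int (fst (snd x)) * \<delta>\<bar> \<le> R"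
    and T: "\<And>p. p \<in> L \<Longrightarrow> lam \<le> measure lebesgue {s. \<exists>x\<in>KK.
        \<bar>\<alpha> p + s * \<gamma> p - of_int (fst x) * \<delta>\<bar> \<le> \<delta> \<and> \<bar>\<beta> p + s * \<zeta> p - of_int (fst (snd x)) * \<delta>\<bar> \<le> \<delta> \<and>
        \<bar>s - of_int (snd (snd x)) * \<delta>\<bar> \<le> \<delta>}" and lam: "0 < lam"
    and Q: "Q = N1 * (31 * R ^ 6)\<^sup>2" and \<delta>: "0 < \<delta>" "\<delta> \<le> 1/8" and k: "8 \<le> k"
    and k_le: "8 * Q\<^sup>2 * \<delta> * real k ^ (2 * (n + 2)) \<le> 1"
    and k_ge: "1 \<le> 8 * Q\<^sup>2 * \<delta> * (2 * real k) ^ (2 * (n + 2))"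
  shows "(lam / (4 * R)) ^ 7 * (\<delta>\<^sup>2 * real (card L)) \<le> discrete_kakeya.CC Q n * real k ^ 128 * (\<delta> ^ 3 * real (card KK))"
proof -
  define B where "B = (\<lambda>p. \<beta> p / \<zeta> p)"
  define C where "C = (\<lambda>p. of_int om * (\<gamma> p / \<zeta> p))"
  define W where "W = (\<lambda>p. 1 / \<zeta> p)"
  define \<Phi> where "\<Phi> = (\<lambda>p. (B p, C p, W p))"
  \<comment> \<open>The slicing coordinate y moves to the front, and x is multiplied by
    \<open>om\<close> because W + C y equals \<open>om\<close> times the other spatial coordinate
    (\<open>cy\<close> below).\<close>
  define E where "E = (\<lambda>x. (fst (snd x), om * fst x, snd (snd x))) ` KK"
  have om2: "of_int om * of_int om = (1::real)" "\<bar>of_int om\<bar> = (1::real)" using om by auto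
  have Rp: "1 \<le> R ^ m" for m using R by (rule one_le_power)
  have RR: "R ^ m \<le> R ^ 6" if "m \<le> 6" for m using R that by (intro power_increasing)
  have Q0: "31 * R ^ 6 \<le> Q"
  proof -
    have "31 * R ^ 6 \<le> (31 * R ^ 6)\<^sup>2" using Rp[of 6] self_le_power[of "31 * R ^ 6" 2] by simp
    also have "\<dots> \<le> N1 * (31 * R ^ 6)\<^sup>2" using N1(1) mult_right_mono[of 1 N1 "(31 * R ^ 6)\<^sup>2"] by simp
    finally show ?thesis by (simp add: Q)
  qed
  have Q1: "1 \<le> Q" using Q0 Rp[of 6] by linarith
  have \<zeta>0: "\<zeta> p \<noteq> 0" if "p \<in> L" for p using low[OF that] by auto
  have W2: "\<bar>W p\<bar> \<le> 2 * R" if "p \<in> L" for p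
    using low[OF that] \<zeta>0[OF that] by (simp add: W_def field_simps)
  have BW: "B p = \<beta> p * W p" "C p = of_int om * \<gamma> p * W p" for p by (simp_all add: B_def C_def W_def)
  have m: "\<bar>x * y\<bar> \<le> X * Z" if "\<bar>x\<bar> \<le> X" "\<bar>y\<bar> \<le> Z" for x y X Z :: real
    unfolding abs_mult using that by (intro mult_mono) auto
  have B2: "\<bar>B p\<bar> \<le> 2 * R\<^sup>2" and C2: "\<bar>C p\<bar> \<le> 2 * R\<^sup>2" if "p \<in> L" for p
  proof -
    show "\<bar>B p\<bar> \<le> 2 * R\<^sup>2" using m[of "\<beta> p" R "W p" "2 * R"] bd[OF that] W2[OF that] by (simp add: BW power2_eq_square)
    have "\<bar>C p\<bar> = \<bar>\<gamma> p * W p\<bar>" by (simp add: BW abs_mult om2)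
    then show "\<bar>C p\<bar> \<le> 2 * R\<^sup>2" using m[of "\<gamma> p" R "W p" "2 * R"] bd[OF that] W2[OF that] by (simp add: power2_eq_square)
  qed
  \<comment> \<open>The determinant condition recovers the fourth parameter from B, C, W; this is
    the only use of it.\<close>
  have a_eq: "of_int om * \<alpha> p = W p + \<beta> p * C p" if "p \<in> L" for p
  proof -
    have "\<alpha> p * \<zeta> p = of_int om + \<beta> p * \<gamma> p" using det[OF that] by simp
    then have "of_int om * (\<alpha> p * \<zeta> p) = of_int om * of_int om + of_int om * (\<beta> p * \<gamma> p)"
      by (simp only: distrib_left)
    then have "of_int om * \<alpha> p * \<zeta> p = 1 + of_int om * \<beta> p * \<gamma> p" by (simp add: om2 mult_ac)
    then show ?thesis using \<zeta>0[OF that] by (simp add: W_def C_def field_simps)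
  qed
  \<comment> \<open>The inverse of \<Phi> is Lipschitz on \<open>L\<close>, so the ball condition
    carries over to the new coordinates. The 2 \<rho> is the distance between two points of one cube
    \<open>qb a \<rho>\<close>, and 30 is 16 + 6 + 6 + 2 from the four parameters.\<close>
  have close: "norm (p - q) \<le> 30 * R ^ 6 * \<rho>"
    if pq: "p \<in> L" "q \<in> L" and d: "\<bar>B p - B q\<bar> \<le> 2 * \<rho>" "\<bar>C p - C q\<bar> \<le> 2 * \<rho>" "\<bar>W p - W q\<bar> \<le> 2 * \<rho>" for p q \<rho>
  proof -
    have \<rho>0: "0 \<le> \<rho>" using d(1) by linarith
    have R1: "x \<le> c * R ^ 6 * \<rho>" if "x \<le> c * R ^ i * \<rho>" "i \<le> 6" "0 \<le> c" for x c i
    proof -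
      have "c * R ^ i * \<rho> \<le> c * R ^ 6 * \<rho>" using RR[OF that(2)] \<rho>0 that(3) by (intro mult_right_mono mult_left_mono) auto
      then show ?thesis using that(1) by linarith
    qed
    have "\<zeta> p - \<zeta> q = - (\<zeta> p * (\<zeta> q * (W p - W q)))"
      using \<zeta>0[OF pq(1)] \<zeta>0[OF pq(2)] by (simp add: W_def field_simps)
    then have dz: "\<bar>\<zeta> p - \<zeta> q\<bar> \<le> R * (R * (2 * \<rho>))"
      using m[OF _ m[OF _ d(3)], of "\<zeta> p" R "\<zeta> q" R] bd[OF pq(1)] bd[OF pq(2)] by simp
    have db: "\<bar>u p - u q\<bar> \<le> 2 * \<rho> * R + 2 * R\<^sup>2 * (R * (R * (2 * \<rho>)))"
      if "\<bar>U p - U q\<bar> \<le> 2 * \<rho>" "\<bar>U q\<bar> \<le> 2 * R\<^sup>2" "u p = U p * \<zeta> p" "u q = U q * \<zeta> q" for u U :: "real^4 \<Rightarrow> real"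
    proof -
      have "u p - u q = (U p - U q) * \<zeta> p + U q * (\<zeta> p - \<zeta> q)" by (simp add: that(3,4) algebra_simps)
      then show ?thesis
        using m[OF that(1), of "\<zeta> p" R] m[OF that(2) dz] bd[OF pq(1)] abs_triangle_ineq[of "(U p - U q) * \<zeta> p" "U q * (\<zeta> p - \<zeta> q)"] by linarith
    qed
    have e6: "2 * \<rho> * R + 2 * R\<^sup>2 * (R * (R * (2 * \<rho>))) \<le> 6 * R ^ 4 * \<rho>"
    proof -
      have "2 * \<rho> * R \<le> 2 * \<rho> * R ^ 4" using \<rho>0 R self_le_power[of R 4] by (intro mult_left_mono) auto
      then show ?thesis by (simp add: power2_eq_square power4_eq_xxxx mult_ac)
    qed
    have dB: "\<bar>\<beta> p - \<beta> q\<bar> \<le> 6 * R ^ 4 * \<rho>"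
    proof -
      have "\<beta> p = B p * \<zeta> p" "\<beta> q = B q * \<zeta> q" using \<zeta>0[OF pq(1)] \<zeta>0[OF pq(2)] by (simp_all add: B_def)
      from order_trans[OF db[where u=\<beta> and U=B, OF d(1) B2[OF pq(2)] this] e6] show ?thesis .
    qed
    have dC: "\<bar>\<gamma> p - \<gamma> q\<bar> \<le> 6 * R ^ 4 * \<rho>"
    proof -
      let ?u = "\<lambda>x. of_int om * \<gamma> x"
      have "?u p = C p * \<zeta> p" "?u q = C q * \<zeta> q" using \<zeta>0[OF pq(1)] \<zeta>0[OF pq(2)] by (simp_all add: C_def)
      from order_trans[OF db[where u="?u" and U=C, OF d(2) C2[OF pq(2)] this] e6]
      have "\<bar>?u p - ?u q\<bar> \<le> 6 * R ^ 4 * \<rho>" .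
      moreover have "\<bar>?u p - ?u q\<bar> = \<bar>\<gamma> p - \<gamma> q\<bar>" by (simp add: om2 abs_mult flip: right_diff_distrib)
      ultimately show ?thesis by simp
    qed
    have dA: "\<bar>\<alpha> p - \<alpha> q\<bar> \<le> 16 * R ^ 6 * \<rho>"
    proof -
      have "\<bar>\<alpha> p - \<alpha> q\<bar> = \<bar>of_int om * \<alpha> p - of_int om * \<alpha> q\<bar>" by (simp add: om2 abs_mult flip: right_diff_distrib)
      also have "\<dots> = \<bar>(W p - W q) + (\<beta> p - \<beta> q) * C p + \<beta> q * (C p - C q)\<bar>"
        unfolding a_eq[OF pq(1)] a_eq[OF pq(2)] by (simp add: algebra_simps)
      also have "\<dots> \<le> 2 * \<rho> + 6 * R ^ 4 * \<rho> * (2 * R\<^sup>2) + R * (2 * \<rho>)"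
        using d(3) m[OF dB C2[OF pq(1)]] m[of "\<beta> q" R, OF _ d(2)] bd[OF pq(2)] by linarith
      also have "\<dots> \<le> 16 * R ^ 6 * \<rho>"
      proof -
        have "6 * R ^ 4 * \<rho> * (2 * R\<^sup>2) = 12 * R ^ 6 * \<rho>" by (simp add: numeral_eq_Suc)
        moreover have "2 * \<rho> \<le> 2 * R ^ 6 * \<rho>" using Rp[of 6] \<rho>0 mult_right_mono[of 1 "R ^ 6" \<rho>] by simp
        moreover have "R * (2 * \<rho>) \<le> 2 * R ^ 6 * \<rho>" using RR[of 1] \<rho>0 mult_right_mono[of R "R ^ 6" \<rho>] by simp
        ultimately show ?thesis by linarith
      qed
      finally show ?thesis .
    qed
    have "\<bar>\<zeta> p - \<zeta> q\<bar> \<le> 2 * R ^ 2 * \<rho>" using dz by (simp add: power2_eq_square mult_ac)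
    from R1[OF this] R1[OF dB] R1[OF dC] dA nrm[of p q] show ?thesis by simp
  qed
  have inj: "inj_on \<Phi> L"
  proof (rule inj_onI)
    fix p q assume "p \<in> L" "q \<in> L" "\<Phi> p = \<Phi> q"
    then have "norm (p - q) \<le> 30 * R ^ 6 * 0" by (intro close) (auto simp: \<Phi>_def)
    then show "p = q" by simp
  qed
  have sp: "real (card (\<Phi> ` L \<inter> qb a \<rho>)) \<le> Q * (\<rho> / \<delta>)\<^sup>2" if \<rho>: "\<delta> \<le> \<rho>" for a \<rho>
  proof (cases "\<Phi> ` L \<inter> qb a \<rho> = {}")
    case True
    then show ?thesis using Q1 by (simp only: card.empty) simp
  next
    case False
    then obtain p0 where p0: "p0 \<in> L" "\<Phi> p0 \<in> qb a \<rho>" by auto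
    define \<rho>' where "\<rho>' = 31 * R ^ 6 * \<rho>"
    have \<rho>0: "0 < \<rho>" using \<rho> \<delta> by linarith
    have R31: "1 \<le> 31 * R ^ 6" using Rp[of 6] by linarith
    have "1 * \<rho> \<le> 31 * R ^ 6 * \<rho>" using R31 \<rho>0 by (intro mult_right_mono) auto
    then have \<rho>': "\<delta> \<le> \<rho>'" using \<rho> unfolding \<rho>'_def by linarith
    have sub: "\<Phi> ` L \<inter> qb a \<rho> \<subseteq> \<Phi> ` (L \<inter> ball p0 \<rho>')"
    proof
      fix y assume "y \<in> \<Phi> ` L \<inter> qb a \<rho>"
      then obtain p where p: "p \<in> L" "y = \<Phi> p" "\<Phi> p \<in> qb a \<rho>" by auto
      have "norm (p0 - p) \<le> 30 * R ^ 6 * \<rho>"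
        using p0 p by (intro close) (auto simp: \<Phi>_def qb_def)
      also have "\<dots> < \<rho>'" using R \<rho>0 by (simp add: \<rho>'_def)
      finally have "p \<in> ball p0 \<rho>'" by (simp add: dist_norm)
      then show "y \<in> \<Phi> ` (L \<inter> ball p0 \<rho>')" using p by blast
    qed
    have "card (\<Phi> ` L \<inter> qb a \<rho>) \<le> card (\<Phi> ` (L \<inter> ball p0 \<rho>'))"
      using finL by (intro card_mono sub) auto
    also have "\<dots> \<le> card (L \<inter> ball p0 \<rho>')" using finL by (intro card_image_le) auto
    finally have c1: "real (card (\<Phi> ` L \<inter> qb a \<rho>)) \<le> real (card (L \<inter> ball p0 \<rho>'))" by simp
    have "real (card (L \<inter> ball p0 \<rho>')) \<le> N1 * (\<rho>' / \<delta>)\<^sup>2"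
    proof (cases "\<rho>' \<le> 1")
      case True
      have "real (card (L \<inter> ball p0 \<rho>')) \<le> 1 * (\<rho>' / \<delta>)\<^sup>2" using ball[OF \<rho>' True] by simp
      also have "\<dots> \<le> N1 * (\<rho>' / \<delta>)\<^sup>2" using N1(1) by (intro mult_right_mono) auto
      finally show ?thesis .
    next
      case False
      have "real (card (L \<inter> ball p0 \<rho>')) \<le> real (card L)" using finL by (simp add: card_mono)
      also have "\<dots> \<le> N1 * (1 / \<delta>\<^sup>2)" using N1(2) by simp
      also have "\<dots> \<le> N1 * (\<rho>' / \<delta>)\<^sup>2"
        using N1(1) False one_le_power[of \<rho>' 2] by (intro mult_left_mono) (auto simp: power_divide divide_right_mono)
      finally show ?thesis .
    qed
    also have "\<dots> = Q * (\<rho> / \<delta>)\<^sup>2" by (simp add: Q \<rho>'_def power_divide power_mult_distrib)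
    finally show ?thesis using c1 by linarith
  qed
  have rich: "(lam / (4 * R)) / \<delta> \<le> real (card {j. \<exists>m l. (j, m, l) \<in> E \<and>
        \<bar>W p + C p * (of_int j * \<delta>) - of_int m * \<delta>\<bar> \<le> Q * \<delta> \<and>
        \<bar>W p * (of_int j * \<delta>) - B p - of_int l * \<delta>\<bar> \<le> Q * \<delta>})" if p: "p \<in> L" for p
  proof -
    let ?H = "{j. \<exists>m l. (j, m, l) \<in> E \<and> \<bar>W p + C p * (of_int j * \<delta>) - of_int m * \<delta>\<bar> \<le> Q * \<delta> \<and>
        \<bar>W p * (of_int j * \<delta>) - B p - of_int l * \<delta>\<bar> \<le> Q * \<delta>}"
    have "?H \<subseteq> fst ` E" by force
    then have finH: "finite ?H" by (rule finite_subset) (use KK(1) in \<open>simp add: E_def\<close>)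
    let ?T = "{s. \<exists>x\<in>KK. \<bar>\<alpha> p + s * \<gamma> p - of_int (fst x) * \<delta>\<bar> \<le> \<delta> \<and> \<bar>\<beta> p + s * \<zeta> p - of_int (fst (snd x)) * \<delta>\<bar> \<le> \<delta> \<and>
        \<bar>s - of_int (snd (snd x)) * \<delta>\<bar> \<le> \<delta>}"
    \<comment> \<open>The parameter at which the line crosses y = j \<delta>. As \<bar>W\<bar> is at
      most 2 R, a slice accounts for parameters within 2 R \<delta> of it, which explains the later
      division of lam by 4 R.\<close>
    let ?c = "\<lambda>j::int. (of_int j * \<delta> - \<beta> p) * W p"
    have \<zeta>W: "\<zeta> p * W p = 1" using \<zeta>0[OF p] by (simp add: W_def)
    have cover: "?T \<subseteq> (\<Union>j\<in>?H. {?c j - 2 * R * \<delta>..?c j + 2 * R * \<delta>})"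
    proof
      fix s assume "s \<in> ?T"
      then obtain x where x: "x \<in> KK" and h: "\<bar>\<alpha> p + s * \<gamma> p - of_int (fst x) * \<delta>\<bar> \<le> \<delta>"
        "\<bar>\<beta> p + s * \<zeta> p - of_int (fst (snd x)) * \<delta>\<bar> \<le> \<delta>" "\<bar>s - of_int (snd (snd x)) * \<delta>\<bar> \<le> \<delta>"
        by blast
      define j where "j = fst (snd x)"
      define y where "y = \<beta> p + s * \<zeta> p"
      have yj: "\<bar>of_int j * \<delta> - y\<bar> \<le> \<delta>" using h(2) by (simp add: j_def y_def abs_minus_commute)
      have wy: "W p * y = B p + s"
      proof -
        have "W p * y = \<beta> p * W p + s * (\<zeta> p * W p)" by (simp add: y_def algebra_simps)
        then show ?thesis by (simp add: \<zeta>W BW)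
      qed
      have Cz: "C p * \<zeta> p = of_int om * \<gamma> p"
        using \<zeta>0[OF p] by (simp add: C_def)
      have cy: "W p + C p * y = of_int om * (\<alpha> p + s * \<gamma> p)"
      proof -
        have "W p + C p * y = (W p + \<beta> p * C p) + s * (C p * \<zeta> p)" by (simp add: y_def algebra_simps)
        then show ?thesis unfolding Cz a_eq[OF p, symmetric] by (simp add: algebra_simps)
      qed
      have R6: "1 + 2 * R\<^sup>2 \<le> Q" "1 + 2 * R \<le> Q"
        using RR[of 2] RR[of 1] Rp[of 6] Q0 by auto
      have 1: "\<bar>W p + C p * (of_int j * \<delta>) - of_int (om * fst x) * \<delta>\<bar> \<le> Q * \<delta>"
      proof -
        have "W p + C p * (of_int j * \<delta>) - of_int (om * fst x) * \<delta> = (W p + C p * y - of_int om * (of_int (fst x) * \<delta>)) + C p * (of_int j * \<delta> - y)"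
          by (simp add: algebra_simps)
        also have "\<dots> = of_int om * (\<alpha> p + s * \<gamma> p - of_int (fst x) * \<delta>) + C p * (of_int j * \<delta> - y)"
          unfolding cy by (simp add: algebra_simps)
        finally have "\<bar>W p + C p * (of_int j * \<delta>) - of_int (om * fst x) * \<delta>\<bar> \<le> \<bar>of_int om * (\<alpha> p + s * \<gamma> p - of_int (fst x) * \<delta>)\<bar> + \<bar>C p * (of_int j * \<delta> - y)\<bar>"
          by (simp only: abs_triangle_ineq)
        also have "\<dots> \<le> \<delta> + 2 * R\<^sup>2 * \<delta>"
          using h(1) m[OF C2[OF p] yj] by (intro add_mono) (auto simp: abs_mult om2)
        also have "\<dots> = (1 + 2 * R\<^sup>2) * \<delta>" by (simp add: distrib_right)
        also have "\<dots> \<le> Q * \<delta>" using R6 \<delta> by (intro mult_right_mono) auto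
        finally show ?thesis .
      qed
      have 2: "\<bar>W p * (of_int j * \<delta>) - B p - of_int (snd (snd x)) * \<delta>\<bar> \<le> Q * \<delta>"
      proof -
        have "W p * (of_int j * \<delta>) - B p - of_int (snd (snd x)) * \<delta> = (W p * y - B p - of_int (snd (snd x)) * \<delta>) + W p * (of_int j * \<delta> - y)"
          by (simp add: algebra_simps)
        also have "\<dots> = (s - of_int (snd (snd x)) * \<delta>) + W p * (of_int j * \<delta> - y)"
          unfolding wy by simp
        finally have "\<bar>W p * (of_int j * \<delta>) - B p - of_int (snd (snd x)) * \<delta>\<bar> \<le> \<bar>s - of_int (snd (snd x)) * \<delta>\<bar> + \<bar>W p * (of_int j * \<delta> - y)\<bar>"
          by (simp only: abs_triangle_ineq)
        also have "\<dots> \<le> \<delta> + 2 * R * \<delta>"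
          using h(3) m[OF W2[OF p] yj] by (intro add_mono) auto
        also have "\<dots> = (1 + 2 * R) * \<delta>" by (simp add: distrib_right)
        also have "\<dots> \<le> Q * \<delta>" using R6 \<delta> by (intro mult_right_mono) auto
        finally show ?thesis .
      qed
      have jE: "(j, om * fst x, snd (snd x)) \<in> E" using x by (auto simp: E_def j_def)
      have jH: "j \<in> ?H" using jE 1 2 by blast
      have "?c j - s = (of_int j * \<delta> - y) * W p + s * (\<zeta> p * W p) - s" by (simp add: y_def algebra_simps)
      then have "\<bar>?c j - s\<bar> \<le> \<delta> * (2 * R)"
        using m[OF yj W2[OF p]] by (simp add: \<zeta>W)
      then have "s \<in> {?c j - 2 * R * \<delta>..?c j + 2 * R * \<delta>}"
        by (simp add: abs_le_iff mult_ac)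
      then show "s \<in> (\<Union>j\<in>?H. {?c j - 2 * R * \<delta>..?c j + 2 * R * \<delta>})" using jH by blast
    qed
    have "lam \<le> real (card ?H) * (2 * (2 * R * \<delta>))"
      by (rule card_ge_of_interval_cover[OF finH cover _ T[OF p] lam]) (use R \<delta> in simp)
    then show ?thesis using R \<delta> by (simp add: divide_le_eq mult_ac)
  qed
  interpret discrete_kakeya \<delta> Q "lam / (4 * R)" k n "\<Phi> ` L" E
  proof (unfold_locales)
    show "1 \<le> Q" by fact
    show "0 < \<delta>" "\<delta> \<le> 1/8" "8 \<le> k" by fact+
    show "0 < lam / (4 * R)" using lam R by simp
    show "8 * Q\<^sup>2 * \<delta> * real k ^ (2 * (n + 2)) \<le> 1" "1 \<le> 8 * Q\<^sup>2 * \<delta> * (2 * real k) ^ (2 * (n + 2))" by fact+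
    show "finite (\<Phi> ` L)" "finite E" using finL KK(1) by (simp_all add: E_def)
    have RQ: "2 * R \<le> Q" "2 * R\<^sup>2 \<le> Q" "R \<le> Q" using RR[of 1] RR[of 2] Q0 Rp[of 6] by auto
    show "\<bar>fst p\<bar> \<le> Q \<and> \<bar>fst (snd p)\<bar> \<le> Q \<and> \<bar>snd (snd p)\<bar> \<le> Q" if pL: "p \<in> \<Phi> ` L" for p
    proof -
      obtain q where q: "q \<in> L" "p = \<Phi> q" using pL by blast
      show ?thesis using B2[OF q(1)] C2[OF q(1)] W2[OF q(1)] RQ by (simp add: q(2) \<Phi>_def)
    qed
    show "\<bar>of_int (fst x) * \<delta>\<bar> \<le> Q" if xE: "x \<in> E" for x
    proof -
      obtain z where z: "z \<in> KK" "fst x = fst (snd z)" using xE by (auto simp: E_def)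
      show ?thesis using KK(2)[OF z(1)] RQ by (simp add: z(2))
    qed
    show "lam / (4 * R) / \<delta> \<le> real (card {j. \<exists>m l. (j, m, l) \<in> E \<and>
        \<bar>snd (snd p) + fst (snd p) * (of_int j * \<delta>) - of_int m * \<delta>\<bar> \<le> Q * \<delta> \<and>
        \<bar>snd (snd p) * (of_int j * \<delta>) - fst p - of_int l * \<delta>\<bar> \<le> Q * \<delta>})" if pL: "p \<in> \<Phi> ` L" for p
    proof -
      obtain q where q: "q \<in> L" "p = \<Phi> q" using pL by blast
      show ?thesis using rich[OF q(1)] by (simp only: q(2) \<Phi>_def fst_conv snd_conv)
    qed
    show "real (card (\<Phi> ` L \<inter> qb a \<rho>)) \<le> Q * (\<rho> / \<delta>)\<^sup>2" if "\<delta> \<le> \<rho>" for a \<rho>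
      by (rule sp[OF that])
  qed
  have "card E \<le> card KK" unfolding E_def using KK(1) by (rule card_image_le)
  moreover have "0 \<le> CC"
    unfolding CC_def using constants ct_pos Q1
    by (intro divide_nonneg_nonneg mult_nonneg_nonneg zero_le_power) auto
  ultimately have "CC * real k ^ 128 * (\<delta> ^ 3 * real (card E)) \<le> CC * real k ^ 128 * (\<delta> ^ 3 * real (card KK))"
    using \<delta> by (intro mult_left_mono) auto
  then show ?thesis using discrete_bound card_image[OF inj] by simp
qed

section \<open>Unions of cubes, choice of the scale, and assembly\<close>

lemma delta_cube_eq_cbox: "delta_cube \<delta> k = cbox (\<chi> i. \<delta> * of_int (k $ i)) (\<chi> i. \<delta> * (of_int (k $ i) + 1))"
  by (auto simp: delta_cube_def mem_box_cart)

lemma measure_delta_cube: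
  assumes "0 < \<delta>"
  shows "measure lebesgue (delta_cube \<delta> k) = \<delta> ^ 3"
proof -
  have "(\<chi> i. \<delta> * of_int (k $ i)) \<in> cbox (\<chi> i. \<delta> * of_int (k $ i)) (\<chi> i. \<delta> * (of_int (k $ i) + 1))"
    using assms by (simp add: mem_box_cart)
  then have ne: "cbox (\<chi> i. \<delta> * of_int (k $ i)) (\<chi> i. \<delta> * (of_int (k $ i) + 1)) \<noteq> {}" by blast
  show ?thesis
    unfolding delta_cube_eq_cbox using content_cbox_cart[OF ne] by (simp add: algebra_simps power3_eq_cube)
qed

text \<open>The closed cubes overlap, but two different ones only within a coordinate
  hyperplane.\<close>

lemma measure_Union_delta_cubes:
  assumes "0 < \<delta>" "finite K"
  shows "measure lebesgue (\<Union>k\<in>K. delta_cube \<delta> k) = \<delta> ^ 3 * real (card K)"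
proof -
  have "measure lebesgue (\<Union> (delta_cube \<delta> ` K)) = (\<Sum>k\<in>K. measure lebesgue (delta_cube \<delta> k))"
  proof (rule measure_negligible_finite_Union_image)
    show "finite K" by fact
    show "delta_cube \<delta> k \<in> lmeasurable" for k by (simp add: delta_cube_eq_cbox)
    show "pairwise (\<lambda>k l. negligible (delta_cube \<delta> k \<inter> delta_cube \<delta> l)) K"
    proof (rule pairwiseI)
      fix k l :: "int^3" assume "k \<noteq> l"
      then obtain i where i: "k $ i \<noteq> l $ i" by (auto simp: vec_eq_iff)
      have key: "x = \<delta> * (of_int b)" if "a < b" "x \<le> \<delta> * (of_int a + 1)" "\<delta> * of_int b \<le> x" for x and a b :: int
      proof -
        have "of_int a + 1 \<le> (of_int b :: real)" using that(1) by linarith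
        then have "\<delta> * (of_int a + 1) \<le> \<delta> * of_int b" using assms(1) by (intro mult_left_mono) auto
        then show ?thesis using that by linarith
      qed
      have "delta_cube \<delta> k \<inter> delta_cube \<delta> l \<subseteq> {x. x $ i = \<delta> * of_int (max (k $ i) (l $ i))}"
      proof
        fix x assume "x \<in> delta_cube \<delta> k \<inter> delta_cube \<delta> l"
        then have "\<delta> * of_int (k $ i) \<le> x $ i" "x $ i \<le> \<delta> * (of_int (k $ i) + 1)" "\<delta> * of_int (l $ i) \<le> x $ i" "x $ i \<le> \<delta> * (of_int (l $ i) + 1)"
          by (auto simp: delta_cube_def)
        then show "x \<in> {x. x $ i = \<delta> * of_int (max (k $ i) (l $ i))}"
          using key[of "k $ i" "l $ i" "x $ i"] key[of "l $ i" "k $ i" "x $ i"] i by (auto simp: max_def)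
      qed
      moreover have "negligible {x::real^3. x $ i = \<delta> * of_int (max (k $ i) (l $ i))}"
        unfolding cart_eq_inner_axis by (rule negligible_standard_hyperplane) (simp add: axis_in_Basis_iff)
      ultimately show "negligible (delta_cube \<delta> k \<inter> delta_cube \<delta> l)"
        by (rule negligible_subset[rotated])
    qed
  qed
  then show ?thesis using assms by (simp add: measure_delta_cube mult.commute)
qed

lemma delta_cubes_bounded:
  assumes "0 < \<delta>" "(\<Union>k\<in>K. delta_cube \<delta> k) \<subseteq> ball 0 R"
  shows "k \<in> K \<Longrightarrow> \<bar>of_int (k $ i) * \<delta>\<bar> \<le> R" "finite K"
proof -
  have b: "\<bar>of_int (k $ i) * \<delta>\<bar> \<le> R" if "k \<in> K" for k i
  proof -
    have "(\<chi> i. \<delta> * of_int (k $ i)) \<in> delta_cube \<delta> k" using assms(1) by (simp add: delta_cube_def)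
    then have "norm (\<chi> i. \<delta> * of_int (k $ i) :: real^3) < R" using assms(2) that by (auto simp: subset_iff)
    moreover have "\<bar>(\<chi> i. \<delta> * of_int (k $ i) :: real^3) $ i\<bar> \<le> norm (\<chi> i. \<delta> * of_int (k $ i) :: real^3)"
      by (rule component_le_norm_cart)
    ultimately show ?thesis by (simp add: mult.commute)
  qed
  then show "k \<in> K \<Longrightarrow> \<bar>of_int (k $ i) * \<delta>\<bar> \<le> R" .
  define f where "f = (\<lambda>k::int^3. (k $ 1, k $ 2, k $ 3))"
  define S where "S = {j::int. - (R / \<delta>) \<le> of_int j \<and> of_int j \<le> R / \<delta>}"
  have "finite S"
  proof (cases "- (R / \<delta>) \<le> R / \<delta>")
    case True
    show ?thesis by (rule card_int_interval_le(1)[OF _ True]) (simp add: S_def)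
  next
    case False
    then have "S = {}" by (auto simp: S_def)
    then show ?thesis by simp
  qed
  have inj: "inj f" by (rule injI) (simp add: f_def vec_eq_iff forall_3)
  have "f ` K \<subseteq> S \<times> S \<times> S"
  proof -
    have "k $ i \<in> S" if "k \<in> K" for k i
    proof -
      have "of_int (k $ i) * \<delta> \<le> R" "- R \<le> of_int (k $ i) * \<delta>" using b[OF that, of i] by (auto simp: abs_le_iff)
      then have "of_int (k $ i) \<le> R / \<delta>" "- R / \<delta> \<le> of_int (k $ i)"
        using assms(1) by (simp_all only: pos_le_divide_eq pos_divide_le_eq)
      then show ?thesis by (simp add: S_def)
    qed
    then show ?thesis by (auto simp: f_def)
  qed
  then have "finite (f ` K)" by (rule finite_subset) (use \<open>finite S\<close> in simp)
  then show "finite K" using inj by (metis finite_imageD inj_on_subset subset_UNIV)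
qed

text \<open>The ball condition stops at radius 1; covering the ball of radius R by unit balls turns
  it into a bound for the whole of \<open>L\<close>, at the cost of a constant depending on
  R.\<close>

lemma finite_unit_ball_cover:
  fixes R :: real
  obtains N :: nat where "\<And>(L :: (real^4) set) \<delta>. finite L \<Longrightarrow> L \<subseteq> ball 0 R \<Longrightarrow>
     (\<And>x. real (card (L \<inter> ball x 1)) \<le> (1 / \<delta>)\<^sup>2) \<Longrightarrow> real (card L) \<le> real N * (1 / \<delta>)\<^sup>2"
proof -
  obtain S where S: "finite S" "cball (0::real^4) R \<subseteq> (\<Union>x\<in>S. ball x 1)"
    using compact_cball[of "0::real^4" R] unfolding compact_eq_totally_bounded by (metis zero_less_one)
  have "real (card L) \<le> real (card S) * (1 / \<delta>)\<^sup>2"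
    if "finite L" "L \<subseteq> ball 0 R" "\<And>x. real (card (L \<inter> ball x 1)) \<le> (1 / \<delta>)\<^sup>2" for L :: "(real^4) set" and \<delta> :: real
  proof -
    have "L \<subseteq> (\<Union>x\<in>S. L \<inter> ball x 1)" using that(2) S(2) ball_subset_cball[of "0::real^4" R] by blast
    then have "card L \<le> card (\<Union>x\<in>S. L \<inter> ball x 1)" using that(1) S(1) by (intro card_mono) auto
    also have "\<dots> \<le> (\<Sum>x\<in>S. card (L \<inter> ball x 1))" by (rule card_UN_le[OF S(1)])
    finally have "real (card L) \<le> (\<Sum>x\<in>S. real (card (L \<inter> ball x 1)))" by (simp flip: of_nat_sum)
    also have "\<dots> \<le> (\<Sum>x\<in>S. (1 / \<delta>)\<^sup>2)" by (intro sum_mono that(3))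
    finally show ?thesis by simp
  qed
  then show ?thesis using that by blast
qed

text \<open>Take the largest admissible integer; its successor is at most twice as large and
  violates the first inequality, which gives the second.\<close>

lemma exists_scale:
  fixes D :: real
  assumes "0 < D" "D * 8 ^ m \<le> 1" "0 < m"
  obtains k :: nat where "8 \<le> k" "D * real k ^ m \<le> 1" "1 \<le> D * (2 * real k) ^ m"
proof -
  define bad where "bad = (\<lambda>i::nat. 1 < D * real i ^ m)"
  have "\<exists>i. bad i"
  proof -
    obtain i :: nat where i: "1 / D < real i" using reals_Archimedean2 by blast
    have "1 / D < real (Suc i)" using i by simp
    also have "\<dots> \<le> real (Suc i) ^ m" using assms(3) by (intro self_le_power) auto
    finally show ?thesis using assms(1) by (auto simp: bad_def pos_divide_less_eq mult.commute intro!: exI[of _ "Suc i"])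
  qed
  define l where "l = (LEAST i. bad i)"
  have bl: "bad l" unfolding l_def using \<open>\<exists>i. bad i\<close> by (rule LeastI_ex)
  have "8 < l"
  proof (rule ccontr)
    assume "\<not> 8 < l"
    then have "D * real l ^ m \<le> D * 8 ^ m" using assms(1) by (intro mult_left_mono power_mono) auto
    then show False using bl assms(2) by (simp add: bad_def)
  qed
  define k where "k = l - 1"
  have k: "8 \<le> k" "l = Suc k" using \<open>8 < l\<close> by (auto simp: k_def)
  have "\<not> bad k" unfolding l_def[symmetric] using not_less_Least[of k bad] k(2) by (simp add: l_def)
  then have "D * real k ^ m \<le> 1" by (simp add: bad_def)
  moreover have "1 \<le> D * (2 * real k) ^ m"
  proof -
    have "D * real l ^ m \<le> D * (2 * real k) ^ m" using assms(1) k by (intro mult_left_mono power_mono) auto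
    then show ?thesis using bl by (simp add: bad_def)
  qed
  ultimately show ?thesis using that k(1) by blast
qed

text \<open>The factor 8 \<open>R\<^sup>2\<close> is 2 R for the speed of the parametrisation times
  4 R from \<open>chart_bound\<close>; the factor 2 on the right is the number of charts.\<close>

lemma SL2_bound:
  fixes L :: "(real^4) set" and E :: "(real^3) set"
  assumes R: "1 \<le> R" and N1: "1 \<le> N1" "real (card L) \<le> N1 / \<delta>\<^sup>2" and Q: "Q = N1 * (31 * R ^ 6)\<^sup>2"
    and \<delta>: "0 < \<delta>" "\<delta> \<le> 1/8" and k: "8 \<le> k"
    and k_le: "8 * Q\<^sup>2 * \<delta> * real k ^ (2 * (n + 2)) \<le> 1" and k_ge: "1 \<le> 8 * Q\<^sup>2 * \<delta> * (2 * real k) ^ (2 * (n + 2))"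
    and finL: "finite L" and L: "L \<subseteq> {p. SL2_param p} \<inter> ball 0 R"
    and ball: "\<And>r x. \<delta> \<le> r \<Longrightarrow> r \<le> 1 \<Longrightarrow> real (card (L \<inter> ball x r)) \<le> (r / \<delta>)\<^sup>2"
    and E: "union_of_delta_cubes \<delta> E" "E \<subseteq> ball 0 R" and lam: "0 < lam" "\<And>p. p \<in> L \<Longrightarrow> lam \<le> line_meas p E"
  shows "(lam / (8 * R\<^sup>2)) ^ 7 * (\<delta>\<^sup>2 * real (card L)) \<le> 2 * discrete_kakeya.CC Q n * real k ^ 128 * measure lebesgue E"
proof -
  obtain K where EK: "E = (\<Union>k\<in>K. delta_cube \<delta> k)" using E(1) by (auto simp: union_of_delta_cubes_def)
  have finK: "finite K" and Kb: "\<And>k i. k \<in> K \<Longrightarrow> \<bar>of_int (k $ i) * \<delta>\<bar> \<le> R"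
    using delta_cubes_bounded[OF \<delta>(1) E(2)[unfolded EK]] by blast+
  have mE: "measure lebesgue E = \<delta> ^ 3 * real (card K)"
    unfolding EK by (rule measure_Union_delta_cubes[OF \<delta>(1) finK])
  have comp: "\<bar>p $ i\<bar> \<le> R" if "p \<in> L" for p i
  proof -
    have "norm p < R" using that L by auto
    then show ?thesis using component_le_norm_cart[of p i] by linarith
  qed
  have det: "p $ 1 * p $ 4 - p $ 2 * p $ 3 = 1" if "p \<in> L" for p
    using that L by (auto simp: SL2_param_def)
  have meas: "lam / (2 * R) \<le> measure lebesgue {s. line_of p s \<in> E}" if p: "p \<in> L" for p
  proof -
    have "(p $ 3)\<^sup>2 \<le> R\<^sup>2" "(p $ 4)\<^sup>2 \<le> R\<^sup>2"
      using power_mono[OF comp[OF p, of 3], of 2] power_mono[OF comp[OF p, of 4], of 2] by auto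
    moreover have "1 \<le> R\<^sup>2" using R by simp
    ultimately have "(p $ 3)\<^sup>2 + (p $ 4)\<^sup>2 + 1 \<le> (2 * R)\<^sup>2" by (simp add: power_mult_distrib)
    then have "sqrt ((p $ 3)\<^sup>2 + (p $ 4)\<^sup>2 + 1) \<le> 2 * R" using R by (intro real_le_lsqrt) auto
    then have "line_meas p E \<le> 2 * R * measure lebesgue {s. line_of p s \<in> E}"
      unfolding line_meas_def by (intro mult_right_mono) auto
    then have "lam \<le> measure lebesgue {s. line_of p s \<in> E} * (2 * R)" using lam(2)[OF p] by (simp add: mult.commute)
    then show ?thesis using R by (subst pos_divide_le_eq) auto
  qed
  have inE: "line_of p s \<in> E \<longleftrightarrow> (\<exists>k\<in>K. (\<delta> * of_int (k $ 1) \<le> p $ 1 + s * p $ 3 \<and> p $ 1 + s * p $ 3 \<le> \<delta> * (of_int (k $ 1) + 1)) \<and>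
      (\<delta> * of_int (k $ 2) \<le> p $ 2 + s * p $ 4 \<and> p $ 2 + s * p $ 4 \<le> \<delta> * (of_int (k $ 2) + 1)) \<and>
      (\<delta> * of_int (k $ 3) \<le> s \<and> s \<le> \<delta> * (of_int (k $ 3) + 1)))" for p s
    unfolding EK by (simp add: delta_cube_def line_of_def forall_3 vector_3)
  have sm: "{s. line_of p s \<in> E} \<in> sets lebesgue" if "p \<in> L" for p
    using meas[OF that] measure_notin_sets[of "{s. line_of p s \<in> E}" lebesgue] lam(1) R
    by (smt (verit) divide_pos_pos)
  have nr: "norm (p - q) \<le> \<bar>p $ 1 - q $ 1\<bar> + \<bar>p $ 2 - q $ 2\<bar> + \<bar>p $ 3 - q $ 3\<bar> + \<bar>p $ 4 - q $ 4\<bar>" for p q :: "real^4"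
    using norm_le_l1_cart[of "p - q"] by (simp add: sum_4)
  \<comment> \<open>From a d - b c = 1 with \<bar>a\<bar> and \<bar>b\<bar> at most R, one of
    \<bar>c\<bar> and \<bar>d\<bar> is at least 1 / (2 R), so the two charts cover
    \<open>L\<close>.\<close>
  define L1 where "L1 = {p\<in>L. 1 \<le> 2 * R * \<bar>p $ 4\<bar>}"
  define L2 where "L2 = {p\<in>L. 1 \<le> 2 * R * \<bar>p $ 3\<bar>}"
  have sub: "L1 \<subseteq> L" "L2 \<subseteq> L" by (auto simp: L1_def L2_def)
  have un: "L \<subseteq> L1 \<union> L2"
  proof
    fix p assume p: "p \<in> L"
    have "\<bar>p $ 1 * p $ 4\<bar> \<le> R * \<bar>p $ 4\<bar>" "\<bar>p $ 2 * p $ 3\<bar> \<le> R * \<bar>p $ 3\<bar>"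
      unfolding abs_mult using comp[OF p] by (auto intro!: mult_right_mono)
    then have "1 \<le> R * \<bar>p $ 4\<bar> + R * \<bar>p $ 3\<bar>" using det[OF p] by linarith
    then show "p \<in> L1 \<union> L2" using p by (auto simp: L1_def L2_def)
  qed
  have cardle: "real (card M) \<le> N1 / \<delta>\<^sup>2" "real (card (M \<inter> ball x r)) \<le> real (card (L \<inter> ball x r))" if "M \<subseteq> L" for M x r
  proof -
    have "card M \<le> card L" using finL that by (rule card_mono)
    then show "real (card M) \<le> N1 / \<delta>\<^sup>2" using N1(2) by linarith
    show "real (card (M \<inter> ball x r)) \<le> real (card (L \<inter> ball x r))"
      using finL that by (auto intro!: card_mono)
  qed
  let ?C = "discrete_kakeya.CC Q n * real k ^ 128"
  have lam2: "0 < lam / (2 * R)" using lam(1) R by simp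
  have l8: "lam / (2 * R) / (4 * R) = lam / (8 * R\<^sup>2)" by (simp add: power2_eq_square)
  have near: "\<bar>x - of_int i * \<delta>\<bar> \<le> \<delta>" if "\<delta> * of_int i \<le> x" "x \<le> \<delta> * (of_int i + 1)" for x and i :: int
    using that by (simp add: abs_le_iff algebra_simps)
  have mono: "lam / (2 * R) \<le> measure lebesgue T'" if "p \<in> L" "{s. line_of p s \<in> E} \<subseteq> T'" "T' \<in> lmeasurable" for p T'
    using meas[OF that(1)] measure_mono_fmeasurable[OF that(2) sm[OF that(1)] that(3)] by linarith
  have lm: "{s. \<exists>x\<in>KK. \<bar>a + s * c - u x\<bar> \<le> \<delta> \<and> \<bar>b + s * d - v x\<bar> \<le> \<delta> \<and> \<bar>s - w x\<bar> \<le> \<delta>} \<in> lmeasurable"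
    if "finite KK" for KK :: "(int \<times> int \<times> int) set" and a b c d and u v w :: "int \<times> int \<times> int \<Rightarrow> real"
  proof -
    have "{s. \<exists>x\<in>KK. \<bar>a + s * c - u x\<bar> \<le> \<delta> \<and> \<bar>b + s * d - v x\<bar> \<le> \<delta> \<and> \<bar>s - w x\<bar> \<le> \<delta>}
      = (\<Union>x\<in>KK. {s. \<bar>a + s * c - u x\<bar> \<le> \<delta>} \<inter> {s. \<bar>b + s * d - v x\<bar> \<le> \<delta>} \<inter> cball (w x) \<delta>)"
      by (auto simp: dist_real_def abs_minus_commute)
    moreover have "{s. \<bar>a + s * c - u x\<bar> \<le> \<delta>} \<inter> {s. \<bar>b + s * d - v x\<bar> \<le> \<delta>} \<inter> cball (w x) \<delta> \<in> lmeasurable" for x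
      by (intro lmeasurable_compact closed_Int_compact closed_Int closed_Collect_le continuous_intros) auto
    ultimately show ?thesis using that by (simp add: fmeasurable.finite_UN)
  qed
  let ?K1 = "(\<lambda>k::int^3. (k $ 1, k $ 2, k $ 3)) ` K" and ?K2 = "(\<lambda>k::int^3. (k $ 2, k $ 1, k $ 3)) ` K"
  have cK: "card ?K1 = card K" "card ?K2 = card K"
    by (auto intro!: card_image inj_onI simp: vec_eq_iff forall_3)
  have b1: "(lam / (8 * R\<^sup>2)) ^ 7 * (\<delta>\<^sup>2 * real (card L1)) \<le> ?C * (\<delta> ^ 3 * real (card K))"
    unfolding l8[symmetric] cK(1)[symmetric]
  proof (rule chart_bound[where \<alpha>="\<lambda>p. p $ 1" and \<beta>="\<lambda>p. p $ 2" and \<gamma>="\<lambda>p. p $ 3" and \<zeta>="\<lambda>p. p $ 4" and om=1, OF R _ _ _ _ _ _ N1(1) _ _ _ _ _ lam2 Q \<delta> k k_le k_ge])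
    show "real (card (L1 \<inter> ball x \<rho>)) \<le> (\<rho> / \<delta>)\<^sup>2" if "\<delta> \<le> \<rho>" "\<rho> \<le> 1" for x \<rho>
      by (rule order_trans[OF cardle(2)[OF sub(1)] ball[OF that]])
    show "lam / (2 * R) \<le> measure lebesgue {s. \<exists>x\<in>?K1. \<bar>p $ 1 + s * p $ 3 - of_int (fst x) * \<delta>\<bar> \<le> \<delta> \<and>
        \<bar>p $ 2 + s * p $ 4 - of_int (fst (snd x)) * \<delta>\<bar> \<le> \<delta> \<and> \<bar>s - of_int (snd (snd x)) * \<delta>\<bar> \<le> \<delta>}" if "p \<in> L1" for p
    proof (rule mono)
      show "p \<in> L" using that sub by blast
      show "{s. line_of p s \<in> E} \<subseteq> {s. \<exists>x\<in>?K1. \<bar>p $ 1 + s * p $ 3 - of_int (fst x) * \<delta>\<bar> \<le> \<delta> \<and>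
          \<bar>p $ 2 + s * p $ 4 - of_int (fst (snd x)) * \<delta>\<bar> \<le> \<delta> \<and> \<bar>s - of_int (snd (snd x)) * \<delta>\<bar> \<le> \<delta>}"
        unfolding inE by (auto intro!: near)
    qed (use finK in \<open>intro lm finite_imageI\<close>)
  qed (use finL sub comp det nr Kb finK cardle(1)[OF sub(1)] in \<open>auto simp: L1_def\<close>)
  have b2: "(lam / (8 * R\<^sup>2)) ^ 7 * (\<delta>\<^sup>2 * real (card L2)) \<le> ?C * (\<delta> ^ 3 * real (card K))"
    unfolding l8[symmetric] cK(2)[symmetric]
  proof (rule chart_bound[where \<alpha>="\<lambda>p. p $ 2" and \<beta>="\<lambda>p. p $ 1" and \<gamma>="\<lambda>p. p $ 4" and \<zeta>="\<lambda>p. p $ 3" and om="-1", OF R _ _ _ _ _ _ N1(1) _ _ _ _ _ lam2 Q \<delta> k k_le k_ge])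
    show "real (card (L2 \<inter> ball x \<rho>)) \<le> (\<rho> / \<delta>)\<^sup>2" if "\<delta> \<le> \<rho>" "\<rho> \<le> 1" for x \<rho>
      by (rule order_trans[OF cardle(2)[OF sub(2)] ball[OF that]])
    show "lam / (2 * R) \<le> measure lebesgue {s. \<exists>x\<in>?K2. \<bar>p $ 2 + s * p $ 4 - of_int (fst x) * \<delta>\<bar> \<le> \<delta> \<and>
        \<bar>p $ 1 + s * p $ 3 - of_int (fst (snd x)) * \<delta>\<bar> \<le> \<delta> \<and> \<bar>s - of_int (snd (snd x)) * \<delta>\<bar> \<le> \<delta>}" if "p \<in> L2" for p
    proof (rule mono)
      show "p \<in> L" using that sub by blast
      show "{s. line_of p s \<in> E} \<subseteq> {s. \<exists>x\<in>?K2. \<bar>p $ 2 + s * p $ 4 - of_int (fst x) * \<delta>\<bar> \<le> \<delta> \<and>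
          \<bar>p $ 1 + s * p $ 3 - of_int (fst (snd x)) * \<delta>\<bar> \<le> \<delta> \<and> \<bar>s - of_int (snd (snd x)) * \<delta>\<bar> \<le> \<delta>}"
        unfolding inE by (auto intro!: near)
    qed (use finK in \<open>intro lm finite_imageI\<close>)
    show "p $ 2 * p $ 3 - p $ 1 * p $ 4 = of_int (- 1)" if "p \<in> L2" for p
      using det[of p] that sub(2) by auto
    show "norm (p - q) \<le> \<bar>p $ 2 - q $ 2\<bar> + \<bar>p $ 1 - q $ 1\<bar> + \<bar>p $ 4 - q $ 4\<bar> + \<bar>p $ 3 - q $ 3\<bar>" for p q :: "real^4"
      using nr[of p q] by linarith
  qed (use finL sub comp Kb finK cardle(1)[OF sub(2)] in \<open>auto simp: L2_def\<close>)
  have "card L \<le> card L1 + card L2"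
    using card_mono[OF _ un] card_Un_le[of L1 L2] finite_subset[OF sub(1) finL] finite_subset[OF sub(2) finL] by simp
  then have "real (card L) \<le> real (card L1) + real (card L2)" by linarith
  then have "(lam / (8 * R\<^sup>2)) ^ 7 * (\<delta>\<^sup>2 * real (card L)) \<le> (lam / (8 * R\<^sup>2)) ^ 7 * (\<delta>\<^sup>2 * (real (card L1) + real (card L2)))"
    using lam(1) by (intro mult_left_mono) auto
  also have "\<dots> = (lam / (8 * R\<^sup>2)) ^ 7 * (\<delta>\<^sup>2 * real (card L1)) + (lam / (8 * R\<^sup>2)) ^ 7 * (\<delta>\<^sup>2 * real (card L2))"
    by (simp only: distrib_left)
  also have "\<dots> \<le> ?C * (\<delta> ^ 3 * real (card K)) + ?C * (\<delta> ^ 3 * real (card K))"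
    by (intro add_mono b1 b2)
  also have "\<dots> = 2 * discrete_kakeya.CC Q n * real k ^ 128 * measure lebesgue E"
    unfolding mE by simp
  finally show ?thesis .
qed

theorem theorem1p2:
  "\<forall>\<epsilon>>0. \<exists>M>0. \<forall>R>0. \<exists>\<delta>0>0. \<forall>\<delta>. 0 < \<delta> \<and> \<delta> \<le> \<delta>0 \<longrightarrow>
     (\<forall>(L :: (real^4) set) (E :: (real^3) set) (lam::real).
        finite L \<and> L \<subseteq> {p. SL2_param p} \<inter> ball 0 R \<and>
        (\<forall>r x. \<delta> \<le> r \<and> r \<le> 1 \<longrightarrow> real (card (L \<inter> ball x r)) \<le> (r / \<delta>)\<^sup>2) \<and>
        union_of_delta_cubes \<delta> E \<and> E \<subseteq> ball 0 R \<and>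
        0 < lam \<and> (\<forall>p\<in>L. line_meas p E \<ge> lam)
        \<longrightarrow> measure lebesgue E \<ge> \<delta> powr \<epsilon> * lam powr M * (\<delta>\<^sup>2 * real (card L)))"
proof (intro allI impI)
  fix \<epsilon> :: real assume \<epsilon>: "0 < \<epsilon>"
  \<comment> \<open>Since k^(2 (n + 2)) is at most 1 / \<delta>, the loss \<open>k ^ 128\<close> is
    at most \<delta> to the power -64 / (n + 2), and this choice of n makes it at most \<delta> to
    the power - \<epsilon> / 2.\<close>
  obtain n :: nat where n: "128 / \<epsilon> < real n" using reals_Archimedean2 by blast
  show "\<exists>M>0. \<forall>R>0. \<exists>\<delta>0>0. \<forall>\<delta>. 0 < \<delta> \<and> \<delta> \<le> \<delta>0 \<longrightarrow>
     (\<forall>(L :: (real^4) set) (E :: (real^3) set) (lam::real).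
        finite L \<and> L \<subseteq> {p. SL2_param p} \<inter> ball 0 R \<and>
        (\<forall>r x. \<delta> \<le> r \<and> r \<le> 1 \<longrightarrow> real (card (L \<inter> ball x r)) \<le> (r / \<delta>)\<^sup>2) \<and>
        union_of_delta_cubes \<delta> E \<and> E \<subseteq> ball 0 R \<and>
        0 < lam \<and> (\<forall>p\<in>L. line_meas p E \<ge> lam)
        \<longrightarrow> measure lebesgue E \<ge> \<delta> powr \<epsilon> * lam powr M * (\<delta>\<^sup>2 * real (card L)))"
  proof (rule exI[of _ 7], intro conjI allI impI)
    show "(0::real) < 7" by simp
    fix R' :: real assume "0 < R'"
    \<comment> \<open>Enlarging the radius weakens the containments and allows powers of R to be
      compared.\<close>
    define R where "R = max R' 1"
    have R: "1 \<le> R" "R' \<le> R" by (auto simp: R_def)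
    obtain N :: nat where N: "\<And>(L :: (real^4) set) \<delta>. finite L \<Longrightarrow> L \<subseteq> ball 0 R \<Longrightarrow>
       (\<And>x. real (card (L \<inter> ball x 1)) \<le> (1 / \<delta>)\<^sup>2) \<Longrightarrow> real (card L) \<le> real N * (1 / \<delta>)\<^sup>2"
      using finite_unit_ball_cover[of R] by blast
    define N1 where "N1 = real N + 1"
    define Q where "Q = N1 * (31 * R ^ 6)\<^sup>2"
    have Q0: "0 < Q" using R by (simp add: Q_def N1_def)
    define m where "m = 2 * (n + 2)"
    \<comment> \<open>Everything that depends only on n and R; the second half of the exponent
      \<epsilon> absorbs it.\<close>
    define D where "D = max 1 (2 * discrete_kakeya.CC Q n * (8 * R\<^sup>2) ^ 7)"
    have D1: "1 \<le> D" by (simp add: D_def)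
    \<comment> \<open>The three terms serve, in order, the standing assumption on \<delta>, the
      existence of an integer \<open>k\<close> of size at least 8, and the absorption of
      \<open>D\<close>.\<close>
    define \<delta>0 where "\<delta>0 = min (1/8) (min (1 / (8 * Q\<^sup>2 * 8 ^ m)) ((1 / D) powr (2 / \<epsilon>)))"
    have \<delta>0: "0 < \<delta>0" using Q0 D1 by (simp add: \<delta>0_def)
    show "\<exists>\<delta>0>0. \<forall>\<delta>. 0 < \<delta> \<and> \<delta> \<le> \<delta>0 \<longrightarrow>
     (\<forall>(L :: (real^4) set) (E :: (real^3) set) (lam::real).
        finite L \<and> L \<subseteq> {p. SL2_param p} \<inter> ball 0 R' \<and>
        (\<forall>r x. \<delta> \<le> r \<and> r \<le> 1 \<longrightarrow> real (card (L \<inter> ball x r)) \<le> (r / \<delta>)\<^sup>2) \<and>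
        union_of_delta_cubes \<delta> E \<and> E \<subseteq> ball 0 R' \<and>
        0 < lam \<and> (\<forall>p\<in>L. line_meas p E \<ge> lam)
        \<longrightarrow> measure lebesgue E \<ge> \<delta> powr \<epsilon> * lam powr 7 * (\<delta>\<^sup>2 * real (card L)))"
    proof (rule exI[of _ \<delta>0], intro conjI allI impI, rule \<delta>0)
      fix \<delta> :: real and L :: "(real^4) set" and E :: "(real^3) set" and lam :: real
      assume "0 < \<delta> \<and> \<delta> \<le> \<delta>0"
      then have \<delta>: "0 < \<delta>" "\<delta> \<le> 1/8" "\<delta> \<le> 1 / (8 * Q\<^sup>2 * 8 ^ m)" "\<delta> \<le> (1 / D) powr (2 / \<epsilon>)"
        by (auto simp: \<delta>0_def)
      assume H: "finite L \<and> L \<subseteq> {p. SL2_param p} \<inter> ball 0 R' \<and>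
        (\<forall>r x. \<delta> \<le> r \<and> r \<le> 1 \<longrightarrow> real (card (L \<inter> ball x r)) \<le> (r / \<delta>)\<^sup>2) \<and>
        union_of_delta_cubes \<delta> E \<and> E \<subseteq> ball 0 R' \<and> 0 < lam \<and> (\<forall>p\<in>L. line_meas p E \<ge> lam)"
      have lam: "0 < lam" using H by blast
      have "8 * Q\<^sup>2 * \<delta> * 8 ^ m \<le> 1" using \<delta>(3) Q0 by (simp add: pos_le_divide_eq mult_ac)
      then obtain k :: nat where k: "8 \<le> k" "8 * Q\<^sup>2 * \<delta> * real k ^ m \<le> 1" "1 \<le> 8 * Q\<^sup>2 * \<delta> * (2 * real k) ^ m"
        using exists_scale[of "8 * Q\<^sup>2 * \<delta>" m] Q0 \<delta>(1) by (auto simp: m_def)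
      have Lc: "real (card L) \<le> N1 / \<delta>\<^sup>2"
      proof -
        have "real (card L) \<le> real N * (1 / \<delta>)\<^sup>2"
        proof (rule N)
          show "finite L" using H by blast
          show "L \<subseteq> ball 0 R" using H subset_ball[OF R(2), of "0::real^4"] by blast
          have "\<forall>r x. \<delta> \<le> r \<and> r \<le> 1 \<longrightarrow> real (card (L \<inter> ball x r)) \<le> (r / \<delta>)\<^sup>2" using H by blast
          then show "real (card (L \<inter> ball x 1)) \<le> (1 / \<delta>)\<^sup>2" for x using \<delta>(2) by auto
        qed
        also have "\<dots> \<le> N1 * (1 / \<delta>)\<^sup>2" by (intro mult_right_mono) (auto simp: N1_def)
        finally show ?thesis by (simp add: power_divide)
      qed
      have main: "(lam / (8 * R\<^sup>2)) ^ 7 * (\<delta>\<^sup>2 * real (card L)) \<le> 2 * discrete_kakeya.CC Q n * real k ^ 128 * measure lebesgue E"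
      proof (rule SL2_bound[OF R(1) _ Lc Q_def \<delta>(1,2) k(1) k(2,3)[unfolded m_def]])
        show "L \<subseteq> {p. SL2_param p} \<inter> ball 0 R" using H subset_ball[OF R(2), of "0::real^4"] by blast
        show "E \<subseteq> ball 0 R" using H subset_ball[OF R(2), of "0::real^3"] by blast
      qed (use H in \<open>auto simp: N1_def\<close>)
      have k128: "real k ^ 128 \<le> \<delta> powr (- (\<epsilon> / 2))"
      proof -
        have Q1: "1 \<le> 8 * Q\<^sup>2"
        proof -
          have "1 \<le> 31 * R ^ 6" using one_le_power[OF R(1), of 6] by linarith
          then have "1 \<le> (31 * R ^ 6)\<^sup>2" by (rule one_le_power)
          moreover have "1 \<le> N1" by (simp add: N1_def)
          ultimately have "1 \<le> Q" using mult_mono[of 1 N1 1 "(31 * R ^ 6)\<^sup>2"] by (simp add: Q_def)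
          then show ?thesis using one_le_power[of Q 2] by linarith
        qed
        have "1 * (\<delta> * real k ^ m) \<le> 8 * Q\<^sup>2 * (\<delta> * real k ^ m)" using Q1 \<delta>(1) by (intro mult_right_mono) auto
        then have "\<delta> * real k ^ m \<le> 1" using k(2) by (simp add: mult.assoc)
        then have km: "real k ^ m \<le> 1 / \<delta>" using \<delta>(1) by (simp add: pos_le_divide_eq mult.commute)
        have k0: "0 < real k" using k(1) by simp
        have "real k ^ 128 = (real k ^ m) powr (128 / real m)"
        proof -
          have "(real k ^ m) powr (128 / real m) = (real k powr real m) powr (128 / real m)"
            using k0 by (simp add: powr_realpow)
          also have "\<dots> = real k powr (real m * (128 / real m))" by (rule powr_powr)
          also have "real m * (128 / real m) = real (128::nat)"
          proof -
            have "real m \<noteq> 0" by (simp add: m_def)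
            then show ?thesis by simp
          qed
          also have "real k powr real (128::nat) = real k ^ 128" using k0 by (rule powr_realpow)
          finally show ?thesis by (rule sym)
        qed
        also have "\<dots> \<le> (1 / \<delta>) powr (128 / real m)" using km k0 by (intro powr_mono2) auto
        also have "\<dots> \<le> (1 / \<delta>) powr (\<epsilon> / 2)"
        proof (rule powr_mono)
          have "128 < \<epsilon> * real n" using n \<epsilon> by (simp add: pos_divide_less_eq mult.commute)
          also have "\<epsilon> * real n \<le> \<epsilon> * (real n + 2)" using \<epsilon> by simp
          finally show "128 / real m \<le> \<epsilon> / 2" by (simp add: m_def field_simps)
          show "1 \<le> 1 / \<delta>" using \<delta> by simp
        qed
        also have "\<dots> = \<delta> powr (- (\<epsilon> / 2))" using \<delta>(1) by (simp add: powr_minus powr_divide inverse_eq_divide)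
        finally show ?thesis .
      qed
      have D\<delta>: "D * \<delta> powr (\<epsilon> / 2) \<le> 1"
      proof -
        have "\<delta> powr (\<epsilon> / 2) \<le> ((1 / D) powr (2 / \<epsilon>)) powr (\<epsilon> / 2)"
          using \<delta>(1,4) \<epsilon> by (intro powr_mono2) auto
        also have "\<dots> = 1 / D" using \<epsilon> D1 by (simp add: powr_powr)
        finally show ?thesis using D1 by (simp add: pos_le_divide_eq mult.commute)
      qed
      have mE: "0 \<le> measure lebesgue E" by simp
      have R8: "0 < 8 * R\<^sup>2" using R by simp
      have "\<delta> powr \<epsilon> * lam powr 7 * (\<delta>\<^sup>2 * real (card L)) = \<delta> powr \<epsilon> * (8 * R\<^sup>2) ^ 7 * ((lam / (8 * R\<^sup>2)) ^ 7 * (\<delta>\<^sup>2 * real (card L)))"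
        using lam R8 R by (simp add: power_divide)
      also have "\<dots> \<le> \<delta> powr \<epsilon> * (8 * R\<^sup>2) ^ 7 * (2 * discrete_kakeya.CC Q n * real k ^ 128 * measure lebesgue E)"
        using main by (intro mult_left_mono) auto
      also have "\<dots> = \<delta> powr \<epsilon> * (2 * discrete_kakeya.CC Q n * (8 * R\<^sup>2) ^ 7) * (real k ^ 128 * measure lebesgue E)"
        by (simp only: mult_ac)
      also have "\<dots> \<le> \<delta> powr \<epsilon> * D * (\<delta> powr (- (\<epsilon> / 2)) * measure lebesgue E)"
        using k128 D1 by (intro mult_mono mult_left_mono mult_right_mono) (auto simp: D_def)
      also have "\<dots> = (D * \<delta> powr (\<epsilon> / 2)) * measure lebesgue E"
      proof -
        have "\<delta> powr \<epsilon> * \<delta> powr (- (\<epsilon> / 2)) = \<delta> powr (\<epsilon> / 2)" by (simp add: powr_add[symmetric])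
        then show ?thesis by (metis (no_types, lifting) mult.assoc mult.commute)
      qed
      also have "\<dots> \<le> 1 * measure lebesgue E" using D\<delta> by (intro mult_right_mono) auto
      finally show "\<delta> powr \<epsilon> * lam powr 7 * (\<delta>\<^sup>2 * real (card L)) \<le> measure lebesgue E" by simp
    qed
  qed
qed

end
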